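(* Let $R$ be a Huber ring, $(A,\underline{\sigma})$ a twisted $R$-adic algebra of order $d$, and $\underline{x}=(x_1,\ldots,x_d)$ elements of $A$ which are (good) $\underline{\sigma}$-coordinates. Then $\underline{x}$ are classical if and only if, for each $i=1,\ldots,d$, the map $\partial_{\underline{\sigma},i}:A\to A$ is a $\sigma_i$-derivation.
   Context: Huber rings. All rings are unitary. A Huber ring is a commutative topological ring $A$ having an open subring $A_0$ (a ring of definition) and a finitely generated ideal $I_0\subset A_0$ (an ideal of definition) such that $\{I_0^n\}_n$ is a fundamental system of neighbourhoods of $0$ in $A_0$; it is an adic ring if one can take $A_0=A$. A morphism of Huber rings is a continuous ring homomorphism; $u:A\to B$ is adic if there are rings of definition $A_0,B_0$ and an ideal of definition $I_0$ of $A_0$ with $u(A_0)\subset B_0$ and $u(I_0)B_0$ an ideal of definition of $B$. An $R$-adic algebra is a Huber ring $A$ with an adic morphism $R\to A$. Polynomial rings $A[\underline X]$ are Huber rings with ring of definition $A_0[\underline X]$ and ideal of definition $I_0A_0[\underline X]$. Good étale coordinates. A morphism $\varphi:A\to B$ is topologically of finite presentation if it is adic and there are rings of definition $A_0,B_0$ with $\varphi(A_0)\subset B_0$ such that $A_0/I\to B_0/\varphi(I)B_0$ is of finite presentation for every ideal of definition $I\subset A_0$ and $A\otimes_{A_0}\widehat{B_0}\to\widehat B$ is of finite presentation. A morphism of adic rings $A\to B$ is formally étale if for every complete adic ring $C$, nilpotent ideal $\mathfrak c\subset C$, and commutative square of adic rings formed by $A\to C$, $B\to C/\mathfrak c$,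 $A\to B$, $C\to C/\mathfrak c$, there is a unique morphism $B\to C$ making the diagram commute; it is topologically étale if it is formally étale and topologically of finite presentation. A morphism $\varphi:A\to B$ of Huber rings is good étale, with good model $(\varphi_0,A_0,B_0)$, if $A_0,B_0$ are rings of definition with $\varphi(A_0)\subset B_0$, the induced $\varphi_0:A_0\to B_0$ is topologically étale and $B=A\otimes_{A_0}B_0$. Elements $x_1,\dots,x_d$ of a Huber $R$-algebra $A$ are good étale coordinates, with good model $(\varphi_0,R_0,A_0)$, if $\varphi:R[X_1,\dots,X_d]\to A$, $X_i\mapsto x_i$, is good étale with a good model of the form $\varphi_0:R_0[X_1,\dots,X_d]\to A_0$. Twisted algebras and coordinates. A twisted $R$-adic algebra of order $d$ is an $R$-adic algebra $A$ with pairwise commuting continuous $R$-linear ring endomorphisms $\underline{\sigma}=(\sigma_1,\dots,\sigma_d)$. Given $\underline x=(x_1,\dots,x_d)\in A^d$, put in $A[\underline\xi]=A[\xi_1,\dots,\xi_d]$, for $\underline k\in\mathbb N^d$, $\underline\xi^{(\underline k)_{\underline\sigma}}=\prod_{i=1}^d\prod_{j=0}^{k_i-1}(\xi_i+x_i-\sigma_i^j(x_i))$, and $P_{A,(n)_{\underline\sigma}}=A[\underline\xi]/(\underline\xi^{(\underline k)_{\underline\sigma}}: |\underline k|=n+1)$ with the quotient topology. It is a free $A$-module with basis $\{\underline\xi^{(\underline k)_{\underline\sigma}}\}_{|\underline k|\le n}$. The $x_i$ are $\underline\sigma$-coordinates if for every $n\in\mathbb N$ there is a unique adic morphism of $R$-algebras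 $\Theta_{A,(n)_{\underline\sigma}}:A\to P_{A,(n)_{\underline\sigma}}$ with $x_i\mapsto x_i+\xi_i$ whose composition with the projection $P_{A,(n)_{\underline\sigma}}\to A$, $\xi_i\mapsto0$, is the identity. They are good $\underline\sigma$-coordinates if they are good étale coordinates with a good model $(\varphi_0,R_0,A_0)$ such that $\sigma_i(A_0)\subset A_0$ for all $i$ and they are $\underline\sigma$-coordinates of the twisted $R_0$-adic algebra $(A_0,\underline\sigma)$; then $\Theta_{A,(n)_{\underline\sigma}}:=\mathrm{Id}_R\otimes\Theta_{A_0,(n)_{\underline\sigma}}:A=R\otimes_{R_0}A_0\to R\otimes_{R_0}P_{A_0,(n)_{\underline\sigma}}=P_{A,(n)_{\underline\sigma}}$. "(Good) $\underline\sigma$-coordinates" means: $\underline\sigma$-coordinates or good $\underline\sigma$-coordinates. Derivations. The $R$-linear maps $\partial_{\underline\sigma,i}:A\to A$ are defined by $\Theta_{A,(1)_{\underline\sigma}}(f)=f+\sum_{i=1}^d\partial_{\underline\sigma,i}(f)\xi_i$ in $P_{A,(1)_{\underline\sigma}}$. A $\sigma_i$-derivation of $A$ is an $R$-linear endomorphism $D$ of $A$ with $D(fg)=fD(g)+\sigma_i(g)D(f)$ for all $f,g\in A$. The (good) $\underline\sigma$-coordinates $\underline x$ are classical if $\sigma_i(f)=f+(\sigma_i(x_i)-x_i)\partial_{\underline\sigma,i}(f)$ for all $f\in A$ and $i=1,\dots,d$. *)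

theory Defs
  imports
    "HOL-Algebra.Ideal_Product" "HOL-Algebra.QuotRing" "HOL-Algebra.Subrings" "HOL-Algebra.IntRing"
    "HOL-Library.Multiset"
    "HOL-Analysis.Abstract_Limits" "HOL-Analysis.T1_Spaces" "HOL-Analysis.Product_Topology"
    "HOL-Analysis.Function_Topology"
begin

section \<open>Monoid rings and polynomial rings\<close>

definition monoid_ring :: "('a, 'r) ring_scheme \<Rightarrow> ('m, 's) monoid_scheme \<Rightarrow> ('m \<Rightarrow> 'a) ring" where
  "monoid_ring K M =
    \<lparr> carrier = {p. (\<forall>m. p m \<in> carrier K) \<and> finite {m. p m \<noteq> \<zero>\<^bsub>K\<^esub>} \<and> {m. p m \<noteq> \<zero>\<^bsub>K\<^esub>} \<subseteq> carrier M},
      monoid.mult = (\<lambda>p q m. \<Oplus>\<^bsub>K\<^esub>ab \<in> {(a, b). p a \<noteq> \<zero>\<^bsub>K\<^esub> \<and> q b \<noteq> \<zero>\<^bsub>K\<^esub> \<and> a \<otimes>\<^bsub>M\<^esub> b = m}.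
                p (fst ab) \<otimes>\<^bsub>K\<^esub> q (snd ab)),
      one = (\<lambda>m. if m = \<one>\<^bsub>M\<^esub> then \<one>\<^bsub>K\<^esub> else \<zero>\<^bsub>K\<^esub>),
      zero = (\<lambda>m. \<zero>\<^bsub>K\<^esub>),
      add = (\<lambda>p q m. p m \<oplus>\<^bsub>K\<^esub> q m) \<rparr>"

definition single :: "('a, 'r) ring_scheme \<Rightarrow> 'm \<Rightarrow> 'a \<Rightarrow> 'm \<Rightarrow> 'a" where
  "single K m c = (\<lambda>m'. if m' = m then c else \<zero>\<^bsub>K\<^esub>)"

text \<open>Evaluation of a finitely supported function, the coefficients being mapped by \<open>c\<close> and the
  elements of the monoid by \<open>e\<close>.\<close>

definition mr_eval ::
  "('a, 'r) ring_scheme \<Rightarrow> ('b, 's) ring_scheme \<Rightarrow> ('a \<Rightarrow> 'b) \<Rightarrow> ('m \<Rightarrow> 'b) \<Rightarrow> ('m \<Rightarrow> 'a) \<Rightarrow> 'b" where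
  "mr_eval K U c e p = (\<Oplus>\<^bsub>U\<^esub>m \<in> {m. p m \<noteq> \<zero>\<^bsub>K\<^esub>}. c (p m) \<otimes>\<^bsub>U\<^esub> e m)"

text \<open>As in \<open>HOL-Algebra.Indexed_Polynomials\<close>, a multi-index \<open>k = (k\<^sub>1, \<dots>, k\<^sub>d)\<close> is the multiset
  over \<open>{1..d}\<close> in which \<open>i\<close> occurs \<open>k\<^sub>i\<close> times; its length \<open>k\<^sub>1 + \<dots> + k\<^sub>d\<close> is the size.\<close>

definition multi_indices :: "nat \<Rightarrow> nat multiset set" where
  "multi_indices d = {k. set_mset k \<subseteq> {1..d}}"

definition poly_ring :: "('a, 'r) ring_scheme \<Rightarrow> nat \<Rightarrow> (nat multiset \<Rightarrow> 'a) ring" where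
  "poly_ring A d = monoid_ring A \<lparr> carrier = multi_indices d, monoid.mult = (+), one = {#} \<rparr>"

definition pconst :: "('a, 'r) ring_scheme \<Rightarrow> 'a \<Rightarrow> nat multiset \<Rightarrow> 'a" where
  "pconst A c = single A {#} c"

definition pvar :: "('a, 'r) ring_scheme \<Rightarrow> nat \<Rightarrow> nat multiset \<Rightarrow> 'a" where
  "pvar A i = single A {#i#} \<one>\<^bsub>A\<^esub>"

definition poly_eval ::
  "('r, 'm) ring_scheme \<Rightarrow> ('a, 'n) ring_scheme \<Rightarrow> ('r \<Rightarrow> 'a) \<Rightarrow> nat \<Rightarrow> (nat \<Rightarrow> 'a) \<Rightarrow> (nat multiset \<Rightarrow> 'r) \<Rightarrow> 'a"
  where
  "poly_eval R A \<iota> d x = mr_eval R A \<iota> (\<lambda>k. \<Otimes>\<^bsub>A\<^esub>i \<in> {1..d}. x i [^]\<^bsub>A\<^esub> count k i)"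

definition fin_gen_ideal :: "('a, 'r) ring_scheme \<Rightarrow> 'a set \<Rightarrow> bool" where
  "fin_gen_ideal A I \<longleftrightarrow> (\<exists>F. finite F \<and> F \<subseteq> carrier A \<and> I = Idl\<^bsub>A\<^esub> F)"

definition finite_presentation :: "('a, 'r) ring_scheme \<Rightarrow> ('b, 's) ring_scheme \<Rightarrow> ('a \<Rightarrow> 'b) \<Rightarrow> bool" where
  "finite_presentation A B f \<longleftrightarrow> f \<in> ring_hom A B \<and>
    (\<exists>n h. h \<in> ring_hom (poly_ring A n) B \<and> (\<forall>a\<in>carrier A. h (pconst A a) = f a) \<and>
      h ` carrier (poly_ring A n) = carrier B \<and>
      fin_gen_ideal (poly_ring A n) (a_kernel (poly_ring A n) B h))"

text \<open>The map between quotients by ideals (the target being the quotient of \<open>B\<close> by \<open>J\<close>) that is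
  induced by \<open>f\<close>: if \<open>f\<close> is compatible with the ideals, the union is one of equal cosets.\<close>

definition coset_map :: "('b, 's) ring_scheme \<Rightarrow> 'b set \<Rightarrow> ('a \<Rightarrow> 'b) \<Rightarrow> 'a set \<Rightarrow> 'b set" where
  "coset_map B J f X = (\<Union>a\<in>X. J +>\<^bsub>B\<^esub> f a)"


section \<open>Tensor products of commutative algebras\<close>

text \<open>For \<open>f : K \<rightarrow> S\<close> and \<open>g : K \<rightarrow> T\<close>, the tensor product of \<open>S\<close> and \<open>T\<close> over \<open>K\<close> is the free abelian
  group on \<open>S \<times> T\<close> modulo the bilinearity relations. The free abelian group carries the multiplication
  of the monoid ring over the integers, for which the subgroup generated by the relations is an
  ideal.\<close>

abbreviation free_pairs ::
  "('s, 'm) ring_scheme \<Rightarrow> ('t, 'n) ring_scheme \<Rightarrow> ('s \<times> 't \<Rightarrow> int) ring" where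
  "free_pairs S T \<equiv> monoid_ring int_ring (S \<times>\<times> T)"

abbreviation gpair :: "'s \<Rightarrow> 't \<Rightarrow> 's \<times> 't \<Rightarrow> int" where
  "gpair s t \<equiv> single int_ring (s, t) 1"

definition tensor_ideal ::
  "('k, 'l) ring_scheme \<Rightarrow> ('s, 'm) ring_scheme \<Rightarrow> ('t, 'n) ring_scheme \<Rightarrow> ('k \<Rightarrow> 's) \<Rightarrow> ('k \<Rightarrow> 't)
    \<Rightarrow> ('s \<times> 't \<Rightarrow> int) set" where
  "tensor_ideal K S T f g = Idl\<^bsub>free_pairs S T\<^esub>
    ({gpair (s \<oplus>\<^bsub>S\<^esub> s') t \<ominus>\<^bsub>free_pairs S T\<^esub> (gpair s t \<oplus>\<^bsub>free_pairs S T\<^esub> gpair s' t) | s s' t.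
        s \<in> carrier S \<and> s' \<in> carrier S \<and> t \<in> carrier T} \<union>
     {gpair s (t \<oplus>\<^bsub>T\<^esub> t') \<ominus>\<^bsub>free_pairs S T\<^esub> (gpair s t \<oplus>\<^bsub>free_pairs S T\<^esub> gpair s t') | s t t'.
        s \<in> carrier S \<and> t \<in> carrier T \<and> t' \<in> carrier T} \<union>
     {gpair (f k \<otimes>\<^bsub>S\<^esub> s) t \<ominus>\<^bsub>free_pairs S T\<^esub> gpair s (g k \<otimes>\<^bsub>T\<^esub> t) | k s t.
        k \<in> carrier K \<and> s \<in> carrier S \<and> t \<in> carrier T})"

definition tensor ::
  "('k, 'l) ring_scheme \<Rightarrow> ('s, 'm) ring_scheme \<Rightarrow> ('t, 'n) ring_scheme \<Rightarrow> ('k \<Rightarrow> 's) \<Rightarrow> ('k \<Rightarrow> 't)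
    \<Rightarrow> ('s \<times> 't \<Rightarrow> int) set ring" where
  "tensor K S T f g = free_pairs S T Quot tensor_ideal K S T f g"

definition pure_tensor ::
  "('k, 'l) ring_scheme \<Rightarrow> ('s, 'm) ring_scheme \<Rightarrow> ('t, 'n) ring_scheme \<Rightarrow> ('k \<Rightarrow> 's) \<Rightarrow> ('k \<Rightarrow> 't)
    \<Rightarrow> 's \<Rightarrow> 't \<Rightarrow> ('s \<times> 't \<Rightarrow> int) set" where
  "pure_tensor K S T f g s t = tensor_ideal K S T f g +>\<^bsub>free_pairs S T\<^esub> gpair s t"

text \<open>The map from a tensor product to \<open>U\<close> with \<open>s \<otimes> t \<mapsto> u s \<cdot> v t\<close>, for \<open>u : S \<rightarrow> U\<close> and \<open>v : T \<rightarrow> U\<close>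
  that agree on the base ring.\<close>

definition tensor_lift ::
  "('u, 'm) ring_scheme \<Rightarrow> ('s \<Rightarrow> 'u) \<Rightarrow> ('t \<Rightarrow> 'u) \<Rightarrow> ('s \<times> 't \<Rightarrow> int) set \<Rightarrow> 'u" where
  "tensor_lift U u v W =
    the_elem (mr_eval int_ring U (\<lambda>n. [n] \<cdot>\<^bsub>U\<^esub> \<one>\<^bsub>U\<^esub>) (\<lambda>(s, t). u s \<otimes>\<^bsub>U\<^esub> v t) ` W)"


section \<open>Topological rings and Huber rings\<close>

record 'a top_ring = "'a ring" +
  topol :: "'a topology"

definition with_topology :: "('a, 'r) ring_scheme \<Rightarrow> 'a topology \<Rightarrow> 'a top_ring" where
  "with_topology A T =
    \<lparr> carrier = carrier A, monoid.mult = monoid.mult A, one = one A, zero = zero A, add = add A, topol = T \<rparr>"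

definition topological_ring :: "'a top_ring \<Rightarrow> bool" where
  "topological_ring A \<longleftrightarrow> cring A \<and> topspace (topol A) = carrier A \<and>
    continuous_map (prod_topology (topol A) (topol A)) (topol A) (\<lambda>(x, y). x \<oplus>\<^bsub>A\<^esub> y) \<and>
    continuous_map (topol A) (topol A) (\<lambda>x. \<ominus>\<^bsub>A\<^esub> x) \<and>
    continuous_map (prod_topology (topol A) (topol A)) (topol A) (\<lambda>(x, y). x \<otimes>\<^bsub>A\<^esub> y)"

definition sub_ring :: "'a top_ring \<Rightarrow> 'a set \<Rightarrow> 'a top_ring" where
  "sub_ring A S = A\<lparr> carrier := S, topol := subtopology (topol A) S \<rparr>"

definition quot_topology :: "'a topology \<Rightarrow> ('a \<Rightarrow> 'b) \<Rightarrow> 'b topology" where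
  "quot_topology T q = topology (\<lambda>U. U \<subseteq> q ` topspace T \<and> openin T {x \<in> topspace T. q x \<in> U})"

lemma istopology_quot:
  "istopology (\<lambda>U. U \<subseteq> q ` topspace T \<and> openin T {x \<in> topspace T. q x \<in> U})"
proof -
  have "{x \<in> topspace T. q x \<in> U \<inter> V} = {x \<in> topspace T. q x \<in> U} \<inter> {x \<in> topspace T. q x \<in> V}" for U V
    by blast
  moreover have "{x \<in> topspace T. q x \<in> \<Union>\<K>} = (\<Union>U\<in>\<K>. {x \<in> topspace T. q x \<in> U})" for \<K>
    by blast
  ultimately show ?thesis
    unfolding istopology_def by (auto intro!: openin_Union)
qed

lemma openin_quot_topology:
  "openin (quot_topology T q) U \<longleftrightarrow> U \<subseteq> q ` topspace T \<and> openin T {x \<in> topspace T. q x \<in> U}"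
  unfolding quot_topology_def by (simp add: istopology_quot)

definition quot_ring :: "'a top_ring \<Rightarrow> 'a set \<Rightarrow> 'a set top_ring" where
  "quot_ring A I = with_topology (A Quot I) (quot_topology (topol A) (\<lambda>a. I +>\<^bsub>A\<^esub> a))"

definition ideal_pow :: "('a, 'r) ring_scheme \<Rightarrow> 'a set \<Rightarrow> nat \<Rightarrow> 'a set" where
  "ideal_pow A I n = I [^]\<^bsub>ideals_set A\<^esub> n"

text \<open>\<open>A\<^sub>0\<close> is a ring of definition of \<open>A\<close> and \<open>I\<close> is an ideal of definition in it.\<close>

definition definition_pair :: "'a top_ring \<Rightarrow> 'a set \<Rightarrow> 'a set \<Rightarrow> bool" where
  "definition_pair A A\<^sub>0 I \<longleftrightarrow> subring A\<^sub>0 A \<and> openin (topol A) A\<^sub>0 \<and> fin_gen_ideal (sub_ring A A\<^sub>0) I \<and>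
    (\<forall>n. \<exists>U. openin (topol (sub_ring A A\<^sub>0)) U \<and> \<zero>\<^bsub>A\<^esub> \<in> U \<and> U \<subseteq> ideal_pow (sub_ring A A\<^sub>0) I n) \<and>
    (\<forall>U. openin (topol (sub_ring A A\<^sub>0)) U \<and> \<zero>\<^bsub>A\<^esub> \<in> U \<longrightarrow> (\<exists>n. ideal_pow (sub_ring A A\<^sub>0) I n \<subseteq> U))"

definition ring_of_definition :: "'a top_ring \<Rightarrow> 'a set \<Rightarrow> bool" where
  "ring_of_definition A A\<^sub>0 \<longleftrightarrow> (\<exists>I. definition_pair A A\<^sub>0 I)"

definition huber_ring :: "'a top_ring \<Rightarrow> bool" where
  "huber_ring A \<longleftrightarrow> topological_ring A \<and> (\<exists>A\<^sub>0. ring_of_definition A A\<^sub>0)"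

definition adic_ring :: "'a top_ring \<Rightarrow> bool" where
  "adic_ring A \<longleftrightarrow> topological_ring A \<and> ring_of_definition A (carrier A)"

definition huber_morphism :: "'a top_ring \<Rightarrow> 'b top_ring \<Rightarrow> ('a \<Rightarrow> 'b) \<Rightarrow> bool" where
  "huber_morphism A B u \<longleftrightarrow> huber_ring A \<and> huber_ring B \<and>
    u \<in> ring_hom A B \<and> continuous_map (topol A) (topol B) u"

definition adic_morphism :: "'a top_ring \<Rightarrow> 'b top_ring \<Rightarrow> ('a \<Rightarrow> 'b) \<Rightarrow> bool" where
  "adic_morphism A B u \<longleftrightarrow> huber_morphism A B u \<and>
    (\<exists>A\<^sub>0 B\<^sub>0 I. definition_pair A A\<^sub>0 I \<and> ring_of_definition B B\<^sub>0 \<and> u ` A\<^sub>0 \<subseteq> B\<^sub>0 \<and>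
      definition_pair B B\<^sub>0 (Idl\<^bsub>sub_ring B B\<^sub>0\<^esub> (u ` I)))"

text \<open>The topology of \<open>A[X\<^sub>1, \<dots>, X\<^sub>d]\<close> for which \<open>A\<^sub>0[X\<^sub>1, \<dots>, X\<^sub>d]\<close> is a ring of definition and
  \<open>I A\<^sub>0[X\<^sub>1, \<dots>, X\<^sub>d]\<close> an ideal of definition. All pairs \<open>(A\<^sub>0, I)\<close> give the same topology, so that
  no choice of a pair is needed.\<close>

definition poly_top_ring :: "'a top_ring \<Rightarrow> nat \<Rightarrow> (nat multiset \<Rightarrow> 'a) top_ring" where
  "poly_top_ring A d = with_topology (poly_ring A d) (topology_generated_by
    {ideal_pow (poly_ring (sub_ring A A\<^sub>0) d) (Idl\<^bsub>poly_ring (sub_ring A A\<^sub>0) d\<^esub> (pconst A ` I)) n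
        +>\<^bsub>poly_ring A d\<^esub> p | A\<^sub>0 I n p.
      definition_pair A A\<^sub>0 I \<and> p \<in> carrier (poly_ring A d)})"


section \<open>Completion\<close>

text \<open>The topology of a Huber ring is first countable, so that sequences suffice. A complete ring is
  understood to be separated.\<close>

definition cauchy_seq :: "'a top_ring \<Rightarrow> (nat \<Rightarrow> 'a) \<Rightarrow> bool" where
  "cauchy_seq A s \<longleftrightarrow> (\<forall>n. s n \<in> carrier A) \<and>
    (\<forall>U. openin (topol A) U \<and> \<zero>\<^bsub>A\<^esub> \<in> U \<longrightarrow> (\<exists>N. \<forall>m\<ge>N. \<forall>n\<ge>N. s m \<ominus>\<^bsub>A\<^esub> s n \<in> U))"

definition complete_ring :: "'a top_ring \<Rightarrow> bool" where
  "complete_ring A \<longleftrightarrow> Hausdorff_space (topol A) \<and>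
    (\<forall>s. cauchy_seq A s \<longrightarrow> (\<exists>l. limitin (topol A) s l sequentially))"

definition cauchy_ring :: "'a top_ring \<Rightarrow> (nat \<Rightarrow> 'a) ring" where
  "cauchy_ring A =
    \<lparr> carrier = {s. cauchy_seq A s}, monoid.mult = (\<lambda>s t n. s n \<otimes>\<^bsub>A\<^esub> t n), one = (\<lambda>n. \<one>\<^bsub>A\<^esub>),
      zero = (\<lambda>n. \<zero>\<^bsub>A\<^esub>), add = (\<lambda>s t n. s n \<oplus>\<^bsub>A\<^esub> t n) \<rparr>"

definition null_seqs :: "'a top_ring \<Rightarrow> (nat \<Rightarrow> 'a) set" where
  "null_seqs A = {s. cauchy_seq A s \<and> limitin (topol A) s \<zero>\<^bsub>A\<^esub> sequentially}"

definition completion :: "'a top_ring \<Rightarrow> (nat \<Rightarrow> 'a) set ring" where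
  "completion A = cauchy_ring A Quot null_seqs A"

definition to_completion :: "'a top_ring \<Rightarrow> 'a \<Rightarrow> (nat \<Rightarrow> 'a) set" where
  "to_completion A a = null_seqs A +>\<^bsub>cauchy_ring A\<^esub> (\<lambda>n. a)"

definition completion_map :: "'b top_ring \<Rightarrow> ('a \<Rightarrow> 'b) \<Rightarrow> (nat \<Rightarrow> 'a) set \<Rightarrow> (nat \<Rightarrow> 'b) set" where
  "completion_map B f = coset_map (cauchy_ring B) (null_seqs B) (\<lambda>s. f \<circ> s)"


section \<open>Good etale morphisms and coordinates\<close>

definition top_finite_presentation :: "'a top_ring \<Rightarrow> 'b top_ring \<Rightarrow> ('a \<Rightarrow> 'b) \<Rightarrow> bool" where
  "top_finite_presentation A B \<phi> \<longleftrightarrow> adic_morphism A B \<phi> \<and>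
    (\<exists>A\<^sub>0 B\<^sub>0. ring_of_definition A A\<^sub>0 \<and> ring_of_definition B B\<^sub>0 \<and> \<phi> ` A\<^sub>0 \<subseteq> B\<^sub>0 \<and>
      (\<forall>I. definition_pair A A\<^sub>0 I \<longrightarrow>
        (let J = Idl\<^bsub>sub_ring B B\<^sub>0\<^esub> (\<phi> ` I) in
          finite_presentation (sub_ring A A\<^sub>0 Quot I) (sub_ring B B\<^sub>0 Quot J)
            (coset_map (sub_ring B B\<^sub>0) J \<phi>))) \<and>
      finite_presentation
        (tensor (sub_ring A A\<^sub>0) A (completion (sub_ring B B\<^sub>0)) id
          (to_completion (sub_ring B B\<^sub>0) \<circ> \<phi>))
        (completion B)
        (tensor_lift (completion B) (to_completion B \<circ> \<phi>) (completion_map B id)))"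

text \<open>Since a definition cannot quantify over types, the test rings \<open>C\<close> live on a type of cardinality
  \<open>\<kappa>\<close> to the power \<open>\<aleph>\<^sub>0\<close>, where \<open>\<kappa> = |'a| + |'b| + \<aleph>\<^sub>0\<close>. This is no restriction. Consider a lifting problem (and, for uniqueness,
  two solutions of it) in a complete adic ring \<open>C\<close> of any size, with ideal of definition generated by
  the finite set \<open>F\<close>. Choose a subring \<open>S\<close> of \<open>C\<close> of cardinality at most \<open>\<kappa>\<close>
  containing \<open>F\<close>, the image of \<open>A\<close>, a representative of the image of every element of \<open>B\<close>, the images
  of the solutions, and the finitely many coefficients that express continuity of these maps for the
  \<open>F\<close>-adic topology. The \<open>F\<close>-adic completion of \<open>S\<close>, with the ideal generated by \<open>\<cc> \<inter> S\<close>, is a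
  lifting problem of the admitted size which maps to the given one.\<close>

definition formally_etale :: "'a top_ring \<Rightarrow> 'b top_ring \<Rightarrow> ('a \<Rightarrow> 'b) \<Rightarrow> bool" where
  "formally_etale A B \<phi> \<longleftrightarrow>
    (\<forall>(C :: (nat \<Rightarrow> 'a + 'b + nat) top_ring) \<cc> f g.
      adic_ring C \<and> complete_ring C \<and> ideal \<cc> C \<and> (\<exists>n. ideal_pow C \<cc> n = {\<zero>\<^bsub>C\<^esub>}) \<and>
      huber_morphism A C f \<and> huber_morphism B (quot_ring C \<cc>) g \<and>
      (\<forall>a\<in>carrier A. g (\<phi> a) = \<cc> +>\<^bsub>C\<^esub> f a) \<longrightarrow>
      (\<exists>!h. h \<in> extensional (carrier B) \<and> huber_morphism B C h \<and>
        (\<forall>a\<in>carrier A. h (\<phi> a) = f a) \<and> (\<forall>b\<in>carrier B. \<cc> +>\<^bsub>C\<^esub> h b = g b)))"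

definition top_etale :: "'a top_ring \<Rightarrow> 'b top_ring \<Rightarrow> ('a \<Rightarrow> 'b) \<Rightarrow> bool" where
  "top_etale A B \<phi> \<longleftrightarrow> adic_ring A \<and> adic_ring B \<and> huber_morphism A B \<phi> \<and>
    formally_etale A B \<phi> \<and> top_finite_presentation A B \<phi>"

definition good_model :: "'a top_ring \<Rightarrow> 'b top_ring \<Rightarrow> ('a \<Rightarrow> 'b) \<Rightarrow> 'a set \<Rightarrow> 'b set \<Rightarrow> bool" where
  "good_model A B \<phi> A\<^sub>0 B\<^sub>0 \<longleftrightarrow> huber_morphism A B \<phi> \<and>
    ring_of_definition A A\<^sub>0 \<and> ring_of_definition B B\<^sub>0 \<and> \<phi> ` A\<^sub>0 \<subseteq> B\<^sub>0 \<and>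
    top_etale (sub_ring A A\<^sub>0) (sub_ring B B\<^sub>0) \<phi> \<and>
    tensor_lift B \<phi> id \<in> ring_iso (tensor (sub_ring A A\<^sub>0) A (sub_ring B B\<^sub>0) id \<phi>) B"

text \<open>In the rest of the theory \<open>\<iota> : R \<rightarrow> A\<close> is the structure morphism of the \<open>R\<close>-algebra \<open>A\<close>.\<close>

definition good_etale_coordinates_model ::
  "'r top_ring \<Rightarrow> 'a top_ring \<Rightarrow> ('r \<Rightarrow> 'a) \<Rightarrow> nat \<Rightarrow> (nat \<Rightarrow> 'a) \<Rightarrow> 'r set \<Rightarrow> 'a set \<Rightarrow> bool" where
  "good_etale_coordinates_model R A \<iota> d x R\<^sub>0 A\<^sub>0 \<longleftrightarrow>
    huber_morphism R A \<iota> \<and> (\<forall>i\<in>{1..d}. x i \<in> carrier A) \<and> ring_of_definition R R\<^sub>0 \<and>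
    good_model (poly_top_ring R d) A (poly_eval R A \<iota> d x) (carrier (poly_ring (sub_ring R R\<^sub>0) d)) A\<^sub>0"


section \<open>Twisted algebras and twisted coordinates\<close>

definition R_linear :: "'r top_ring \<Rightarrow> 'a top_ring \<Rightarrow> ('r \<Rightarrow> 'a) \<Rightarrow> ('a \<Rightarrow> 'a) \<Rightarrow> bool" where
  "R_linear R A \<iota> D \<longleftrightarrow> D \<in> carrier A \<rightarrow> carrier A \<and>
    (\<forall>f\<in>carrier A. \<forall>g\<in>carrier A. D (f \<oplus>\<^bsub>A\<^esub> g) = D f \<oplus>\<^bsub>A\<^esub> D g) \<and>
    (\<forall>r\<in>carrier R. \<forall>f\<in>carrier A. D (\<iota> r \<otimes>\<^bsub>A\<^esub> f) = \<iota> r \<otimes>\<^bsub>A\<^esub> D f)"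

definition twisted_algebra ::
  "'r top_ring \<Rightarrow> 'a top_ring \<Rightarrow> ('r \<Rightarrow> 'a) \<Rightarrow> nat \<Rightarrow> (nat \<Rightarrow> 'a \<Rightarrow> 'a) \<Rightarrow> bool" where
  "twisted_algebra R A \<iota> d \<sigma> \<longleftrightarrow> huber_ring R \<and> huber_ring A \<and> adic_morphism R A \<iota> \<and>
    (\<forall>i\<in>{1..d}. \<sigma> i \<in> ring_hom A A \<and> continuous_map (topol A) (topol A) (\<sigma> i) \<and>
      R_linear R A \<iota> (\<sigma> i)) \<and>
    (\<forall>i\<in>{1..d}. \<forall>j\<in>{1..d}. \<forall>f\<in>carrier A. \<sigma> i (\<sigma> j f) = \<sigma> j (\<sigma> i f))"

definition twisted_power ::
  "'a top_ring \<Rightarrow> nat \<Rightarrow> (nat \<Rightarrow> 'a \<Rightarrow> 'a) \<Rightarrow> (nat \<Rightarrow> 'a) \<Rightarrow> nat multiset \<Rightarrow> nat multiset \<Rightarrow> 'a" where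
  "twisted_power A d \<sigma> x k =
    (\<Otimes>\<^bsub>poly_ring A d\<^esub>i \<in> {1..d}. \<Otimes>\<^bsub>poly_ring A d\<^esub>j \<in> {..<count k i}.
      pvar A i \<oplus>\<^bsub>poly_ring A d\<^esub> pconst A (x i \<ominus>\<^bsub>A\<^esub> (\<sigma> i ^^ j) (x i)))"

definition twisted_ideal ::
  "'a top_ring \<Rightarrow> nat \<Rightarrow> (nat \<Rightarrow> 'a \<Rightarrow> 'a) \<Rightarrow> (nat \<Rightarrow> 'a) \<Rightarrow> nat \<Rightarrow> (nat multiset \<Rightarrow> 'a) set" where
  "twisted_ideal A d \<sigma> x n =
    Idl\<^bsub>poly_ring A d\<^esub> {twisted_power A d \<sigma> x k | k. k \<in> multi_indices d \<and> size k = n + 1}"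

text \<open>The ring \<open>P\<^bsub>A,(n)\<^esub>\<close> and, in it, the classes of polynomials, of constants and of \<open>\<xi>\<^sub>i\<close>.\<close>

definition twisted_parts ::
  "'a top_ring \<Rightarrow> nat \<Rightarrow> (nat \<Rightarrow> 'a \<Rightarrow> 'a) \<Rightarrow> (nat \<Rightarrow> 'a) \<Rightarrow> nat \<Rightarrow> (nat multiset \<Rightarrow> 'a) set top_ring" where
  "twisted_parts A d \<sigma> x n = quot_ring (poly_top_ring A d) (twisted_ideal A d \<sigma> x n)"

definition parts_class ::
  "'a top_ring \<Rightarrow> nat \<Rightarrow> (nat \<Rightarrow> 'a \<Rightarrow> 'a) \<Rightarrow> (nat \<Rightarrow> 'a) \<Rightarrow> nat \<Rightarrow> (nat multiset \<Rightarrow> 'a)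
    \<Rightarrow> (nat multiset \<Rightarrow> 'a) set" where
  "parts_class A d \<sigma> x n p = twisted_ideal A d \<sigma> x n +>\<^bsub>poly_ring A d\<^esub> p"

definition parts_const ::
  "'a top_ring \<Rightarrow> nat \<Rightarrow> (nat \<Rightarrow> 'a \<Rightarrow> 'a) \<Rightarrow> (nat \<Rightarrow> 'a) \<Rightarrow> nat \<Rightarrow> 'a \<Rightarrow> (nat multiset \<Rightarrow> 'a) set" where
  "parts_const A d \<sigma> x n a = parts_class A d \<sigma> x n (pconst A a)"

definition parts_xi ::
  "'a top_ring \<Rightarrow> nat \<Rightarrow> (nat \<Rightarrow> 'a \<Rightarrow> 'a) \<Rightarrow> (nat \<Rightarrow> 'a) \<Rightarrow> nat \<Rightarrow> nat \<Rightarrow> (nat multiset \<Rightarrow> 'a) set" where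
  "parts_xi A d \<sigma> x n i = parts_class A d \<sigma> x n (pvar A i)"

text \<open>The projection \<open>P\<^bsub>A,(n)\<^esub> \<rightarrow> A\<close>, \<open>\<xi>\<^sub>i \<mapsto> 0\<close>, takes the constant coefficient.\<close>

definition parts_proj :: "(nat multiset \<Rightarrow> 'a) set \<Rightarrow> 'a" where
  "parts_proj X = the_elem ((\<lambda>p. p {#}) ` X)"

definition is_Theta ::
  "'r top_ring \<Rightarrow> 'a top_ring \<Rightarrow> ('r \<Rightarrow> 'a) \<Rightarrow> nat \<Rightarrow> (nat \<Rightarrow> 'a \<Rightarrow> 'a) \<Rightarrow> (nat \<Rightarrow> 'a) \<Rightarrow> nat
    \<Rightarrow> ('a \<Rightarrow> (nat multiset \<Rightarrow> 'a) set) \<Rightarrow> bool" where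
  "is_Theta R A \<iota> d \<sigma> x n \<theta> \<longleftrightarrow> \<theta> \<in> extensional (carrier A) \<and>
    adic_morphism A (twisted_parts A d \<sigma> x n) \<theta> \<and>
    (\<forall>r\<in>carrier R. \<theta> (\<iota> r) = parts_const A d \<sigma> x n (\<iota> r)) \<and>
    (\<forall>i\<in>{1..d}. \<theta> (x i) =
      parts_const A d \<sigma> x n (x i) \<oplus>\<^bsub>twisted_parts A d \<sigma> x n\<^esub> parts_xi A d \<sigma> x n i) \<and>
    (\<forall>f\<in>carrier A. parts_proj (\<theta> f) = f)"

definition sigma_coordinates ::
  "'r top_ring \<Rightarrow> 'a top_ring \<Rightarrow> ('r \<Rightarrow> 'a) \<Rightarrow> nat \<Rightarrow> (nat \<Rightarrow> 'a \<Rightarrow> 'a) \<Rightarrow> (nat \<Rightarrow> 'a) \<Rightarrow> bool" where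
  "sigma_coordinates R A \<iota> d \<sigma> x \<longleftrightarrow> twisted_algebra R A \<iota> d \<sigma> \<and> (\<forall>i\<in>{1..d}. x i \<in> carrier A) \<and>
    (\<forall>n. \<exists>!\<theta>. is_Theta R A \<iota> d \<sigma> x n \<theta>)"

definition Theta ::
  "'r top_ring \<Rightarrow> 'a top_ring \<Rightarrow> ('r \<Rightarrow> 'a) \<Rightarrow> nat \<Rightarrow> (nat \<Rightarrow> 'a \<Rightarrow> 'a) \<Rightarrow> (nat \<Rightarrow> 'a) \<Rightarrow> nat
    \<Rightarrow> 'a \<Rightarrow> (nat multiset \<Rightarrow> 'a) set" where
  "Theta R A \<iota> d \<sigma> x n = (THE \<theta>. is_Theta R A \<iota> d \<sigma> x n \<theta>)"

text \<open>The elements \<open>x\<close> are good \<open>\<sigma>\<close>-coordinates if this holds for some \<open>R\<^sub>0\<close> and \<open>A\<^sub>0\<close>.\<close>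

definition good_sigma_coordinates_model ::
  "'r top_ring \<Rightarrow> 'a top_ring \<Rightarrow> ('r \<Rightarrow> 'a) \<Rightarrow> nat \<Rightarrow> (nat \<Rightarrow> 'a \<Rightarrow> 'a) \<Rightarrow> (nat \<Rightarrow> 'a)
    \<Rightarrow> 'r set \<Rightarrow> 'a set \<Rightarrow> bool" where
  "good_sigma_coordinates_model R A \<iota> d \<sigma> x R\<^sub>0 A\<^sub>0 \<longleftrightarrow>
    good_etale_coordinates_model R A \<iota> d x R\<^sub>0 A\<^sub>0 \<and> (\<forall>i\<in>{1..d}. \<sigma> i ` A\<^sub>0 \<subseteq> A\<^sub>0) \<and>
    sigma_coordinates (sub_ring R R\<^sub>0) (sub_ring A A\<^sub>0) \<iota> d \<sigma> x"

text \<open>The map \<open>Id\<^sub>R \<otimes> \<Theta>\<^sub>0\<close>, where \<open>\<Theta>\<^sub>0\<close> is the map \<^const>\<open>Theta\<close> of \<open>A\<^sub>0\<close>, after identification of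
  \<open>R \<otimes> A\<^sub>0\<close> with \<open>A\<close> and of \<open>R \<otimes> P\<^bsub>A\<^sub>0,(n)\<^esub>\<close> with \<open>P\<^bsub>A,(n)\<^esub>\<close> (tensor products over \<open>R\<^sub>0\<close>).\<close>

definition good_Theta ::
  "'r top_ring \<Rightarrow> 'a top_ring \<Rightarrow> ('r \<Rightarrow> 'a) \<Rightarrow> nat \<Rightarrow> (nat \<Rightarrow> 'a \<Rightarrow> 'a) \<Rightarrow> (nat \<Rightarrow> 'a)
    \<Rightarrow> 'r set \<Rightarrow> 'a set \<Rightarrow> nat \<Rightarrow> 'a \<Rightarrow> (nat multiset \<Rightarrow> 'a) set" where
  "good_Theta R A \<iota> d \<sigma> x R\<^sub>0 A\<^sub>0 n =
    (let R0 = sub_ring R R\<^sub>0; A0 = sub_ring A A\<^sub>0;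
         P0 = twisted_parts A0 d \<sigma> x n; P = twisted_parts A d \<sigma> x n;
         c0 = parts_const A0 d \<sigma> x n \<circ> \<iota>;
         RA0 = tensor R0 R A0 id \<iota>; RP0 = tensor R0 R P0 id c0;
         to_A = tensor_lift A \<iota> id;
         to_P = tensor_lift P (parts_const A d \<sigma> x n \<circ> \<iota>)
           (coset_map (poly_ring A d) (twisted_ideal A d \<sigma> x n) id);
         id_Theta = tensor_lift RP0 (\<lambda>r. pure_tensor R0 R P0 id c0 r \<one>\<^bsub>P0\<^esub>)
           (\<lambda>a. pure_tensor R0 R P0 id c0 \<one>\<^bsub>R\<^esub> (Theta R0 A0 \<iota> d \<sigma> x n a))
     in to_P \<circ> id_Theta \<circ> inv_into (carrier RA0) to_A)"


section \<open>Twisted derivations\<close>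

text \<open>\<open>\<theta>\<close> stands for the map \<open>\<Theta>\<^bsub>A,(1)\<^esub>\<close>.\<close>

definition twisted_partial ::
  "'a top_ring \<Rightarrow> nat \<Rightarrow> (nat \<Rightarrow> 'a \<Rightarrow> 'a) \<Rightarrow> (nat \<Rightarrow> 'a) \<Rightarrow> ('a \<Rightarrow> (nat multiset \<Rightarrow> 'a) set)
    \<Rightarrow> nat \<Rightarrow> 'a \<Rightarrow> 'a" where
  "twisted_partial A d \<sigma> x \<theta> i f =
    (THE c. c \<in> {1..d} \<rightarrow>\<^sub>E carrier A \<and>
      \<theta> f = parts_const A d \<sigma> x 1 f \<oplus>\<^bsub>twisted_parts A d \<sigma> x 1\<^esub>
        (\<Oplus>\<^bsub>twisted_parts A d \<sigma> x 1\<^esub>j \<in> {1..d}.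
          parts_const A d \<sigma> x 1 (c j) \<otimes>\<^bsub>twisted_parts A d \<sigma> x 1\<^esub> parts_xi A d \<sigma> x 1 j)) i"

definition sigma_derivation ::
  "'r top_ring \<Rightarrow> 'a top_ring \<Rightarrow> ('r \<Rightarrow> 'a) \<Rightarrow> ('a \<Rightarrow> 'a) \<Rightarrow> ('a \<Rightarrow> 'a) \<Rightarrow> bool" where
  "sigma_derivation R A \<iota> s D \<longleftrightarrow> R_linear R A \<iota> D \<and>
    (\<forall>f\<in>carrier A. \<forall>g\<in>carrier A. D (f \<otimes>\<^bsub>A\<^esub> g) = f \<otimes>\<^bsub>A\<^esub> D g \<oplus>\<^bsub>A\<^esub> s g \<otimes>\<^bsub>A\<^esub> D f)"

definition classical_coordinates ::
  "'a top_ring \<Rightarrow> nat \<Rightarrow> (nat \<Rightarrow> 'a \<Rightarrow> 'a) \<Rightarrow> (nat \<Rightarrow> 'a) \<Rightarrow> (nat \<Rightarrow> 'a \<Rightarrow> 'a) \<Rightarrow> bool" where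
  "classical_coordinates A d \<sigma> x \<delta> \<longleftrightarrow>
    (\<forall>i\<in>{1..d}. \<forall>f\<in>carrier A. \<sigma> i f = f \<oplus>\<^bsub>A\<^esub> (\<sigma> i (x i) \<ominus>\<^bsub>A\<^esub> x i) \<otimes>\<^bsub>A\<^esub> \<delta> i f)"

end

theory Submission
  imports Defs
begin

text \<open>The ring \<open>P\<^bsub>A,(1)\<^esub>\<close> is free over \<open>A\<close> with basis \<open>1, \<xi>\<^sub>1, \<dots>, \<xi>\<^sub>d\<close>, with \<open>\<xi>\<^sub>i \<xi>\<^sub>j = 0\<close> for \<open>i \<noteq> j\<close> and
  \<open>\<xi>\<^sub>i\<^sup>2 = s\<^sub>i \<xi>\<^sub>i\<close> for \<open>s\<^sub>i = \<sigma>\<^sub>i(x\<^sub>i) - x\<^sub>i\<close>. Comparing coefficients of \<open>\<xi>\<^sub>i\<close> in \<open>\<Theta>(f g) = \<Theta>(f) \<Theta>(g)\<close> gives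
  \<open>\<partial>\<^sub>i(f g) = f \<partial>\<^sub>i(g) + (g + s\<^sub>i \<partial>\<^sub>i(g)) \<partial>\<^sub>i(f)\<close>. If the coordinates are classical, the bracket is \<open>\<sigma>\<^sub>i(g)\<close>, so
  \<open>\<partial>\<^sub>i\<close> is a \<open>\<sigma>\<^sub>i\<close>-derivation; conversely take \<open>f = x\<^sub>i\<close> and use \<open>\<partial>\<^sub>i(x\<^sub>i) = 1\<close>.

  All this only uses that \<open>\<Theta>\<close> is a ring homomorphism over \<open>R\<close> that lifts the identity and sends \<open>x\<^sub>i\<close> to
  \<open>x\<^sub>i + \<xi>\<^sub>i\<close>. For good coordinates, the isomorphism \<open>R[X] \<otimes> A\<^sub>0 \<cong> A\<close> of the good model (tensor product over
  \<open>R\<^sub>0[X]\<close>) identifies \<open>Id \<otimes> \<Theta>\<^sub>0\<close> with the ring homomorphism \<open>p \<otimes> a \<mapsto> p(x + \<xi>) \<Theta>\<^sub>0(a)\<close>.\<close>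

section \<open>Monoid rings\<close>

text \<open>The obstacle for good coordinates is a mismatch of tensor products:
  \<open>good_model\<close> gives an isomorphism onto \<open>A\<close> from R[X] \<otimes>
  \<open>A0\<close> over R0[X], whereas \<open>good_Theta\<close> inverts the map R \<otimes>
  \<open>A0\<close> \<rightarrow> \<open>A\<close> over \<open>R0\<close>. Identifying the two would
  require R[X] = R \<otimes> R0[X]. This is bypassed: the second map is only shown to be surjective,
  and whichever preimage \<open>inv_into\<close> picks is moved to R[X] \<otimes> \<open>A0\<close>,
  where the preimage is unique. Maps out of tensor products are then compared on the two factors
  alone, by naturality of \<open>tensor_lift\<close>. Freeness of \<open>P\<close> is split in two.
  Spanning is an induction over polynomials; independence is witnessed by homomorphisms to rank two
  algebras, so no division by twisted powers has to be set up. Polynomial rings and the free groups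
  behind tensor products are both monoid rings, so their ring axioms and their evaluations are
  treated once.\<close>

lemma (in comm_monoid) finprod_cartesian:
  assumes "finite P" "finite Q" "\<And>a b. a \<in> P \<Longrightarrow> b \<in> Q \<Longrightarrow> f (a, b) \<in> carrier G"
  shows "finprod G f (P \<times> Q) = finprod G (\<lambda>a. finprod G (\<lambda>b. f (a, b)) Q) P"
proof -
  have "finprod G f (P \<times> Q) = finprod G f (\<Union>a\<in>P. Pair a ` Q)"
    by (rule arg_cong[of _ _ "finprod G f"]) auto
  also have "\<dots> = finprod G (\<lambda>a. finprod G f (Pair a ` Q)) P"
    using assms by (intro finprod_UN_disjoint) (auto simp: pairwise_def disjnt_def)
  also have "\<dots> = finprod G (\<lambda>a. finprod G (\<lambda>b. f (a, b)) Q) P"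
    using assms by (intro finprod_cong') (auto intro!: finprod_reindex finprod_closed inj_onI)
  finally show ?thesis .
qed

lemma (in comm_monoid) finprod_swap:
  assumes "finite P" "finite Q" "\<And>a b. a \<in> P \<Longrightarrow> b \<in> Q \<Longrightarrow> f a b \<in> carrier G"
  shows "finprod G (\<lambda>a. finprod G (f a) Q) P = finprod G (\<lambda>b. finprod G (\<lambda>a. f a b) P) Q"
proof -
  have "finprod G (\<lambda>a. finprod G (f a) Q) P = finprod G (\<lambda>(a, b). f a b) (P \<times> Q)"
    using assms by (subst finprod_cartesian) auto
  also have "\<dots> = finprod G (\<lambda>(a, b). f a b) (prod.swap ` (Q \<times> P))"
    by (rule arg_cong[of _ _ "finprod G _"]) auto
  also have "\<dots> = finprod G (\<lambda>x. (\<lambda>(a, b). f a b) (prod.swap x)) (Q \<times> P)"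
    using assms by (intro finprod_reindex) auto
  also have "\<dots> = finprod G (\<lambda>b. finprod G (\<lambda>a. f a b) P) Q"
    using assms by (subst finprod_cartesian) auto
  finally show ?thesis .
qed

text \<open>The exchange laws are proved for products in a commutative monoid; the additive
  structure of a ring is such a monoid, which yields them for sums.\<close>

lemmas (in abelian_monoid) finsum_cartesian = add.finprod_cartesian
lemmas (in abelian_monoid) finsum_swap = add.finprod_swap
lemmas (in abelian_monoid) finsum_UN_disjoint = add.finprod_UN_disjoint
lemmas (in abelian_monoid) finsum_mono_neutral_cong_left = add.finprod_mono_neutral_cong_left

lemma monoid_ring_carrier:
  "p \<in> carrier (monoid_ring K M) \<longleftrightarrow>
    (\<forall>m. p m \<in> carrier K) \<and> finite {m. p m \<noteq> \<zero>\<^bsub>K\<^esub>} \<and> {m. p m \<noteq> \<zero>\<^bsub>K\<^esub>} \<subseteq> carrier M"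
  by (simp add: monoid_ring_def)

lemma monoid_ring_add: "p \<oplus>\<^bsub>monoid_ring K M\<^esub> q = (\<lambda>m. p m \<oplus>\<^bsub>K\<^esub> q m)"
  by (simp add: monoid_ring_def)

lemma monoid_ring_zero: "\<zero>\<^bsub>monoid_ring K M\<^esub> = (\<lambda>m. \<zero>\<^bsub>K\<^esub>)"
  by (simp add: monoid_ring_def)

lemma monoid_ring_one: "\<one>\<^bsub>monoid_ring K M\<^esub> = single K \<one>\<^bsub>M\<^esub> \<one>\<^bsub>K\<^esub>"
  by (simp add: monoid_ring_def single_def)

text \<open>The values \<open>e\<close> on the monoid are not fixed here, because evaluation is also
  used at functions that are not multiplicative, such as indicators. Only \<open>mr_eval_hom\<close>
  asks for multiplicativity.\<close>

locale monoid_ring_eval = ring_hom_cring K U c + M: comm_monoid M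
  for K (structure) and U (structure) and c and M (structure)
begin

section \<open>Evaluation of finitely supported functions\<close>

lemma mr_eval_superset:
  assumes "p \<in> carrier (monoid_ring K M)" "finite B" "{m. p m \<noteq> \<zero>\<^bsub>K\<^esub>} \<subseteq> B" "e \<in> B \<rightarrow> carrier U"
  shows "mr_eval K U c e p = (\<Oplus>\<^bsub>U\<^esub>m\<in>B. c (p m) \<otimes>\<^bsub>U\<^esub> e m)"
  unfolding mr_eval_def using assms
  by (intro S.finsum_mono_neutral_cong_left) (auto simp: monoid_ring_carrier Pi_def)

lemma mr_eval_closed [simp]:
  assumes "p \<in> carrier (monoid_ring K M)" "e \<in> carrier M \<rightarrow> carrier U"
  shows "mr_eval K U c e p \<in> carrier U"
  unfolding mr_eval_def using assms
  by (intro S.finsum_closed) (auto simp: monoid_ring_carrier Pi_def subset_iff)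

text \<open>Cancellation can make the support of the sum smaller than the union of the two supports;
  all three evaluations are therefore taken over that union by
  \<open>mr_eval_superset\<close>.\<close>

lemma mr_eval_add:
  assumes "p \<in> carrier (monoid_ring K M)" "q \<in> carrier (monoid_ring K M)" "e \<in> carrier M \<rightarrow> carrier U"
  shows "mr_eval K U c e (p \<oplus>\<^bsub>monoid_ring K M\<^esub> q) = mr_eval K U c e p \<oplus>\<^bsub>U\<^esub> mr_eval K U c e q"
proof -
  let ?B = "{m. p m \<noteq> \<zero>\<^bsub>K\<^esub>} \<union> {m. q m \<noteq> \<zero>\<^bsub>K\<^esub>}"
  have B: "finite ?B" "?B \<subseteq> carrier M"
    using assms by (auto simp: monoid_ring_carrier)
  have supp: "{m. p m \<oplus>\<^bsub>K\<^esub> q m \<noteq> \<zero>\<^bsub>K\<^esub>} \<subseteq> ?B"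
    using assms by (auto simp: monoid_ring_carrier)
  have e: "e \<in> ?B \<rightarrow> carrier U"
    using assms(3) B(2) by blast
  have pq: "p \<oplus>\<^bsub>monoid_ring K M\<^esub> q \<in> carrier (monoid_ring K M)"
    using assms B supp finite_subset[OF supp B(1)] by (auto simp: monoid_ring_carrier monoid_ring_add)
  have "mr_eval K U c e (p \<oplus>\<^bsub>monoid_ring K M\<^esub> q) =
      (\<Oplus>\<^bsub>U\<^esub>m\<in>?B. c (p m) \<otimes>\<^bsub>U\<^esub> e m \<oplus>\<^bsub>U\<^esub> c (q m) \<otimes>\<^bsub>U\<^esub> e m)"
    (is "_ = ?S")
  proof -
    have "mr_eval K U c e (p \<oplus>\<^bsub>monoid_ring K M\<^esub> q) =
        (\<Oplus>\<^bsub>U\<^esub>m\<in>?B. c ((p \<oplus>\<^bsub>monoid_ring K M\<^esub> q) m) \<otimes>\<^bsub>U\<^esub> e m)"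
      using B(1) supp e by (intro mr_eval_superset pq) (auto simp: monoid_ring_add)
    also have "\<dots> = ?S"
      using assms e
      by (intro S.finsum_cong') (auto simp: monoid_ring_add monoid_ring_carrier Pi_def S.l_distr)
    finally show ?thesis .
  qed
  also have "\<dots> = mr_eval K U c e p \<oplus>\<^bsub>U\<^esub> mr_eval K U c e q"
    using assms B e
    by (subst S.finsum_addf) (auto simp: monoid_ring_carrier Pi_def mr_eval_superset[of _ ?B])
  finally show ?thesis .
qed

lemma mr_eval_single:
  assumes "a \<in> carrier K" "m \<in> carrier M" "e \<in> carrier M \<rightarrow> carrier U"
  shows "mr_eval K U c e (single K m a) = c a \<otimes>\<^bsub>U\<^esub> e m"
proof -
  have "single K m a \<in> carrier (monoid_ring K M)"
    using assms by (auto simp: monoid_ring_carrier single_def)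
  then have "mr_eval K U c e (single K m a) = (\<Oplus>\<^bsub>U\<^esub>m'\<in>{m}. c (single K m a m') \<otimes>\<^bsub>U\<^esub> e m')"
    using assms by (intro mr_eval_superset) (auto simp: single_def)
  then show ?thesis
    using assms by (auto simp: single_def Pi_def)
qed

lemma monoid_ring_mult_apply:
  assumes "p \<in> carrier (monoid_ring K M)" "q \<in> carrier (monoid_ring K M)"
  shows "(p \<otimes>\<^bsub>monoid_ring K M\<^esub> q) m =
    (\<Oplus>\<^bsub>K\<^esub>ab\<in>{(a, b). p a \<noteq> \<zero>\<^bsub>K\<^esub> \<and> q b \<noteq> \<zero>\<^bsub>K\<^esub> \<and> a \<otimes>\<^bsub>M\<^esub> b = m}. p (fst ab) \<otimes>\<^bsub>K\<^esub> q (snd ab))"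
  by (simp add: monoid_ring_def)

text \<open>The sum defining a coefficient is empty unless \<open>m\<close> is a product of two
  support elements. The finite set of these products also serves as index set when a product is
  evaluated.\<close>

lemma monoid_ring_mult_closed:
  assumes p: "p \<in> carrier (monoid_ring K M)" and q: "q \<in> carrier (monoid_ring K M)"
  shows "p \<otimes>\<^bsub>monoid_ring K M\<^esub> q \<in> carrier (monoid_ring K M)"
    "{m. (p \<otimes>\<^bsub>monoid_ring K M\<^esub> q) m \<noteq> \<zero>\<^bsub>K\<^esub>} \<subseteq>
      (\<lambda>(a, b). a \<otimes>\<^bsub>M\<^esub> b) ` ({m. p m \<noteq> \<zero>\<^bsub>K\<^esub>} \<times> {m. q m \<noteq> \<zero>\<^bsub>K\<^esub>})" (is "_ \<subseteq> ?B")
proof -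
  have zero: "(p \<otimes>\<^bsub>monoid_ring K M\<^esub> q) m = \<zero>\<^bsub>K\<^esub>" if "m \<notin> ?B" for m
  proof -
    have "{(a, b). p a \<noteq> \<zero>\<^bsub>K\<^esub> \<and> q b \<noteq> \<zero>\<^bsub>K\<^esub> \<and> a \<otimes>\<^bsub>M\<^esub> b = m} = {}"
      using that by force
    then show ?thesis
      by (simp only: monoid_ring_mult_apply[OF p q] R.finsum_empty)
  qed
  then show B: "{m. (p \<otimes>\<^bsub>monoid_ring K M\<^esub> q) m \<noteq> \<zero>\<^bsub>K\<^esub>} \<subseteq> ?B"
    by blast
  have "finite ?B" "?B \<subseteq> carrier M"
    using p q by (auto simp: monoid_ring_carrier subset_iff)
  moreover have "(p \<otimes>\<^bsub>monoid_ring K M\<^esub> q) m \<in> carrier K" for m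
    unfolding monoid_ring_mult_apply[OF p q]
    using p q by (auto intro!: R.finsum_closed simp: monoid_ring_carrier)
  ultimately show "p \<otimes>\<^bsub>monoid_ring K M\<^esub> q \<in> carrier (monoid_ring K M)"
    using B unfolding monoid_ring_carrier by (auto intro: finite_subset)
qed

text \<open>For indicator functions \<open>e\<close> this is the formula for the coefficients of a product, so that
  associativity and commutativity of \<^const>\<open>monoid_ring\<close> are special cases.\<close>

lemma mr_eval_mult_iterated:
  assumes p: "p \<in> carrier (monoid_ring K M)" and q: "q \<in> carrier (monoid_ring K M)"
    and e: "e \<in> carrier M \<rightarrow> carrier U"
  shows "mr_eval K U c e (p \<otimes>\<^bsub>monoid_ring K M\<^esub> q) =
    mr_eval K U c (\<lambda>a. mr_eval K U c (\<lambda>b. e (a \<otimes>\<^bsub>M\<^esub> b)) q) p"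
proof -
  let ?P = "{m. p m \<noteq> \<zero>\<^bsub>K\<^esub>}" and ?Q = "{m. q m \<noteq> \<zero>\<^bsub>K\<^esub>}"
  let ?f = "\<lambda>ab. c (p (fst ab)) \<otimes>\<^bsub>U\<^esub> c (q (snd ab)) \<otimes>\<^bsub>U\<^esub> e (fst ab \<otimes>\<^bsub>M\<^esub> snd ab)"
  let ?B = "(\<lambda>(a, b). a \<otimes>\<^bsub>M\<^esub> b) ` (?P \<times> ?Q)"
  let ?A = "\<lambda>m. {(a, b). p a \<noteq> \<zero>\<^bsub>K\<^esub> \<and> q b \<noteq> \<zero>\<^bsub>K\<^esub> \<and> a \<otimes>\<^bsub>M\<^esub> b = m}"
  have pK: "\<And>m. p m \<in> carrier K" and qK: "\<And>m. q m \<in> carrier K"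
    and fin: "finite ?P" "finite ?Q" and sub: "\<And>a. a \<in> ?P \<Longrightarrow> a \<in> carrier M" "\<And>a. a \<in> ?Q \<Longrightarrow> a \<in> carrier M"
    using p q by (auto simp: monoid_ring_carrier)
  have eU: "e (a \<otimes>\<^bsub>M\<^esub> b) \<in> carrier U" if "a \<in> ?P" "b \<in> ?Q" for a b
    using e sub that by blast
  have finA: "finite (?A m)" for m
    by (rule finite_subset[of _ "?P \<times> ?Q"]) (use fin in auto)
  have "mr_eval K U c e (p \<otimes>\<^bsub>monoid_ring K M\<^esub> q) =
      (\<Oplus>\<^bsub>U\<^esub>m\<in>?B. c ((p \<otimes>\<^bsub>monoid_ring K M\<^esub> q) m) \<otimes>\<^bsub>U\<^esub> e m)"
    using fin eU by (intro mr_eval_superset monoid_ring_mult_closed p q) auto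
  also have "\<dots> = (\<Oplus>\<^bsub>U\<^esub>m\<in>?B. finsum U ?f (?A m))"
  proof (rule S.finsum_cong'[OF refl])
    show "(\<lambda>m. finsum U ?f (?A m)) \<in> ?B \<rightarrow> carrier U"
      using eU pK qK by (auto intro!: S.finsum_closed)
    fix m assume m: "m \<in> ?B"
    then have "e m \<in> carrier U"
      using eU by auto
    have "c ((p \<otimes>\<^bsub>monoid_ring K M\<^esub> q) m) \<otimes>\<^bsub>U\<^esub> e m =
        (\<Oplus>\<^bsub>U\<^esub>ab\<in>?A m. c (p (fst ab)) \<otimes>\<^bsub>U\<^esub> c (q (snd ab))) \<otimes>\<^bsub>U\<^esub> e m"
      unfolding monoid_ring_mult_apply[OF p q] using pK qK
      by (subst hom_finsum) (auto simp: comp_def)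
    also have "\<dots> = (\<Oplus>\<^bsub>U\<^esub>ab\<in>?A m. c (p (fst ab)) \<otimes>\<^bsub>U\<^esub> c (q (snd ab)) \<otimes>\<^bsub>U\<^esub> e m)"
      using finA[of m] pK qK \<open>e m \<in> carrier U\<close> by (intro S.finsum_ldistr) auto
    also have "\<dots> = finsum U ?f (?A m)"
      using pK qK eU by (intro S.finsum_cong') auto
    finally show "c ((p \<otimes>\<^bsub>monoid_ring K M\<^esub> q) m) \<otimes>\<^bsub>U\<^esub> e m = finsum U ?f (?A m)" .
  qed
  \<comment> \<open>The sets \<open>?A m\<close> of factorizations of \<open>m\<close> partition
    \<open>?P \<times> ?Q\<close>, so the double sum becomes a sum over pairs.\<close>
  also have "\<dots> = finsum U ?f (\<Union>m\<in>?B. ?A m)"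
    using fin finA eU pK qK
    by (intro S.finsum_UN_disjoint[symmetric]) (auto simp: pairwise_def disjnt_def)
  also have "(\<Union>m\<in>?B. ?A m) = ?P \<times> ?Q"
    by auto
  also have "finsum U ?f (?P \<times> ?Q) = (\<Oplus>\<^bsub>U\<^esub>a\<in>?P. \<Oplus>\<^bsub>U\<^esub>b\<in>?Q. ?f (a, b))"
    using fin eU pK qK by (intro S.finsum_cartesian) auto
  also have "\<dots> = (\<Oplus>\<^bsub>U\<^esub>a\<in>?P. c (p a) \<otimes>\<^bsub>U\<^esub> (\<Oplus>\<^bsub>U\<^esub>b\<in>?Q. c (q b) \<otimes>\<^bsub>U\<^esub> e (a \<otimes>\<^bsub>M\<^esub> b)))"
  proof (rule S.finsum_cong'[OF refl])
    show "(\<lambda>a. c (p a) \<otimes>\<^bsub>U\<^esub> (\<Oplus>\<^bsub>U\<^esub>b\<in>?Q. c (q b) \<otimes>\<^bsub>U\<^esub> e (a \<otimes>\<^bsub>M\<^esub> b))) \<in> ?P \<rightarrow> carrier U"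
      using eU pK qK by (auto intro!: S.m_closed S.finsum_closed)
    fix a assume a: "a \<in> ?P"
    have "c (p a) \<otimes>\<^bsub>U\<^esub> (\<Oplus>\<^bsub>U\<^esub>b\<in>?Q. c (q b) \<otimes>\<^bsub>U\<^esub> e (a \<otimes>\<^bsub>M\<^esub> b)) =
        (\<Oplus>\<^bsub>U\<^esub>b\<in>?Q. c (p a) \<otimes>\<^bsub>U\<^esub> (c (q b) \<otimes>\<^bsub>U\<^esub> e (a \<otimes>\<^bsub>M\<^esub> b)))"
      using fin eU pK qK a by (intro S.finsum_rdistr) auto
    also have "\<dots> = (\<Oplus>\<^bsub>U\<^esub>b\<in>?Q. ?f (a, b))"
      using eU pK qK a by (intro S.finsum_cong') (auto simp: S.m_assoc)
    finally show "(\<Oplus>\<^bsub>U\<^esub>b\<in>?Q. ?f (a, b)) =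
      c (p a) \<otimes>\<^bsub>U\<^esub> (\<Oplus>\<^bsub>U\<^esub>b\<in>?Q. c (q b) \<otimes>\<^bsub>U\<^esub> e (a \<otimes>\<^bsub>M\<^esub> b))" ..
  qed
  finally show ?thesis
    by (simp only: mr_eval_def)
qed

lemma mr_eval_cong:
  assumes "p \<in> carrier (monoid_ring K M)" "e' \<in> carrier M \<rightarrow> carrier U"
    "\<And>a. a \<in> carrier K \<Longrightarrow> c' a = c a" "\<And>m. m \<in> carrier M \<Longrightarrow> e m = e' m"
  shows "mr_eval K U c' e p = mr_eval K U c e' p"
  unfolding mr_eval_def using assms
  by (intro S.finsum_cong') (auto simp: monoid_ring_carrier subset_iff Pi_def)

lemma mr_eval_rmult:
  assumes "p \<in> carrier (monoid_ring K M)" "e \<in> carrier M \<rightarrow> carrier U" "u \<in> carrier U"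
  shows "mr_eval K U c (\<lambda>m. e m \<otimes>\<^bsub>U\<^esub> u) p = mr_eval K U c e p \<otimes>\<^bsub>U\<^esub> u"
proof -
  have "mr_eval K U c e p \<otimes>\<^bsub>U\<^esub> u =
      (\<Oplus>\<^bsub>U\<^esub>m \<in> {m. p m \<noteq> \<zero>\<^bsub>K\<^esub>}. c (p m) \<otimes>\<^bsub>U\<^esub> e m \<otimes>\<^bsub>U\<^esub> u)"
    unfolding mr_eval_def using assms
    by (intro S.finsum_ldistr) (auto simp: monoid_ring_carrier subset_iff)
  also have "\<dots> = mr_eval K U c (\<lambda>m. e m \<otimes>\<^bsub>U\<^esub> u) p"
    unfolding mr_eval_def using assms
    by (intro S.finsum_cong') (auto simp: monoid_ring_carrier subset_iff S.m_assoc Pi_def)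
  finally show ?thesis ..
qed

text \<open>An exchange of two finite sums; commutativity of the product in
  \<open>monoid_ring\<close> comes from it.\<close>

lemma mr_eval_swap:
  assumes p: "p \<in> carrier (monoid_ring K M)" and q: "q \<in> carrier (monoid_ring K M)"
    and e: "\<And>a b. a \<in> carrier M \<Longrightarrow> b \<in> carrier M \<Longrightarrow> e a b \<in> carrier U"
  shows "mr_eval K U c (\<lambda>a. mr_eval K U c (e a) q) p = mr_eval K U c (\<lambda>b. mr_eval K U c (\<lambda>a. e a b) p) q"
proof -
  let ?P = "{m. p m \<noteq> \<zero>\<^bsub>K\<^esub>}" and ?Q = "{m. q m \<noteq> \<zero>\<^bsub>K\<^esub>}"
  have pK: "\<And>m. p m \<in> carrier K" and qK: "\<And>m. q m \<in> carrier K"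
    and fin: "finite ?P" "finite ?Q" and sub: "\<And>a. a \<in> ?P \<Longrightarrow> a \<in> carrier M" "\<And>a. a \<in> ?Q \<Longrightarrow> a \<in> carrier M"
    using p q by (auto simp: monoid_ring_carrier)
  have "mr_eval K U c (\<lambda>a. mr_eval K U c (e a) q) p =
      (\<Oplus>\<^bsub>U\<^esub>a\<in>?P. \<Oplus>\<^bsub>U\<^esub>b\<in>?Q. c (p a) \<otimes>\<^bsub>U\<^esub> (c (q b) \<otimes>\<^bsub>U\<^esub> e a b))"
    unfolding mr_eval_def using pK qK fin sub e
    by (intro S.finsum_cong' S.finsum_rdistr) (auto intro!: S.finsum_closed)
  also have "\<dots> = (\<Oplus>\<^bsub>U\<^esub>b\<in>?Q. \<Oplus>\<^bsub>U\<^esub>a\<in>?P. c (p a) \<otimes>\<^bsub>U\<^esub> (c (q b) \<otimes>\<^bsub>U\<^esub> e a b))"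
    using pK qK fin sub e by (intro S.finsum_swap) auto
  also have "\<dots> = (\<Oplus>\<^bsub>U\<^esub>b\<in>?Q. \<Oplus>\<^bsub>U\<^esub>a\<in>?P. c (q b) \<otimes>\<^bsub>U\<^esub> (c (p a) \<otimes>\<^bsub>U\<^esub> e a b))"
    using pK qK fin sub e by (intro S.finsum_cong') (auto intro!: S.finsum_closed simp: S.m_lcomm)
  also have "\<dots> = mr_eval K U c (\<lambda>b. mr_eval K U c (\<lambda>a. e a b) p) q"
    unfolding mr_eval_def using pK qK fin sub e
    by (intro S.finsum_cong' S.finsum_rdistr[symmetric]) (auto intro!: S.finsum_closed S.m_closed)
  finally show ?thesis .
qed

end

lemma mr_eval_indicator:
  assumes "cring K" "comm_monoid M" "p \<in> carrier (monoid_ring K M)"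
  shows "mr_eval K K id (\<lambda>m'. if m' = m then \<one>\<^bsub>K\<^esub> else \<zero>\<^bsub>K\<^esub>) p = p m"
proof -
  interpret cring K by fact
  interpret monoid_ring_eval K K id M
    using assms by (intro monoid_ring_eval.intro ring_hom_cring.intro ring_hom_cring_axioms.intro) auto
  \<comment> \<open>The index \<open>m\<close> is inserted because it may lie outside the support;
    the term there is then zero, as is the coefficient.\<close>
  have "mr_eval K K id (\<lambda>m'. if m' = m then \<one>\<^bsub>K\<^esub> else \<zero>\<^bsub>K\<^esub>) p =
      (\<Oplus>\<^bsub>K\<^esub>m'\<in>insert m {m. p m \<noteq> \<zero>\<^bsub>K\<^esub>}. if m' = m then p m' else \<zero>\<^bsub>K\<^esub>)"
    using assms(3) by (subst mr_eval_superset[of _ "insert m {m. p m \<noteq> \<zero>\<^bsub>K\<^esub>}"])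
      (auto simp: monoid_ring_carrier intro!: finsum_cong')
  also have "\<dots> = p m"
    using assms(3) by (intro add.finprod_singleton_swap) (auto simp: monoid_ring_carrier)
  finally show ?thesis .
qed

text \<open>Coefficients are evaluations at indicator functions, so equality can be tested by
  evaluating, without touching convolution sums.\<close>

lemma monoid_ring_eqI:
  assumes "cring K" "comm_monoid M" "p \<in> carrier (monoid_ring K M)" "q \<in> carrier (monoid_ring K M)"
    and "\<And>e. e \<in> carrier M \<rightarrow> carrier K \<Longrightarrow> mr_eval K K id e p = mr_eval K K id e q"
  shows "p = q"
proof
  fix m
  interpret cring K by fact
  show "p m = q m"
    using assms(5)[of "\<lambda>m'. if m' = m then \<one>\<^bsub>K\<^esub> else \<zero>\<^bsub>K\<^esub>"]
    by (simp add: mr_eval_indicator[OF assms(1-3)] mr_eval_indicator[OF assms(1,2,4)])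
qed

text \<open>After \<open>monoid_ring_eqI\<close>, each axiom of the product is an identity of
  iterated evaluations: associativity and the unit law take place inside the argument of
  \<open>e\<close>, commutativity is \<open>mr_eval_swap\<close>, distributivity is
  \<open>mr_eval_add\<close>.\<close>

lemma monoid_ring_cring:
  assumes "cring K" "comm_monoid M"
  shows "cring (monoid_ring K M)"
proof -
  interpret cring K by fact
  interpret monoid_ring_eval K K id M
    using assms by (intro monoid_ring_eval.intro ring_hom_cring.intro ring_hom_cring_axioms.intro) auto
  let ?P = "monoid_ring K M"
  have add: "p \<oplus>\<^bsub>?P\<^esub> q \<in> carrier ?P" if "p \<in> carrier ?P" "q \<in> carrier ?P" for p q
  proof -
    have sub: "{m. p m \<oplus>\<^bsub>K\<^esub> q m \<noteq> \<zero>\<^bsub>K\<^esub>} \<subseteq> {m. p m \<noteq> \<zero>\<^bsub>K\<^esub>} \<union> {m. q m \<noteq> \<zero>\<^bsub>K\<^esub>}"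
      using that by (auto simp: monoid_ring_carrier)
    have "finite ({m. p m \<noteq> \<zero>\<^bsub>K\<^esub>} \<union> {m. q m \<noteq> \<zero>\<^bsub>K\<^esub>})"
      "{m. p m \<noteq> \<zero>\<^bsub>K\<^esub>} \<union> {m. q m \<noteq> \<zero>\<^bsub>K\<^esub>} \<subseteq> carrier M"
      using that by (auto simp: monoid_ring_carrier)
    with sub have "finite {m. p m \<oplus>\<^bsub>K\<^esub> q m \<noteq> \<zero>\<^bsub>K\<^esub>}" "{m. p m \<oplus>\<^bsub>K\<^esub> q m \<noteq> \<zero>\<^bsub>K\<^esub>} \<subseteq> carrier M"
      by (auto intro: finite_subset)
    then show ?thesis
      using that by (simp add: monoid_ring_carrier monoid_ring_add)
  qed
  have neg: "(\<lambda>m. \<ominus>\<^bsub>K\<^esub> p m) \<in> carrier ?P" if "p \<in> carrier ?P" for p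
  proof -
    have "{m. \<ominus>\<^bsub>K\<^esub> p m \<noteq> \<zero>\<^bsub>K\<^esub>} \<subseteq> {m. p m \<noteq> \<zero>\<^bsub>K\<^esub>}"
      by auto
    then show ?thesis
      using that by (auto simp: monoid_ring_carrier intro: finite_subset)
  qed
  have one: "\<one>\<^bsub>?P\<^esub> \<in> carrier ?P"
    by (auto simp: monoid_ring_carrier monoid_ring_one single_def)
  show ?thesis
  proof (rule cringI)
    show "abelian_group ?P"
    proof (rule abelian_groupI)
      fix p assume "p \<in> carrier ?P"
      then show "\<exists>q\<in>carrier ?P. q \<oplus>\<^bsub>?P\<^esub> p = \<zero>\<^bsub>?P\<^esub>"
        using neg by (intro bexI[of _ "\<lambda>m. \<ominus>\<^bsub>K\<^esub> p m"])
          (auto simp: monoid_ring_add monoid_ring_zero monoid_ring_carrier l_neg)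
    qed (auto simp: add, auto simp: monoid_ring_carrier monoid_ring_add monoid_ring_zero a_ac)
    have mc: "p \<otimes>\<^bsub>?P\<^esub> q \<in> carrier ?P" if "p \<in> carrier ?P" "q \<in> carrier ?P" for p q
      using that by (rule monoid_ring_mult_closed)
    show "Group.comm_monoid ?P"
    proof (rule comm_monoidI)
      fix p q r assume pqr: "p \<in> carrier ?P" "q \<in> carrier ?P" "r \<in> carrier ?P"
      show "p \<otimes>\<^bsub>?P\<^esub> q \<otimes>\<^bsub>?P\<^esub> r = p \<otimes>\<^bsub>?P\<^esub> (q \<otimes>\<^bsub>?P\<^esub> r)"
      proof (rule monoid_ring_eqI[OF assms])
        fix e assume e: "e \<in> carrier M \<rightarrow> carrier K"
        have "mr_eval K K id e (p \<otimes>\<^bsub>?P\<^esub> q \<otimes>\<^bsub>?P\<^esub> r) = 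
          mr_eval K K id (\<lambda>a. mr_eval K K id (\<lambda>b. mr_eval K K id (\<lambda>z. e (a \<otimes>\<^bsub>M\<^esub> b \<otimes>\<^bsub>M\<^esub> z)) r) q) p"
          using pqr e by (subst mr_eval_mult_iterated | auto intro!: mc mr_eval_closed simp: Pi_def)+
        also have "\<dots> = mr_eval K K id (\<lambda>a. mr_eval K K id (\<lambda>b. mr_eval K K id (\<lambda>z. e (a \<otimes>\<^bsub>M\<^esub> (b \<otimes>\<^bsub>M\<^esub> z))) r) q) p"
          using pqr e by (intro mr_eval_cong) (auto intro!: mr_eval_closed simp: Pi_def M.m_assoc)
        also have "\<dots> = mr_eval K K id (\<lambda>a. mr_eval K K id (\<lambda>b. e (a \<otimes>\<^bsub>M\<^esub> b)) (q \<otimes>\<^bsub>?P\<^esub> r)) p"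
          using pqr e by (intro mr_eval_cong mr_eval_mult_iterated[symmetric]) (auto intro!: mc mr_eval_closed)
        also have "\<dots> = mr_eval K K id e (p \<otimes>\<^bsub>?P\<^esub> (q \<otimes>\<^bsub>?P\<^esub> r))"
          using pqr e by (intro mr_eval_mult_iterated[symmetric]) (auto intro!: mc)
        finally show "mr_eval K K id e (p \<otimes>\<^bsub>?P\<^esub> q \<otimes>\<^bsub>?P\<^esub> r) = mr_eval K K id e (p \<otimes>\<^bsub>?P\<^esub> (q \<otimes>\<^bsub>?P\<^esub> r))" .
      qed (use pqr mc in auto)
      show "p \<otimes>\<^bsub>?P\<^esub> q = q \<otimes>\<^bsub>?P\<^esub> p"
      proof (rule monoid_ring_eqI[OF assms])
        fix e assume e: "e \<in> carrier M \<rightarrow> carrier K"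
        have "mr_eval K K id (\<lambda>b. mr_eval K K id (\<lambda>a. e (a \<otimes>\<^bsub>M\<^esub> b)) p) q =
          mr_eval K K id (\<lambda>b. mr_eval K K id (\<lambda>a. e (b \<otimes>\<^bsub>M\<^esub> a)) p) q"
          using pqr e by (intro mr_eval_cong) (auto intro!: mr_eval_closed simp: Pi_def M.m_comm)
        then show "mr_eval K K id e (p \<otimes>\<^bsub>?P\<^esub> q) = mr_eval K K id e (q \<otimes>\<^bsub>?P\<^esub> p)"
          using pqr e by (simp add: mr_eval_mult_iterated mr_eval_swap[of p q] Pi_def)
      qed (use pqr mc in auto)
      show "\<one>\<^bsub>?P\<^esub> \<otimes>\<^bsub>?P\<^esub> p = p"
      proof (rule monoid_ring_eqI[OF assms])
        fix e assume e: "e \<in> carrier M \<rightarrow> carrier K"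
        have "mr_eval K K id e (\<one>\<^bsub>?P\<^esub> \<otimes>\<^bsub>?P\<^esub> p) = mr_eval K K id (\<lambda>b. e (\<one>\<^bsub>M\<^esub> \<otimes>\<^bsub>M\<^esub> b)) p"
          using pqr e one by (simp add: mr_eval_mult_iterated monoid_ring_one mr_eval_single Pi_def)
        also have "\<dots> = mr_eval K K id e p"
          using pqr e by (intro mr_eval_cong) auto
        finally show "mr_eval K K id e (\<one>\<^bsub>?P\<^esub> \<otimes>\<^bsub>?P\<^esub> p) = mr_eval K K id e p" .
      qed (use pqr mc one in auto)
    qed (use mc one in auto)
    fix p q r assume pqr: "p \<in> carrier ?P" "q \<in> carrier ?P" "r \<in> carrier ?P"
    show "(p \<oplus>\<^bsub>?P\<^esub> q) \<otimes>\<^bsub>?P\<^esub> r = p \<otimes>\<^bsub>?P\<^esub> r \<oplus>\<^bsub>?P\<^esub> q \<otimes>\<^bsub>?P\<^esub> r"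
      using pqr
      by (intro monoid_ring_eqI[OF assms]) (auto simp: mr_eval_mult_iterated mr_eval_add add mc Pi_def)
  qed
qed

lemma (in monoid_ring_eval) mr_eval_hom:
  assumes e: "e \<in> carrier M \<rightarrow> carrier U" "e \<one>\<^bsub>M\<^esub> = \<one>\<^bsub>U\<^esub>"
    "\<And>a b. a \<in> carrier M \<Longrightarrow> b \<in> carrier M \<Longrightarrow> e (a \<otimes>\<^bsub>M\<^esub> b) = e a \<otimes>\<^bsub>U\<^esub> e b"
  shows "mr_eval K U c e \<in> ring_hom (monoid_ring K M) U"
proof (rule ring_hom_memI)
  fix p q assume pq: "p \<in> carrier (monoid_ring K M)" "q \<in> carrier (monoid_ring K M)"
  \<comment> \<open>The two values of \<open>e\<close> are written in swapped order because
    \<open>mr_eval_rmult\<close> extracts a factor standing on the right.\<close>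
  have "mr_eval K U c e (p \<otimes>\<^bsub>monoid_ring K M\<^esub> q) =
      mr_eval K U c (\<lambda>a. mr_eval K U c (\<lambda>b. e b \<otimes>\<^bsub>U\<^esub> e a) q) p"
    unfolding mr_eval_mult_iterated[OF pq e(1)] using pq e
    by (intro mr_eval_cong mr_eval_closed) (auto intro!: mr_eval_closed simp: Pi_def S.m_comm)
  also have "\<dots> = mr_eval K U c (\<lambda>a. e a \<otimes>\<^bsub>U\<^esub> mr_eval K U c e q) p"
    using pq e(1) by (intro mr_eval_cong) (auto simp: mr_eval_rmult Pi_def S.m_comm)
  also have "\<dots> = mr_eval K U c e p \<otimes>\<^bsub>U\<^esub> mr_eval K U c e q"
    using pq e(1) by (intro mr_eval_rmult) auto
  finally show "mr_eval K U c e (p \<otimes>\<^bsub>monoid_ring K M\<^esub> q) = mr_eval K U c e p \<otimes>\<^bsub>U\<^esub> mr_eval K U c e q" .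
qed (use e in \<open>auto simp: mr_eval_add monoid_ring_one mr_eval_single\<close>)

section \<open>Quotients and tensor products\<close>

lemma ring_hom_cringI':
  assumes "cring K" "cring U" "c \<in> ring_hom K U"
  shows "ring_hom_cring K U c"
  using assms by (simp add: ring_hom_cring_def ring_hom_cring_axioms_def)

lemma monoid_ring_evalI:
  assumes "cring K" "cring U" "c \<in> ring_hom K U" "comm_monoid M"
  shows "monoid_ring_eval K U c M"
  using assms by (simp add: monoid_ring_eval_def ring_hom_cringI')

lemma single_closed [simp]:
  assumes "cring K" "m \<in> carrier M" "a \<in> carrier K"
  shows "single K m a \<in> carrier (monoid_ring K M)"
proof -
  interpret cring K by fact
  show ?thesis
    using assms by (auto simp: monoid_ring_carrier single_def)
qed

lemma single_mult:
  assumes "cring K" "comm_monoid M" "m \<in> carrier M" "m' \<in> carrier M" "a \<in> carrier K" "b \<in> carrier K"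
  shows "single K m a \<otimes>\<^bsub>monoid_ring K M\<^esub> single K m' b = single K (m \<otimes>\<^bsub>M\<^esub> m') (a \<otimes>\<^bsub>K\<^esub> b)"
proof -
  interpret cring K by fact
  interpret monoid_ring_eval K K id M
    using assms by (intro monoid_ring_evalI) auto
  show ?thesis
    using assms
    by (intro monoid_ring_eqI[of K M] monoid_ring_mult_closed)
      (auto simp: mr_eval_mult_iterated mr_eval_single m_assoc Pi_def)
qed

lemma single_add:
  assumes "cring K"
  shows "single K m (a \<oplus>\<^bsub>K\<^esub> b) = single K m a \<oplus>\<^bsub>monoid_ring K M\<^esub> single K m b"
proof -
  interpret cring K by fact
  show ?thesis
    by (auto simp: single_def monoid_ring_add)
qed

text \<open>Closure of \<open>T\<close> under zero and sums suffices, so this applies to subrings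
  and also to the set of linear combinations in \<open>P_lincomb\<close>.\<close>

lemma (in abelian_monoid) finsum_in:
  assumes "\<zero> \<in> T" "\<And>a b. a \<in> T \<Longrightarrow> b \<in> T \<Longrightarrow> a \<oplus> b \<in> T" "T \<subseteq> carrier G" "f \<in> A \<rightarrow> T"
  shows "finsum G f A \<in> T"
  using assms(4)
proof (induction A rule: infinite_finite_induct)
  case (insert a A)
  then have "f a \<in> T" "f \<in> A \<rightarrow> T"
    by auto
  then show ?case
    using insert assms by (subst finsum_insert) (auto simp: Pi_def subset_iff)
qed (use assms in auto)

lemma (in comm_monoid) finprod_in:
  assumes "\<one> \<in> T" "\<And>a b. a \<in> T \<Longrightarrow> b \<in> T \<Longrightarrow> a \<otimes> b \<in> T" "T \<subseteq> carrier G" "f \<in> A \<rightarrow> T"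
  shows "finprod G f A \<in> T"
  using assms(4)
proof (induction A rule: infinite_finite_induct)
  case (insert a A)
  then have "f a \<in> T" "f \<in> A \<rightarrow> T"
    by auto
  then show ?case
    using insert assms by (subst finprod_insert) (auto simp: Pi_def subset_iff)
qed (use assms in auto)

context monoid_ring_eval
begin

lemma hom_mr_eval:
  assumes "cring V" "h \<in> ring_hom U V" "p \<in> carrier (monoid_ring K M)" "e \<in> carrier M \<rightarrow> carrier U"
  shows "h (mr_eval K U c e p) = mr_eval K V (\<lambda>a. h (c a)) (\<lambda>m. h (e m)) p"
proof -
  interpret h: ring_hom_cring U V h
    using assms by (intro ring_hom_cringI') (auto intro: S.is_cring)
  show ?thesis
    unfolding mr_eval_def using assms
    by (subst h.hom_finsum)
      (auto simp: monoid_ring_carrier subset_iff Pi_def intro!: h.S.finsum_cong')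
qed

lemma mr_eval_in_subring:
  assumes T: "subring T U" and "p \<in> carrier (monoid_ring K M)"
    and "\<And>a. a \<in> carrier K \<Longrightarrow> c a \<in> T" "\<And>m. m \<in> carrier M \<Longrightarrow> e m \<in> T"
  shows "mr_eval K U c e p \<in> T"
  unfolding mr_eval_def using assms subringE[OF T]
  by (intro S.finsum_in) (auto simp: monoid_ring_carrier subset_iff)

end

text \<open>The canonical map from the integers, which is the coefficient map in
  \<open>tensor_lift\<close>.\<close>

abbreviation int_embed :: "('u, 'm) ring_scheme \<Rightarrow> int \<Rightarrow> 'u" where
  "int_embed U \<equiv> \<lambda>n. add_pow U n \<one>\<^bsub>U\<^esub>"

lemma int_ring_hom:
  assumes "cring U"
  shows "int_embed U \<in> ring_hom int_ring U"
proof -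
  interpret cring U by fact
  show ?thesis
  proof (rule ring_hom_memI)
    fix i j :: int
    have "int_embed U (i * j) = add_pow U j (int_embed U i)"
      by (rule add.int_pow_pow[symmetric]) simp
    also have "\<dots> = int_embed U i \<otimes>\<^bsub>U\<^esub> int_embed U j"
      by (simp add: add_pow_rdistr_int)
    finally show "int_embed U (i \<otimes>\<^bsub>int_ring\<^esub> j) = int_embed U i \<otimes>\<^bsub>U\<^esub> int_embed U j"
      by simp
  qed (auto simp: add.int_pow_mult)
qed

lemma hom_int_multiple:
  assumes "cring U" "cring V" "h \<in> ring_hom U V"
  shows "h (int_embed U n) = int_embed V n"
proof -
  interpret h: ring_hom_cring U V h
    using assms by (rule ring_hom_cringI')
  show ?thesis
    using group_hom.hom_int_pow[OF h.ring.a_group_hom, of "\<one>\<^bsub>U\<^esub>" n] by (simp add: add_pow_def)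
qed

lemma quot_carrierE:
  assumes "X \<in> carrier (F Quot I)"
  obtains a where "a \<in> carrier F" "X = I +>\<^bsub>F\<^esub> a"
  using assms by (auto simp: FactRing_def A_RCOSETS_def')

text \<open>The homomorphism theorem, with the induced map written by \<open>the_elem\<close> as in
  \<open>tensor_lift\<close>, \<open>parts_proj\<close> and \<open>to_dual\<close>. The first
  conclusion, that a whole coset has a single value, is kept for \<open>coset_map\<close>, which
  takes a union instead.\<close>

lemma quot_lift:
  assumes F: "cring F" and U: "cring U" and h: "h \<in> ring_hom F U" and I: "ideal I F"
    and kills: "\<And>a. a \<in> I \<Longrightarrow> h a = \<zero>\<^bsub>U\<^esub>"
  shows "\<And>a. a \<in> carrier F \<Longrightarrow> h ` (I +>\<^bsub>F\<^esub> a) = {h a}"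
    and "\<And>a. a \<in> carrier F \<Longrightarrow> the_elem (h ` (I +>\<^bsub>F\<^esub> a)) = h a"
    and "(\<lambda>X. the_elem (h ` X)) \<in> ring_hom (F Quot I) U"
proof -
  interpret ring_hom_cring F U h
    using F U h by (rule ring_hom_cringI')
  interpret I: ideal I F by fact
  show image: "h ` (I +>\<^bsub>F\<^esub> a) = {h a}" if "a \<in> carrier F" for a
  proof (intro equalityI subsetI)
    show "y \<in> {h a}" if "y \<in> h ` (I +>\<^bsub>F\<^esub> a)" for y
      using that kills \<open>a \<in> carrier F\<close> I.a_Hcarr by (auto simp: a_r_coset_def')
    show "y \<in> h ` (I +>\<^bsub>F\<^esub> a)" if "y \<in> {h a}" for y
      using that \<open>a \<in> carrier F\<close> I.a_rcos_self by auto
  qed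
  then show cls: "the_elem (h ` (I +>\<^bsub>F\<^esub> a)) = h a" if "a \<in> carrier F" for a
    using that by simp
  have q: "(+>\<^bsub>F\<^esub>) I \<in> ring_hom F (F Quot I)"
    by (rule I.rcos_ring_hom)
  show "(\<lambda>X. the_elem (h ` X)) \<in> ring_hom (F Quot I) U"
  proof (rule ring_hom_memI)
    fix X Y assume "X \<in> carrier (F Quot I)" "Y \<in> carrier (F Quot I)"
    then obtain a b where "a \<in> carrier F" "X = I +>\<^bsub>F\<^esub> a" "b \<in> carrier F" "Y = I +>\<^bsub>F\<^esub> b"
      by (metis quot_carrierE)
    then show "the_elem (h ` (X \<otimes>\<^bsub>F Quot I\<^esub> Y)) = the_elem (h ` X) \<otimes>\<^bsub>U\<^esub> the_elem (h ` Y)"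
      "the_elem (h ` (X \<oplus>\<^bsub>F Quot I\<^esub> Y)) = the_elem (h ` X) \<oplus>\<^bsub>U\<^esub> the_elem (h ` Y)"
      using ring_hom_mult[OF q, of a b] ring_hom_add[OF q, of a b]
      by (simp_all add: cls flip: ring_hom_mult[OF q] ring_hom_add[OF q])
  next
    fix X assume "X \<in> carrier (F Quot I)"
    then show "the_elem (h ` X) \<in> carrier U"
      by (metis quot_carrierE cls hom_closed)
  next
    show "the_elem (h ` \<one>\<^bsub>F Quot I\<^esub>) = \<one>\<^bsub>U\<^esub>"
      using cls[of "\<one>\<^bsub>F\<^esub>"] ring_hom_one[OF q] by simp
  qed
qed

text \<open>The kernel is an ideal, so it contains the generated ideal as soon as it contains the
  generators.\<close>

lemma Idl_kills:
  assumes F: "cring F" and U: "cring U" and h: "h \<in> ring_hom F U"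
    and G: "\<And>a. a \<in> G \<Longrightarrow> a \<in> carrier F \<and> h a = \<zero>\<^bsub>U\<^esub>" and a: "a \<in> Idl\<^bsub>F\<^esub> G"
  shows "h a = \<zero>\<^bsub>U\<^esub>"
proof -
  interpret ring_hom_cring F U h
    using F U h by (rule ring_hom_cringI')
  have "G \<subseteq> a_kernel F U h"
  proof
    show "a \<in> a_kernel F U h" if "a \<in> G" for a
      unfolding a_kernel_def' using G[OF that] by (rule CollectI)
  qed
  then have "Idl\<^bsub>F\<^esub> G \<subseteq> a_kernel F U h"
    by (intro R.genideal_minimal ring.kernel_is_ideal)
  then show ?thesis
    using a unfolding a_kernel_def' by blast
qed

lemma genideal_incl: "a \<in> G \<Longrightarrow> a \<in> Idl\<^bsub>F\<^esub> G"
  by (auto simp: genideal_def)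

text \<open>It is instantiated three times for good coordinates: with R[X] and \<open>A0\<close>
  over R0[X], and with \<open>R\<close> and either \<open>A0\<close> or \<open>P0\<close> over
  \<open>R0\<close>.\<close>

locale tensor_product = f: ring_hom_cring K S f + g: ring_hom_cring K T g for K S T f g
begin

abbreviation "F \<equiv> free_pairs S T"
abbreviation "J \<equiv> tensor_ideal K S T f g"
abbreviation "ST \<equiv> tensor K S T f g"

lemma comm_monoid_pairs: "comm_monoid (S \<times>\<times> T)"
  by (rule comm_monoidI)
    (auto simp: f.S.m_assoc g.S.m_assoc intro: f.S.m_comm g.S.m_comm)

lemma cring_F: "cring F"
  by (rule monoid_ring_cring[OF int_is_cring comm_monoid_pairs])

lemma gpair_closed [simp]: "s \<in> carrier S \<Longrightarrow> t \<in> carrier T \<Longrightarrow> gpair s t \<in> carrier F"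
  by (rule single_closed[OF int_is_cring]) auto

lemma ideal_J: "ideal J F"
proof -
  interpret F: cring F by (rule cring_F)
  show ?thesis
    unfolding tensor_ideal_def
    by (intro F.genideal_ideal) (auto intro!: F.minus_closed F.add.m_closed)
qed

lemma tensor_ideal_rel:
  assumes "s \<in> carrier S" "s' \<in> carrier S" "t \<in> carrier T" "t' \<in> carrier T" "k \<in> carrier K"
  shows "gpair (s \<oplus>\<^bsub>S\<^esub> s') t \<ominus>\<^bsub>F\<^esub> (gpair s t \<oplus>\<^bsub>F\<^esub> gpair s' t) \<in> J"
    "gpair s (t \<oplus>\<^bsub>T\<^esub> t') \<ominus>\<^bsub>F\<^esub> (gpair s t \<oplus>\<^bsub>F\<^esub> gpair s t') \<in> J"
    "gpair (f k \<otimes>\<^bsub>S\<^esub> s) t \<ominus>\<^bsub>F\<^esub> gpair s (g k \<otimes>\<^bsub>T\<^esub> t) \<in> J"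
proof -
  show "gpair (s \<oplus>\<^bsub>S\<^esub> s') t \<ominus>\<^bsub>F\<^esub> (gpair s t \<oplus>\<^bsub>F\<^esub> gpair s' t) \<in> J"
    unfolding tensor_ideal_def by (rule genideal_incl, rule UnI1, rule UnI1, rule CollectI, intro exI conjI) (rule refl assms)+
  show "gpair s (t \<oplus>\<^bsub>T\<^esub> t') \<ominus>\<^bsub>F\<^esub> (gpair s t \<oplus>\<^bsub>F\<^esub> gpair s t') \<in> J"
    unfolding tensor_ideal_def by (rule genideal_incl, rule UnI1, rule UnI2, rule CollectI, intro exI conjI) (rule refl assms)+
  show "gpair (f k \<otimes>\<^bsub>S\<^esub> s) t \<ominus>\<^bsub>F\<^esub> gpair s (g k \<otimes>\<^bsub>T\<^esub> t) \<in> J"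
    unfolding tensor_ideal_def by (rule genideal_incl, rule UnI2, rule CollectI, intro exI conjI) (rule refl assms)+
qed

lemma cring_tensor: "cring ST"
  unfolding tensor_def by (rule ideal.quotient_is_cring[OF ideal_J cring_F])

lemma class_hom: "(+>\<^bsub>F\<^esub>) J \<in> ring_hom F ST"
  unfolding tensor_def by (rule ideal.rcos_ring_hom[OF ideal_J])

lemma tensor_carrierE:
  assumes "W \<in> carrier ST"
  obtains w where "w \<in> carrier F" "W = J +>\<^bsub>F\<^esub> w"
  using assms unfolding tensor_def by (rule quot_carrierE)

lemma pure_closed [simp]:
  "s \<in> carrier S \<Longrightarrow> t \<in> carrier T \<Longrightarrow> pure_tensor K S T f g s t \<in> carrier ST"
  unfolding pure_tensor_def by (rule ring_hom_closed[OF class_hom]) simp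

lemma pure_mult:
  assumes "s \<in> carrier S" "s' \<in> carrier S" "t \<in> carrier T" "t' \<in> carrier T"
  shows "pure_tensor K S T f g s t \<otimes>\<^bsub>ST\<^esub> pure_tensor K S T f g s' t' =
    pure_tensor K S T f g (s \<otimes>\<^bsub>S\<^esub> s') (t \<otimes>\<^bsub>T\<^esub> t')"
proof -
  have "gpair s t \<otimes>\<^bsub>F\<^esub> gpair s' t' = gpair (s \<otimes>\<^bsub>S\<^esub> s') (t \<otimes>\<^bsub>T\<^esub> t')"
    using assms single_mult[OF int_is_cring comm_monoid_pairs, of "(s, t)" "(s', t')" 1 1] by simp
  then show ?thesis
    unfolding pure_tensor_def using assms by (simp flip: ring_hom_mult[OF class_hom])
qed

lemma pure_add:
  assumes "s \<in> carrier S" "s' \<in> carrier S" "t \<in> carrier T" "t' \<in> carrier T"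
  shows "pure_tensor K S T f g (s \<oplus>\<^bsub>S\<^esub> s') t =
      pure_tensor K S T f g s t \<oplus>\<^bsub>ST\<^esub> pure_tensor K S T f g s' t"
    "pure_tensor K S T f g s (t \<oplus>\<^bsub>T\<^esub> t') =
      pure_tensor K S T f g s t \<oplus>\<^bsub>ST\<^esub> pure_tensor K S T f g s t'"
proof -
  interpret F: cring F by (rule cring_F)
  have "J +>\<^bsub>F\<^esub> gpair (s \<oplus>\<^bsub>S\<^esub> s') t = J +>\<^bsub>F\<^esub> (gpair s t \<oplus>\<^bsub>F\<^esub> gpair s' t)"
    "J +>\<^bsub>F\<^esub> gpair s (t \<oplus>\<^bsub>T\<^esub> t') = J +>\<^bsub>F\<^esub> (gpair s t \<oplus>\<^bsub>F\<^esub> gpair s t')"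
    using assms tensor_ideal_rel[OF assms f.R.one_closed]
    by (simp_all add: F.quotient_eq_iff_same_a_r_cos[OF ideal_J])
  then show "pure_tensor K S T f g (s \<oplus>\<^bsub>S\<^esub> s') t =
      pure_tensor K S T f g s t \<oplus>\<^bsub>ST\<^esub> pure_tensor K S T f g s' t"
    "pure_tensor K S T f g s (t \<oplus>\<^bsub>T\<^esub> t') =
      pure_tensor K S T f g s t \<oplus>\<^bsub>ST\<^esub> pure_tensor K S T f g s t'"
    unfolding pure_tensor_def using assms by (simp_all add: ring_hom_add[OF class_hom])
qed

lemma pure_one: "pure_tensor K S T f g \<one>\<^bsub>S\<^esub> \<one>\<^bsub>T\<^esub> = \<one>\<^bsub>ST\<^esub>"
  unfolding pure_tensor_def using ring_hom_one[OF class_hom] by (simp add: monoid_ring_one)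

lemma pure_left_hom: "(\<lambda>s. pure_tensor K S T f g s \<one>\<^bsub>T\<^esub>) \<in> ring_hom S ST"
  by (rule ring_hom_memI) (auto simp: pure_mult pure_one pure_add(1)[where t' = "\<one>\<^bsub>T\<^esub>"])

lemma pure_right_hom: "(\<lambda>t. pure_tensor K S T f g \<one>\<^bsub>S\<^esub> t) \<in> ring_hom T ST"
  by (rule ring_hom_memI) (auto simp: pure_mult pure_one pure_add(2)[where s' = "\<one>\<^bsub>S\<^esub>"])

lemma pure_balanced:
  assumes "k \<in> carrier K"
  shows "pure_tensor K S T f g (f k) \<one>\<^bsub>T\<^esub> = pure_tensor K S T f g \<one>\<^bsub>S\<^esub> (g k)"
proof -
  interpret F: cring F by (rule cring_F)
  show ?thesis
    unfolding pure_tensor_def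
    using assms tensor_ideal_rel(3)[of "\<one>\<^bsub>S\<^esub>" "\<one>\<^bsub>S\<^esub>" "\<one>\<^bsub>T\<^esub>" "\<one>\<^bsub>T\<^esub>" k]
    by (simp add: F.quotient_eq_iff_same_a_r_cos[OF ideal_J])
qed

lemma pairs_eval:
  assumes "cring U"
  shows "monoid_ring_eval int_ring U (int_embed U) (S \<times>\<times> T)"
  by (intro monoid_ring_evalI int_is_cring assms int_ring_hom comm_monoid_pairs)

text \<open>The universal property. Evaluating formal sums at \<open>u s \<otimes> v t\<close> is
  multiplicative because \<open>U\<close> is commutative; it kills the additivity relations by
  distributivity and the balancing relations by \<open>uv\<close>.\<close>

lemma
  assumes U: "cring U" and u: "u \<in> ring_hom S U" and v: "v \<in> ring_hom T U"
    and uv: "\<And>k. k \<in> carrier K \<Longrightarrow> u (f k) = v (g k)"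
  shows tensor_lift_class: "w \<in> carrier F \<Longrightarrow> tensor_lift U u v (J +>\<^bsub>F\<^esub> w) =
      mr_eval int_ring U (int_embed U) (\<lambda>(s, t). u s \<otimes>\<^bsub>U\<^esub> v t) w"
    and tensor_lift_hom: "tensor_lift U u v \<in> ring_hom ST U"
    and tensor_lift_pure: "s \<in> carrier S \<Longrightarrow> t \<in> carrier T \<Longrightarrow>
      tensor_lift U u v (pure_tensor K S T f g s t) = u s \<otimes>\<^bsub>U\<^esub> v t"
proof -
  interpret U: cring U by fact
  interpret F: cring F by (rule cring_F)
  interpret ev: monoid_ring_eval int_ring U "int_embed U" "S \<times>\<times> T"
    using U by (rule pairs_eval)
  interpret u: ring_hom_cring S U u
    by (intro ring_hom_cringI' U u f.S.is_cring)
  interpret v: ring_hom_cring T U v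
    by (intro ring_hom_cringI' U v g.S.is_cring)
  let ?h = "mr_eval int_ring U (int_embed U) (\<lambda>(s, t). u s \<otimes>\<^bsub>U\<^esub> v t)"
  have h: "?h \<in> ring_hom F U"
    by (rule ev.mr_eval_hom) (auto simp: U.m_ac)
  interpret h: ring_hom_cring F U ?h
    by (intro ring_hom_cringI' cring_F U h)
  have gp: "?h (gpair s t) = u s \<otimes>\<^bsub>U\<^esub> v t" if "s \<in> carrier S" "t \<in> carrier T" for s t
    using that by (subst ev.mr_eval_single) auto
  have kills: "?h a = \<zero>\<^bsub>U\<^esub>" if "a \<in> J" for a
    using that unfolding tensor_ideal_def
    by (rule Idl_kills[OF cring_F U h, rotated])
      (auto simp: F.minus_eq gp U.l_distr U.r_distr uv U.r_neg U.m_ac)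
  note lift = quot_lift[OF cring_F U h ideal_J]
  show cl: "tensor_lift U u v (J +>\<^bsub>F\<^esub> w) = ?h w" if "w \<in> carrier F" for w
    unfolding tensor_lift_def using kills that by (rule lift(2))
  show "tensor_lift U u v \<in> ring_hom ST U"
    unfolding tensor_lift_def[abs_def] tensor_def using kills by (rule lift(3))
  show "tensor_lift U u v (pure_tensor K S T f g s t) = u s \<otimes>\<^bsub>U\<^esub> v t" if "s \<in> carrier S" "t \<in> carrier T"
    unfolding pure_tensor_def using that by (simp add: cl gp)
qed

text \<open>Naturality of the lift, which takes the place of a separate uniqueness statement: two
  maps out of a tensor product are identified by their values on the factors. The maps
  \<open>u'\<close> and \<open>v'\<close> are related to the composites only on the carriers, so
  that they can be given in simplified form.\<close>

lemma tensor_lift_comp: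
  assumes U: "cring U" and u: "u \<in> ring_hom S U" and v: "v \<in> ring_hom T U"
    and uv: "\<And>k. k \<in> carrier K \<Longrightarrow> u (f k) = v (g k)"
    and V: "cring V" and h: "h \<in> ring_hom U V" and W: "W \<in> carrier ST"
    and u': "\<And>s. s \<in> carrier S \<Longrightarrow> u' s = h (u s)" and v': "\<And>t. t \<in> carrier T \<Longrightarrow> v' t = h (v t)"
  shows "h (tensor_lift U u v W) = tensor_lift V u' v' W"
proof -
  interpret U: cring U by fact
  interpret V: cring V by fact
  interpret ev: monoid_ring_eval int_ring U "int_embed U" "S \<times>\<times> T"
    using U by (rule pairs_eval)
  interpret ev': monoid_ring_eval int_ring V "int_embed V" "S \<times>\<times> T"
    using V by (rule pairs_eval)
  interpret u: ring_hom_cring S U u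
    by (intro ring_hom_cringI' U u f.S.is_cring)
  interpret v: ring_hom_cring T U v
    by (intro ring_hom_cringI' U v g.S.is_cring)
  interpret h: ring_hom_cring U V h
    by (intro ring_hom_cringI' U V h)
  obtain w where w: "w \<in> carrier F" "W = J +>\<^bsub>F\<^esub> w"
    using W by (rule tensor_carrierE)
  have u'h: "u' \<in> ring_hom S V"
    using u' by (intro ring_hom_memI) auto
  have v'h: "v' \<in> ring_hom T V"
    using v' by (intro ring_hom_memI) auto
  have "h (tensor_lift U u v W) = mr_eval int_ring V (\<lambda>n. h (int_embed U n)) (\<lambda>m. h (case m of (s, t) \<Rightarrow> u s \<otimes>\<^bsub>U\<^esub> v t)) w"
    using w by (subst ev.hom_mr_eval[symmetric, OF V h]) (auto simp: tensor_lift_class[OF U u v uv])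
  also have "\<dots> = mr_eval int_ring V (int_embed V) (\<lambda>(s, t). u' s \<otimes>\<^bsub>V\<^esub> v' t) w"
    using w u' v' by (intro ev'.mr_eval_cong) (auto simp: hom_int_multiple[OF U V h])
  also have "\<dots> = tensor_lift V u' v' W"
    using w uv by (subst w(2), subst tensor_lift_class[OF V u'h v'h]) (auto simp: u' v')
  finally show ?thesis .
qed

lemma tensor_lift_in_subring:
  assumes U: "cring U" and u: "u \<in> ring_hom S U" and v: "v \<in> ring_hom T U"
    and uv: "\<And>k. k \<in> carrier K \<Longrightarrow> u (f k) = v (g k)"
    and Q: "subring Q U" and W: "W \<in> carrier ST"
    and "\<And>s. s \<in> carrier S \<Longrightarrow> u s \<in> Q" "\<And>t. t \<in> carrier T \<Longrightarrow> v t \<in> Q"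
  shows "tensor_lift U u v W \<in> Q"
proof -
  interpret U: cring U by fact
  interpret ev: monoid_ring_eval int_ring U "int_embed U" "S \<times>\<times> T"
    using U by (rule pairs_eval)
  interpret Q: cring "U\<lparr>carrier := Q\<rparr>"
    using Q subringE[OF Q] U.subcring_iff[of Q] U.subcringI'[OF Q] by blast
  \<comment> \<open>Integer multiples of one are formed in the ring \<open>Q\<close> and carried
    over by its inclusion, which shows that the integer coefficients of the evaluation land in
    \<open>Q\<close>.\<close>
  have "id \<in> ring_hom (U\<lparr>carrier := Q\<rparr>) U"
    using subringE[OF Q] by (auto simp: ring_hom_def)
  then have int: "int_embed U n \<in> Q" for n :: int
    using hom_int_multiple[OF Q.is_cring U, of id n]
      ring_hom_closed[OF int_ring_hom[OF Q.is_cring], of n] by simp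
  obtain w where w: "w \<in> carrier F" "W = J +>\<^bsub>F\<^esub> w"
    using W by (rule tensor_carrierE)
  then show ?thesis
    using assms subringE[OF Q] int
    by (auto simp: tensor_lift_class[OF U u v uv] intro!: ev.mr_eval_in_subring[OF Q])
qed

end

text \<open>The induction runs over a finite set containing the support and clears one coefficient
  at a time. With a superset of the support, a coefficient that is already zero causes no
  trouble.\<close>

lemma monoid_ring_induct [consumes 2, case_names zero single add]:
  assumes K: "cring K" and p: "p \<in> carrier (monoid_ring K M)"
    and zero: "P \<zero>\<^bsub>monoid_ring K M\<^esub>"
    and single: "\<And>m a. m \<in> carrier M \<Longrightarrow> a \<in> carrier K \<Longrightarrow> P (single K m a)"
    and add: "\<And>p q. p \<in> carrier (monoid_ring K M) \<Longrightarrow> q \<in> carrier (monoid_ring K M) \<Longrightarrow> P p \<Longrightarrow> P q \<Longrightarrow>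
      P (p \<oplus>\<^bsub>monoid_ring K M\<^esub> q)"
  shows "P p"
proof -
  interpret cring K by fact
  have "P p" if "finite B" "p \<in> carrier (monoid_ring K M)" "{m. p m \<noteq> \<zero>\<^bsub>K\<^esub>} \<subseteq> B" for B p
    using that
  proof (induction B arbitrary: p rule: finite_induct)
    case empty
    then have "p = \<zero>\<^bsub>monoid_ring K M\<^esub>"
      by (auto simp: monoid_ring_zero)
    then show ?case
      using zero by simp
  next
    case (insert m B)
    show ?case
    proof (cases "p m = \<zero>\<^bsub>K\<^esub>")
      case True
      then show ?thesis
        using insert by auto
    next
      case False
      have "{m'. (p(m := \<zero>\<^bsub>K\<^esub>)) m' \<noteq> \<zero>\<^bsub>K\<^esub>} \<subseteq> {m. p m \<noteq> \<zero>\<^bsub>K\<^esub>}"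
        by auto
      then have q: "p(m := \<zero>\<^bsub>K\<^esub>) \<in> carrier (monoid_ring K M)"
        using insert.prems(1) by (auto simp: monoid_ring_carrier intro: finite_subset)
      have m: "m \<in> carrier M" "p m \<in> carrier K"
        using insert.prems(1) False by (auto simp: monoid_ring_carrier)
      have "P (p(m := \<zero>\<^bsub>K\<^esub>))"
        using insert.prems by (intro insert.IH q) auto
      then have "P (single K m (p m) \<oplus>\<^bsub>monoid_ring K M\<^esub> p(m := \<zero>\<^bsub>K\<^esub>))"
        using m K by (intro add single single_closed q) auto
      also have "single K m (p m) \<oplus>\<^bsub>monoid_ring K M\<^esub> p(m := \<zero>\<^bsub>K\<^esub>) = p"
        using insert.prems(1) by (auto simp: single_def monoid_ring_add monoid_ring_carrier)
      finally show ?thesis .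
    qed
  qed
  from this[of "{m. p m \<noteq> \<zero>\<^bsub>K\<^esub>}" p] show ?thesis
    using p by (auto simp: monoid_ring_carrier)
qed

text \<open>Transfers the axioms between records with equal operations, for instance after a
  topology has been attached or replaced.\<close>

lemma cring_cong:
  assumes "cring A" "carrier B = carrier A" "monoid.mult B = monoid.mult A" "one B = one A"
    "zero B = zero A" "add B = add A"
  shows "cring B"
proof -
  interpret cring A by fact
  show ?thesis
  proof (rule cringI)
    show "abelian_group B"
      using assms l_neg by (intro abelian_groupI) (auto simp: a_ac intro!: bexI[of _ "\<ominus>\<^bsub>A\<^esub> x" for x])
    show "Group.comm_monoid B"
      using assms by (intro comm_monoidI) (auto simp: m_assoc intro: m_comm)
  qed (use assms in \<open>auto simp: l_distr\<close>)
qed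

section \<open>Polynomial rings and the ring of twisted principal parts\<close>

lemma with_topology_simps [simp]:
  "carrier (with_topology A T) = carrier A" "monoid.mult (with_topology A T) = monoid.mult A"
  "one (with_topology A T) = one A" "zero (with_topology A T) = zero A"
  "add (with_topology A T) = add A"
  by (simp_all add: with_topology_def)

lemma cring_with_topology: "cring A \<Longrightarrow> cring (with_topology A T)"
  by (rule cring_cong) auto

lemma ring_hom_with_topology [simp]:
  "ring_hom B (with_topology A T) = ring_hom B A" "ring_hom (with_topology A T) B = ring_hom A B"
  by (simp_all add: ring_hom_def)

lemma with_topology_quot: "with_topology A T Quot I = A Quot I"
proof -
  have coset: "(+>\<^bsub>with_topology A T\<^esub>) = (+>\<^bsub>A\<^esub>)"
    by (simp add: fun_eq_iff a_r_coset_def r_coset_def)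
  then have "rcoset_mult (with_topology A T) = rcoset_mult A"
    by (simp add: fun_eq_iff rcoset_mult_def)
  moreover have "(<+>\<^bsub>with_topology A T\<^esub>) = (<+>\<^bsub>A\<^esub>)"
    by (simp add: fun_eq_iff set_add_def set_mult_def)
  ultimately show ?thesis
    using coset by (simp add: FactRing_def A_RCOSETS_def')
qed

abbreviation exponents :: "nat \<Rightarrow> nat multiset monoid" where
  "exponents d \<equiv> \<lparr>carrier = multi_indices d, monoid.mult = (+), one = {#}\<rparr>"

lemma comm_monoid_exponents: "comm_monoid (exponents d)"
  by (rule comm_monoidI) (auto simp: multi_indices_def)

lemma poly_cring: "cring A \<Longrightarrow> cring (poly_ring A d)"
  unfolding poly_ring_def by (rule monoid_ring_cring[OF _ comm_monoid_exponents])

lemma pconst_closed [simp]: "cring A \<Longrightarrow> a \<in> carrier A \<Longrightarrow> pconst A a \<in> carrier (poly_ring A d)"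
  unfolding poly_ring_def pconst_def by (rule single_closed) (auto simp: multi_indices_def)

lemma pvar_closed [simp]: "cring A \<Longrightarrow> i \<in> {1..d} \<Longrightarrow> pvar A i \<in> carrier (poly_ring A d)"
  unfolding poly_ring_def pvar_def
  by (rule single_closed) (auto simp: multi_indices_def cring.cring_simprules)

lemma pconst_hom: "cring A \<Longrightarrow> pconst A \<in> ring_hom A (poly_ring A d)"
proof (rule ring_hom_memI)
  fix a b assume "cring A" "a \<in> carrier A" "b \<in> carrier A"
  moreover have "{#} \<in> carrier (exponents d)"
    by (simp add: multi_indices_def)
  ultimately show "pconst A (a \<otimes>\<^bsub>A\<^esub> b) = pconst A a \<otimes>\<^bsub>poly_ring A d\<^esub> pconst A b"
    unfolding pconst_def poly_ring_def
    using single_mult[OF _ comm_monoid_exponents, of A "{#}" d "{#}" a b] by simp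
qed (auto, auto simp: pconst_def poly_ring_def single_add monoid_ring_one)

lemma
  assumes K: "cring K" and U: "cring U" and c: "c \<in> ring_hom K U"
    and y: "\<And>i. i \<in> {1..d} \<Longrightarrow> y i \<in> carrier U"
  shows poly_eval_hom: "poly_eval K U c d y \<in> ring_hom (poly_ring K d) U"
    and poly_eval_pconst: "a \<in> carrier K \<Longrightarrow> poly_eval K U c d y (pconst K a) = c a"
    and poly_eval_pvar: "i \<in> {1..d} \<Longrightarrow> poly_eval K U c d y (pvar K i) = y i"
proof -
  interpret ev: monoid_ring_eval K U c "exponents d"
    by (intro monoid_ring_evalI K U c comm_monoid_exponents)
  let ?e = "\<lambda>k. \<Otimes>\<^bsub>U\<^esub>i \<in> {1..d}. y i [^]\<^bsub>U\<^esub> count k i"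
  have e: "?e \<in> carrier (exponents d) \<rightarrow> carrier U"
    using y by (auto intro!: ev.S.finprod_closed)
  show "poly_eval K U c d y \<in> ring_hom (poly_ring K d) U"
    unfolding poly_eval_def poly_ring_def
  proof (rule ev.mr_eval_hom[OF e])
    show "?e (a \<otimes>\<^bsub>exponents d\<^esub> b) = ?e a \<otimes>\<^bsub>U\<^esub> ?e b" for a b
    proof -
      have "?e (a + b) = (\<Otimes>\<^bsub>U\<^esub>i \<in> {1..d}. y i [^]\<^bsub>U\<^esub> count a i \<otimes>\<^bsub>U\<^esub> y i [^]\<^bsub>U\<^esub> count b i)"
        using y by (intro ev.S.finprod_cong') (auto simp: ev.S.nat_pow_mult)
      also have "\<dots> = ?e a \<otimes>\<^bsub>U\<^esub> ?e b"
        using y by (intro ev.S.finprod_multf) auto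
      finally show ?thesis
        by simp
    qed
  qed simp
  show "poly_eval K U c d y (pconst K a) = c a" if "a \<in> carrier K"
    unfolding poly_eval_def pconst_def using that e
    by (subst ev.mr_eval_single) (auto simp: multi_indices_def)
  show "poly_eval K U c d y (pvar K i) = y i" if "i \<in> {1..d}"
  proof -
    have "?e {#i#} = (\<Otimes>\<^bsub>U\<^esub>j \<in> {1..d}. if j = i then y j else \<one>\<^bsub>U\<^esub>)"
      using y by (intro ev.S.finprod_cong') auto
    also have "\<dots> = y i"
      using that y by (intro ev.S.finprod_singleton_swap) auto
    finally show ?thesis
      unfolding poly_eval_def pvar_def using that e y
      by (subst ev.mr_eval_single) (auto simp: multi_indices_def)
  qed
qed

text \<open>A monomial with coefficient \<open>a\<close> arises from the constant \<open>a\<close>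
  by adding elements to the exponent multiset one by one, each costing a factor
  \<open>pvar\<close>.\<close>

lemma poly_ring_induct [consumes 2, case_names const add mult_var]:
  assumes A: "cring A" and p: "p \<in> carrier (poly_ring A d)"
    and const: "\<And>a. a \<in> carrier A \<Longrightarrow> P (pconst A a)"
    and add: "\<And>p q. p \<in> carrier (poly_ring A d) \<Longrightarrow> q \<in> carrier (poly_ring A d) \<Longrightarrow> P p \<Longrightarrow> P q \<Longrightarrow>
      P (p \<oplus>\<^bsub>poly_ring A d\<^esub> q)"
    and mult_var: "\<And>p i. p \<in> carrier (poly_ring A d) \<Longrightarrow> i \<in> {1..d} \<Longrightarrow> P p \<Longrightarrow>
      P (pvar A i \<otimes>\<^bsub>poly_ring A d\<^esub> p)"
  shows "P p"
proof -
  interpret A: cring A by fact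
  show ?thesis
    using A p[unfolded poly_ring_def]
  proof (induction rule: monoid_ring_induct)
    case zero
    have "pconst A \<zero>\<^bsub>A\<^esub> = \<zero>\<^bsub>monoid_ring A (exponents d)\<^esub>"
      by (simp add: pconst_def single_def monoid_ring_zero)
    then show ?case
      using const[of "\<zero>\<^bsub>A\<^esub>"] by simp
  next
    case (single k a)
    then show ?case
    proof (induction k)
      case empty
      then show ?case
        using const by (simp add: pconst_def)
    next
      case (add i k)
      then have ik: "i \<in> {1..d}" "k \<in> carrier (exponents d)"
        by (auto simp: multi_indices_def)
      have "pvar A i \<otimes>\<^bsub>poly_ring A d\<^esub> single A k a = single A (add_mset i k) a"
        using ik add.prems A single_mult[OF A comm_monoid_exponents, of "{#i#}" d k "\<one>\<^bsub>A\<^esub>" a]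
        by (simp add: poly_ring_def pvar_def multi_indices_def)
      moreover have "single A k a \<in> carrier (poly_ring A d)"
        using ik add.prems A unfolding poly_ring_def by (intro single_closed)
      ultimately show ?case
        using mult_var[of "single A k a" i] add.IH ik add.prems by simp
    qed
  next
    case (add p q)
    then show ?case
      using assms(4) unfolding poly_ring_def by blast
  qed
qed

text \<open>A model of \<open>A[t] / (t (t - s))\<close> in which \<open>(a, b)\<close> stands for \<open>a + b t\<close>. The homomorphisms from
  \<open>P\<^bsub>A,(1)\<^esub>\<close> to it with \<open>\<xi>\<^sub>i \<mapsto> t\<close> and \<open>\<xi>\<^sub>j \<mapsto> 0\<close> for \<open>j \<noteq> i\<close> read off the coefficient of \<open>\<xi>\<^sub>i\<close>.\<close>

definition dual_ring :: "('a, 'r) ring_scheme \<Rightarrow> 'a \<Rightarrow> ('a \<times> 'a) ring" where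
  "dual_ring A s =
    \<lparr>carrier = carrier A \<times> carrier A,
     monoid.mult = (\<lambda>(a, b) (a', b'). (a \<otimes>\<^bsub>A\<^esub> a',
       a \<otimes>\<^bsub>A\<^esub> b' \<oplus>\<^bsub>A\<^esub> a' \<otimes>\<^bsub>A\<^esub> b \<oplus>\<^bsub>A\<^esub> b \<otimes>\<^bsub>A\<^esub> b' \<otimes>\<^bsub>A\<^esub> s)),
     one = (\<one>\<^bsub>A\<^esub>, \<zero>\<^bsub>A\<^esub>), zero = (\<zero>\<^bsub>A\<^esub>, \<zero>\<^bsub>A\<^esub>),
     add = (\<lambda>(a, b) (a', b'). (a \<oplus>\<^bsub>A\<^esub> a', b \<oplus>\<^bsub>A\<^esub> b'))\<rparr>"

lemma dual_ring_simps [simp]: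
  "carrier (dual_ring A s) = carrier A \<times> carrier A"
  "(a, b) \<otimes>\<^bsub>dual_ring A s\<^esub> (a', b') = (a \<otimes>\<^bsub>A\<^esub> a',
     a \<otimes>\<^bsub>A\<^esub> b' \<oplus>\<^bsub>A\<^esub> a' \<otimes>\<^bsub>A\<^esub> b \<oplus>\<^bsub>A\<^esub> b \<otimes>\<^bsub>A\<^esub> b' \<otimes>\<^bsub>A\<^esub> s)"
  "(a, b) \<oplus>\<^bsub>dual_ring A s\<^esub> (a', b') = (a \<oplus>\<^bsub>A\<^esub> a', b \<oplus>\<^bsub>A\<^esub> b')"
  "\<one>\<^bsub>dual_ring A s\<^esub> = (\<one>\<^bsub>A\<^esub>, \<zero>\<^bsub>A\<^esub>)" "\<zero>\<^bsub>dual_ring A s\<^esub> = (\<zero>\<^bsub>A\<^esub>, \<zero>\<^bsub>A\<^esub>)"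
  by (simp_all add: dual_ring_def)

lemma dual_ring_cring:
  assumes "cring A" "s \<in> carrier A"
  shows "cring (dual_ring A s)"
proof -
  interpret cring A by fact
  show ?thesis
  proof (rule cringI)
    show "abelian_group (dual_ring A s)"
    proof (rule abelian_groupI)
      show "\<exists>q\<in>carrier (dual_ring A s). q \<oplus>\<^bsub>dual_ring A s\<^esub> p = \<zero>\<^bsub>dual_ring A s\<^esub>"
        if "p \<in> carrier (dual_ring A s)" for p
        using that by (intro bexI[of _ "(\<ominus>\<^bsub>A\<^esub> fst p, \<ominus>\<^bsub>A\<^esub> snd p)"]) (auto simp: l_neg)
    qed (auto simp: a_ac)
    show "Group.comm_monoid (dual_ring A s)"
      by (rule comm_monoidI) (use assms in \<open>auto simp: l_distr r_distr a_ac m_ac\<close>)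
  qed (use assms in \<open>auto simp: l_distr r_distr a_ac m_ac\<close>)
qed

\<comment> \<open>keeps the order \<open>1\<close> in terms such as \<open>twisted_parts A d \<sigma> x 1\<close>\<close>
declare One_nat_def [simp del]

text \<open>The generators of the ideal for \<open>n = 1\<close> have size 2, so \<sigma>_i is
  applied to x_i at most once and only \<open>\<sigma> i (x i)\<close> has to lie in the carrier.
  The locale serves for \<open>A\<close> and for its ring of definition alike.\<close>

locale twisted_parts_ring = A: cring A for A :: "'a top_ring" +
  fixes d :: nat and \<sigma> :: "nat \<Rightarrow> 'a \<Rightarrow> 'a" and x :: "nat \<Rightarrow> 'a"
  assumes x_closed [simp]: "i \<in> {1..d} \<Longrightarrow> x i \<in> carrier A"
    and \<sigma>_closed [simp]: "i \<in> {1..d} \<Longrightarrow> \<sigma> i (x i) \<in> carrier A"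
begin

abbreviation "Pol \<equiv> poly_ring A d"
abbreviation "P \<equiv> twisted_parts A d \<sigma> x 1"
abbreviation "I \<equiv> twisted_ideal A d \<sigma> x 1"
abbreviation "const \<equiv> parts_const A d \<sigma> x 1"
abbreviation "\<xi> \<equiv> parts_xi A d \<sigma> x 1"

definition s :: "nat \<Rightarrow> 'a" where "s i = \<sigma> i (x i) \<ominus>\<^bsub>A\<^esub> x i"

lemma s_closed [simp]: "i \<in> {1..d} \<Longrightarrow> s i \<in> carrier A"
  by (simp add: s_def)

sublocale Pol: cring Pol
  by (rule poly_cring) (rule A.is_cring)

lemmas pc [simp] = pconst_closed[OF A.is_cring] pvar_closed[OF A.is_cring]

sublocale pconst: ring_hom_cring A Pol "pconst A"
  by (intro ring_hom_cringI' A.is_cring Pol.is_cring pconst_hom)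

section \<open>The ideal of order 1 and the relations between the classes
  \<open>\<xi> i\<close>\<close>

lemma twisted_power_pair:
  assumes "i \<in> {1..d}" "j \<in> {1..d}" "i \<noteq> j"
  shows "twisted_power A d \<sigma> x {#i, j#} = pvar A i \<otimes>\<^bsub>Pol\<^esub> pvar A j"
proof -
  let ?g = "\<lambda>i'. \<Otimes>\<^bsub>Pol\<^esub>l \<in> {..<count {#i, j#} i'}.
      pvar A i' \<oplus>\<^bsub>Pol\<^esub> pconst A (x i' \<ominus>\<^bsub>A\<^esub> (\<sigma> i' ^^ l) (x i'))"
  \<comment> \<open>With exponent 1 the inner product has the single factor \<open>l = 0\<close>,
    and there the constant term is x - x = 0.\<close>
  have g: "?g i = pvar A i" "?g j = pvar A j"
    using assms by (simp_all add: lessThan_Suc Pol.minus_eq Pol.r_neg)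
  have "twisted_power A d \<sigma> x {#i, j#} = finprod Pol (\<lambda>i'. if i' \<in> {i, j} then ?g i' else \<one>\<^bsub>Pol\<^esub>) {1..d}"
    unfolding twisted_power_def using g assms by (intro Pol.finprod_cong') auto
  also have "\<dots> = finprod Pol ?g {i, j}"
    using assms g by (intro Pol.finprod_mono_neutral_cong_left[symmetric]) auto
  also have "\<dots> = pvar A i \<otimes>\<^bsub>Pol\<^esub> pvar A j"
    using assms g by (subst Pol.finprod_insert) (auto simp del: count_add_mset simp: Pol.finprod_insert)
  finally show ?thesis .
qed

lemma twisted_power_square:
  assumes "i \<in> {1..d}"
  shows "twisted_power A d \<sigma> x {#i, i#} = pvar A i \<otimes>\<^bsub>Pol\<^esub> (pvar A i \<oplus>\<^bsub>Pol\<^esub> pconst A (x i \<ominus>\<^bsub>A\<^esub> \<sigma> i (x i)))"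
proof -
  let ?g = "\<lambda>i'. \<Otimes>\<^bsub>Pol\<^esub>l \<in> {..<count {#i, i#} i'}.
      pvar A i' \<oplus>\<^bsub>Pol\<^esub> pconst A (x i' \<ominus>\<^bsub>A\<^esub> (\<sigma> i' ^^ l) (x i'))"
  have g: "?g i = pvar A i \<otimes>\<^bsub>Pol\<^esub> (pvar A i \<oplus>\<^bsub>Pol\<^esub> pconst A (x i \<ominus>\<^bsub>A\<^esub> \<sigma> i (x i)))"
    using assms by (simp add: lessThan_Suc Pol.minus_eq Pol.r_neg Pol.m_comm)
  have "twisted_power A d \<sigma> x {#i, i#} = finprod Pol (\<lambda>i'. if i' = i then ?g i' else \<one>\<^bsub>Pol\<^esub>) {1..d}"
    unfolding twisted_power_def using g assms by (intro Pol.finprod_cong') auto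
  also have "\<dots> = finprod Pol ?g {i}"
    using assms g by (intro Pol.finprod_mono_neutral_cong_left[symmetric]) auto
  also have "\<dots> = ?g i"
    using assms g by (subst Pol.finprod_insert) auto
  finally show ?thesis
    using g by simp
qed

text \<open>The size is kept as \<open>1 + 1\<close> to match the bound \<open>n + 1\<close> of
  \<open>twisted_ideal\<close> at \<open>n = 1\<close>.\<close>

lemma multi_index_2E:
  assumes "k \<in> multi_indices d" "size k = 1 + 1"
  obtains i j where "i \<in> {1..d}" "j \<in> {1..d}" "k = {#i, j#}"
proof -
  obtain i k' where "k = add_mset i k'"
    using assms(2) size_eq_Suc_imp_eq_union[of k 1] by auto
  with assms(2) have k': "k = add_mset i k'" "size k' = 1"
    by auto
  then obtain j where "k' = {#j#}"
    using size_1_singleton_mset by blast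
  then show ?thesis
    using that[of i j] k' assms(1) by (auto simp: multi_indices_def)
qed

lemma twisted_power_closed:
  assumes "k \<in> multi_indices d" "size k = 1 + 1"
  shows "twisted_power A d \<sigma> x k \<in> carrier Pol"
proof -
  obtain i j where ij: "i \<in> {1..d}" "j \<in> {1..d}" "k = {#i, j#}"
    using assms by (rule multi_index_2E)
  then show ?thesis
    by (cases "i = j") (simp_all add: twisted_power_pair twisted_power_square)
qed

lemma ideal_I: "ideal I Pol"
  unfolding twisted_ideal_def using twisted_power_closed by (intro Pol.genideal_ideal) auto

text \<open>By \<open>multi_index_2E\<close> the generators are \<xi>_i \<xi>_j for distinct i, j
  and \<xi>_i (\<xi>_i + x_i - \<sigma>_i(x_i)). Checking these two families is how each map out of
  \<open>P\<close> is constructed below.\<close>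

lemma kills_I:
  assumes U: "cring U" and h: "h \<in> ring_hom Pol U"
    and pair: "\<And>i j. i \<in> {1..d} \<Longrightarrow> j \<in> {1..d} \<Longrightarrow> i \<noteq> j \<Longrightarrow> h (pvar A i) \<otimes>\<^bsub>U\<^esub> h (pvar A j) = \<zero>\<^bsub>U\<^esub>"
    and square: "\<And>i. i \<in> {1..d} \<Longrightarrow>
      h (pvar A i) \<otimes>\<^bsub>U\<^esub> (h (pvar A i) \<oplus>\<^bsub>U\<^esub> h (pconst A (x i \<ominus>\<^bsub>A\<^esub> \<sigma> i (x i)))) = \<zero>\<^bsub>U\<^esub>"
    and p: "p \<in> I"
  shows "h p = \<zero>\<^bsub>U\<^esub>"
proof -
  interpret h: ring_hom_cring Pol U h
    by (intro ring_hom_cringI' Pol.is_cring U h)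
  have "h (twisted_power A d \<sigma> x k) = \<zero>\<^bsub>U\<^esub>" if "k \<in> multi_indices d" "size k = 1 + 1" for k
  proof -
    obtain i j where ij: "i \<in> {1..d}" "j \<in> {1..d}" "k = {#i, j#}"
      using \<open>k \<in> multi_indices d\<close> \<open>size k = 1 + 1\<close> by (rule multi_index_2E)
    show ?thesis
    proof (cases "i = j")
      case True
      then show ?thesis
        using ij square[of i] by (simp add: twisted_power_square)
    next
      case False
      then show ?thesis
        using ij pair[of i j] by (simp add: twisted_power_pair)
    qed
  qed
  then show ?thesis
    using p unfolding twisted_ideal_def
    by (intro Idl_kills[OF Pol.is_cring U h]) (auto simp: twisted_power_closed)
qed

text \<open>Exposes the algebraic operations of \<open>P\<close> while its topology stays unnamed;
  ring axioms, carrier and homomorphisms are transferred through this.\<close>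

lemma P_eq: "\<exists>T. P = with_topology (Pol Quot I) T"
  unfolding twisted_parts_def quot_ring_def poly_top_ring_def with_topology_quot by blast

lemma P_hom_iff [simp]: "ring_hom P B = ring_hom (Pol Quot I) B" "ring_hom B P = ring_hom B (Pol Quot I)"
  using P_eq by auto

lemma carrier_P: "carrier P = carrier (Pol Quot I)"
  using P_eq by auto

sublocale P: cring P
  using P_eq ideal.quotient_is_cring[OF ideal_I Pol.is_cring] cring_with_topology by metis

lemma class_hom: "parts_class A d \<sigma> x 1 \<in> ring_hom Pol P"
  using ideal.rcos_ring_hom[OF ideal_I] by (simp add: parts_class_def[abs_def])

sublocale cls: ring_hom_cring Pol P "parts_class A d \<sigma> x 1"
  by (intro ring_hom_cringI' Pol.is_cring P.is_cring class_hom)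

lemma P_carrierE:
  assumes "X \<in> carrier P"
  obtains p where "p \<in> carrier Pol" "X = parts_class A d \<sigma> x 1 p"
  using assms unfolding carrier_P parts_class_def by (rule quot_carrierE)

lemma const_hom: "const \<in> ring_hom A P"
  using ring_hom_trans[OF pconst_hom[OF A.is_cring] class_hom] by (simp add: parts_const_def[abs_def] comp_def)

sublocale const: ring_hom_cring A P const
  by (intro ring_hom_cringI' A.is_cring P.is_cring const_hom)

lemma xi_closed [simp]: "i \<in> {1..d} \<Longrightarrow> \<xi> i \<in> carrier P"
  unfolding parts_xi_def by simp

lemma class_I: "p \<in> I \<Longrightarrow> parts_class A d \<sigma> x 1 p = \<zero>\<^bsub>P\<^esub>"
proof -
  assume p: "p \<in> I"
  have "\<zero>\<^bsub>P\<^esub> = I"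
    using P_eq by (auto simp: FactRing_def)
  then show ?thesis
    unfolding parts_class_def using abelian_subgroup.a_rcos_const[OF ideal.axioms(1)[OF ideal_I, THEN abelian_subgroupI3], of p]
      p Pol.abelian_group_axioms by simp
qed

lemma twisted_power_in_I:
  assumes "i \<in> {1..d}" "j \<in> {1..d}"
  shows "twisted_power A d \<sigma> x {#i, j#} \<in> I"
  unfolding twisted_ideal_def
  by (rule genideal_incl, rule CollectI, rule exI[of _ "{#i, j#}"])
    (use assms in \<open>auto simp: multi_indices_def\<close>)

lemma xi_square:
  assumes "i \<in> {1..d}"
  shows "\<xi> i \<otimes>\<^bsub>P\<^esub> (\<xi> i \<oplus>\<^bsub>P\<^esub> const (x i \<ominus>\<^bsub>A\<^esub> \<sigma> i (x i))) = \<zero>\<^bsub>P\<^esub>"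
  using class_I[OF twisted_power_in_I[of i i]] assms
  by (simp add: twisted_power_square parts_xi_def parts_const_def)

lemma xi_mult:
  assumes "i \<in> {1..d}" "j \<in> {1..d}"
  shows "\<xi> i \<otimes>\<^bsub>P\<^esub> \<xi> j = (if i = j then const (s i) \<otimes>\<^bsub>P\<^esub> \<xi> i else \<zero>\<^bsub>P\<^esub>)"
proof -
  show ?thesis
  proof (cases "i = j")
    case True
    have "x i \<ominus>\<^bsub>A\<^esub> \<sigma> i (x i) = \<ominus>\<^bsub>A\<^esub> s i"
      using assms unfolding s_def by (simp add: A.minus_eq A.minus_add A.a_comm)
    then have "\<xi> i \<otimes>\<^bsub>P\<^esub> (\<xi> i \<oplus>\<^bsub>P\<^esub> \<ominus>\<^bsub>P\<^esub> const (s i)) = \<zero>\<^bsub>P\<^esub>"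
      using xi_square[of i] assms by simp
    then have "\<xi> i \<otimes>\<^bsub>P\<^esub> \<xi> i \<ominus>\<^bsub>P\<^esub> \<xi> i \<otimes>\<^bsub>P\<^esub> const (s i) = \<zero>\<^bsub>P\<^esub>"
      using assms by (simp add: P.r_distr P.r_minus P.minus_eq)
    then show ?thesis
      using assms True by (simp add: P.r_right_minus_eq P.m_comm)
  next
    case False
    then show ?thesis
      using class_I[OF twisted_power_in_I[of i j]] assms by (simp add: twisted_power_pair parts_xi_def)
  qed
qed

section \<open>Spanning: every element of \<open>P\<close> is a linear combination of 1 and the
  \<open>\<xi> i\<close>\<close>

definition lincomb :: "'a \<Rightarrow> (nat \<Rightarrow> 'a) \<Rightarrow> (nat multiset \<Rightarrow> 'a) set" where
  "lincomb a c = const a \<oplus>\<^bsub>P\<^esub> (\<Oplus>\<^bsub>P\<^esub>j \<in> {1..d}. const (c j) \<otimes>\<^bsub>P\<^esub> \<xi> j)"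

lemma lincomb_closed [simp]:
  assumes "a \<in> carrier A" "c \<in> {1..d} \<rightarrow> carrier A"
  shows "lincomb a c \<in> carrier P"
  unfolding lincomb_def using assms by (auto intro!: P.a_closed P.finsum_closed P.m_closed)

lemma lincomb_add:
  assumes "a \<in> carrier A" "c \<in> {1..d} \<rightarrow> carrier A" "a' \<in> carrier A" "c' \<in> {1..d} \<rightarrow> carrier A"
  shows "lincomb a c \<oplus>\<^bsub>P\<^esub> lincomb a' c' = lincomb (a \<oplus>\<^bsub>A\<^esub> a') (\<lambda>j. c j \<oplus>\<^bsub>A\<^esub> c' j)"
proof -
  have "(\<Oplus>\<^bsub>P\<^esub>j \<in> {1..d}. const (c j \<oplus>\<^bsub>A\<^esub> c' j) \<otimes>\<^bsub>P\<^esub> \<xi> j) =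
      (\<Oplus>\<^bsub>P\<^esub>j \<in> {1..d}. const (c j) \<otimes>\<^bsub>P\<^esub> \<xi> j \<oplus>\<^bsub>P\<^esub> const (c' j) \<otimes>\<^bsub>P\<^esub> \<xi> j)"
    using assms by (intro P.finsum_cong') (auto simp: Pi_def P.l_distr)
  also have "\<dots> = (\<Oplus>\<^bsub>P\<^esub>j \<in> {1..d}. const (c j) \<otimes>\<^bsub>P\<^esub> \<xi> j) \<oplus>\<^bsub>P\<^esub> (\<Oplus>\<^bsub>P\<^esub>j \<in> {1..d}. const (c' j) \<otimes>\<^bsub>P\<^esub> \<xi> j)"
    using assms by (intro P.finsum_addf) (auto simp: Pi_def)
  finally show ?thesis
    unfolding lincomb_def using assms
    by (simp add: P.a_ac P.finsum_closed Pi_def)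
qed

lemma const_lincomb: "a \<in> carrier A \<Longrightarrow> const a = lincomb a (\<lambda>_. \<zero>\<^bsub>A\<^esub>)"
proof -
  assume a: "a \<in> carrier A"
  have "(\<Oplus>\<^bsub>P\<^esub>j \<in> {1..d}. const \<zero>\<^bsub>A\<^esub> \<otimes>\<^bsub>P\<^esub> \<xi> j) = \<zero>\<^bsub>P\<^esub>"
    by (rule P.add.finprod_one_eqI) simp
  then show ?thesis
    unfolding lincomb_def using a by simp
qed

lemma xi_lincomb:
  assumes "i \<in> {1..d}" "b \<in> carrier A"
  shows "const b \<otimes>\<^bsub>P\<^esub> \<xi> i = lincomb \<zero>\<^bsub>A\<^esub> (\<lambda>j. if j = i then b else \<zero>\<^bsub>A\<^esub>)"
proof -
  have "(\<Oplus>\<^bsub>P\<^esub>j \<in> {1..d}. const (if j = i then b else \<zero>\<^bsub>A\<^esub>) \<otimes>\<^bsub>P\<^esub> \<xi> j) =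
      (\<Oplus>\<^bsub>P\<^esub>j \<in> {1..d}. if j = i then const b \<otimes>\<^bsub>P\<^esub> \<xi> j else \<zero>\<^bsub>P\<^esub>)"
    using assms by (intro P.finsum_cong') auto
  also have "\<dots> = const b \<otimes>\<^bsub>P\<^esub> \<xi> i"
    using assms by (intro P.add.finprod_singleton_swap) auto
  finally show ?thesis
    unfolding lincomb_def using assms by simp
qed

text \<open>The set \<open>L\<close> of linear combinations contains the constants and is stable
  under sums and under multiplication by each \<open>\<xi> i\<close>, so polynomial induction gives
  all classes.\<close>

lemma P_lincomb:
  assumes "X \<in> carrier P"
  shows "\<exists>a\<in>carrier A. \<exists>c\<in>{1..d} \<rightarrow> carrier A. X = lincomb a c"
proof -
  define L where "L = {lincomb a c | a c. a \<in> carrier A \<and> c \<in> {1..d} \<rightarrow> carrier A}"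
  have L_sub: "L \<subseteq> carrier P"
    by (auto simp: L_def)
  have L_const: "const a \<in> L" if "a \<in> carrier A" for a
    using that unfolding L_def by (auto simp: const_lincomb intro!: exI[of _ a] exI[of _ "\<lambda>_. \<zero>\<^bsub>A\<^esub>"])
  have L_xi: "const b \<otimes>\<^bsub>P\<^esub> \<xi> i \<in> L" if "i \<in> {1..d}" "b \<in> carrier A" for i b
    unfolding xi_lincomb[OF that] using that unfolding L_def
    by (auto intro!: exI[of _ "\<zero>\<^bsub>A\<^esub>"] exI[of _ "\<lambda>j. if j = i then b else \<zero>\<^bsub>A\<^esub>"])
  have L_add: "X \<oplus>\<^bsub>P\<^esub> Y \<in> L" if XY: "X \<in> L" "Y \<in> L" for X Y
  proof -
    obtain a c a' c' where "a \<in> carrier A" "c \<in> {1..d} \<rightarrow> carrier A" "X = lincomb a c"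
      "a' \<in> carrier A" "c' \<in> {1..d} \<rightarrow> carrier A" "Y = lincomb a' c'"
      using XY unfolding L_def by blast
    then show ?thesis
      unfolding L_def
      by (auto simp: lincomb_add Pi_def intro!: exI[of _ "a \<oplus>\<^bsub>A\<^esub> a'"] exI[of _ "\<lambda>j. c j \<oplus>\<^bsub>A\<^esub> c' j"])
  qed
  have L_zero: "\<zero>\<^bsub>P\<^esub> \<in> L"
    using L_const[of "\<zero>\<^bsub>A\<^esub>"] by simp
  have L_mult: "\<xi> i \<otimes>\<^bsub>P\<^esub> X \<in> L" if i: "i \<in> {1..d}" and X: "X \<in> L" for i X
  proof -
    obtain a c where ac: "a \<in> carrier A" "c \<in> {1..d} \<rightarrow> carrier A" "X = lincomb a c"
      using X unfolding L_def by blast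
    have c: "c j \<in> carrier A" if "j \<in> {1..d}" for j
      using ac that by blast
    \<comment> \<open>A product of two \<xi> is again linear: zero for \<open>j \<noteq> i\<close>,
      and \<open>s i\<close> times \<open>\<xi> i\<close> for \<open>j = i\<close>.\<close>
    have "\<xi> i \<otimes>\<^bsub>P\<^esub> (const (c j) \<otimes>\<^bsub>P\<^esub> \<xi> j) \<in> L" if j: "j \<in> {1..d}" for j
    proof -
      have "\<xi> i \<otimes>\<^bsub>P\<^esub> (const (c j) \<otimes>\<^bsub>P\<^esub> \<xi> j) = const (c j) \<otimes>\<^bsub>P\<^esub> (\<xi> i \<otimes>\<^bsub>P\<^esub> \<xi> j)"
        using i j c by (intro P.m_lcomm) auto
      also have "\<dots> = (if i = j then const (c j \<otimes>\<^bsub>A\<^esub> s i) \<otimes>\<^bsub>P\<^esub> \<xi> i else \<zero>\<^bsub>P\<^esub>)"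
        using i j c by (simp add: xi_mult P.m_assoc)
      finally show ?thesis
        using i j c L_xi[of i "c j \<otimes>\<^bsub>A\<^esub> s i"] L_zero by auto
    qed
    then have "(\<Oplus>\<^bsub>P\<^esub>j \<in> {1..d}. \<xi> i \<otimes>\<^bsub>P\<^esub> (const (c j) \<otimes>\<^bsub>P\<^esub> \<xi> j)) \<in> L"
      by (intro P.finsum_in L_zero L_add L_sub) auto
    moreover have "\<xi> i \<otimes>\<^bsub>P\<^esub> (\<Oplus>\<^bsub>P\<^esub>j \<in> {1..d}. const (c j) \<otimes>\<^bsub>P\<^esub> \<xi> j) =
        (\<Oplus>\<^bsub>P\<^esub>j \<in> {1..d}. \<xi> i \<otimes>\<^bsub>P\<^esub> (const (c j) \<otimes>\<^bsub>P\<^esub> \<xi> j))"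
      using i c by (intro P.finsum_rdistr) auto
    moreover have "\<xi> i \<otimes>\<^bsub>P\<^esub> const a \<in> L"
      using L_xi[of i a] i ac by (simp add: P.m_comm)
    ultimately show ?thesis
      using ac i c L_add unfolding \<open>X = lincomb a c\<close> lincomb_def
      by (subst P.r_distr) (auto intro!: P.finsum_closed)
  qed
  obtain p where p: "p \<in> carrier Pol" "X = parts_class A d \<sigma> x 1 p"
    using assms by (rule P_carrierE)
  have "parts_class A d \<sigma> x 1 p \<in> L"
    using A.is_cring p(1)
  proof (induction rule: poly_ring_induct)
    case (const a)
    then show ?case
      using L_const[of a] by (simp add: parts_const_def)
  next
    case (add p q)
    then show ?case
      using L_add by simp
  next
    case (mult_var p i)
    then show ?case
      using L_mult[of i "parts_class A d \<sigma> x 1 p"] by (simp add: parts_xi_def)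
  qed
  then show ?thesis
    using p by (auto simp: L_def)
qed

section \<open>Coordinate functions on \<open>P\<close> and linear independence\<close>

definition to_dual :: "nat \<Rightarrow> (nat multiset \<Rightarrow> 'a) set \<Rightarrow> 'a \<times> 'a" where
  "to_dual i X = the_elem (poly_eval A (dual_ring A (s i)) (\<lambda>a. (a, \<zero>\<^bsub>A\<^esub>)) d
    (\<lambda>j. (\<zero>\<^bsub>A\<^esub>, if j = i then \<one>\<^bsub>A\<^esub> else \<zero>\<^bsub>A\<^esub>)) ` X)"

lemma
  assumes i: "i \<in> {1..d}"
  shows to_dual_hom: "to_dual i \<in> ring_hom P (dual_ring A (s i))"
    and to_dual_const: "a \<in> carrier A \<Longrightarrow> to_dual i (const a) = (a, \<zero>\<^bsub>A\<^esub>)"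
    and to_dual_xi: "j \<in> {1..d} \<Longrightarrow> to_dual i (\<xi> j) = (\<zero>\<^bsub>A\<^esub>, if j = i then \<one>\<^bsub>A\<^esub> else \<zero>\<^bsub>A\<^esub>)"
proof -
  let ?D = "dual_ring A (s i)"
  let ?h = "poly_eval A ?D (\<lambda>a. (a, \<zero>\<^bsub>A\<^esub>)) d (\<lambda>j. (\<zero>\<^bsub>A\<^esub>, if j = i then \<one>\<^bsub>A\<^esub> else \<zero>\<^bsub>A\<^esub>))"
  interpret D: cring ?D
    using i by (intro dual_ring_cring A.is_cring) auto
  have c: "(\<lambda>a. (a, \<zero>\<^bsub>A\<^esub>)) \<in> ring_hom A ?D"
    using i by (intro ring_hom_memI) auto
  have y: "(\<zero>\<^bsub>A\<^esub>, if j = i then \<one>\<^bsub>A\<^esub> else \<zero>\<^bsub>A\<^esub>) \<in> carrier ?D" for j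
    by auto
  note ev = A.is_cring D.is_cring c y
  have h: "?h \<in> ring_hom Pol ?D"
    using ev by (rule poly_eval_hom)
  have hc: "?h (pconst A a) = (a, \<zero>\<^bsub>A\<^esub>)" if "a \<in> carrier A" for a
    using ev that by (rule poly_eval_pconst)
  have hv: "?h (pvar A j) = (\<zero>\<^bsub>A\<^esub>, if j = i then \<one>\<^bsub>A\<^esub> else \<zero>\<^bsub>A\<^esub>)" if "j \<in> {1..d}" for j
    using ev that by (rule poly_eval_pvar)
  have kills: "?h p = \<zero>\<^bsub>?D\<^esub>" if "p \<in> I" for p
    using D.is_cring h _ _ that
  proof (rule kills_I)
    fix j assume j: "j \<in> {1..d}"
    define b where "b = x j \<ominus>\<^bsub>A\<^esub> \<sigma> j (x j)"
    have b: "b \<in> carrier A"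
      using j by (simp add: b_def)
    \<comment> \<open>For \<open>j = i\<close> the generator goes to t (t + b) = (b + s_i) t, so it
      is this cancellation that makes the map factor through \<open>P\<close>.\<close>
    have "b \<oplus>\<^bsub>A\<^esub> s j = \<zero>\<^bsub>A\<^esub>"
      using j by (simp add: b_def s_def A.minus_eq A.a_assoc A.l_neg A.r_neg1 A.r_neg2 A.r_neg)
    with b show "?h (pvar A j) \<otimes>\<^bsub>?D\<^esub> (?h (pvar A j) \<oplus>\<^bsub>?D\<^esub> ?h (pconst A (x j \<ominus>\<^bsub>A\<^esub> \<sigma> j (x j)))) = \<zero>\<^bsub>?D\<^esub>"
      unfolding b_def[symmetric] using i j by (auto simp: hc hv)
  qed (use i in \<open>auto simp: hv\<close>)
  note lift = quot_lift[OF Pol.is_cring D.is_cring h ideal_I]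
  show "to_dual i \<in> ring_hom P ?D"
    unfolding to_dual_def[abs_def] P_hom_iff using kills by (rule lift(3))
  have cl: "to_dual i (parts_class A d \<sigma> x 1 p) = ?h p" if "p \<in> carrier Pol" for p
    unfolding to_dual_def parts_class_def using kills that by (rule lift(2))
  show "to_dual i (const a) = (a, \<zero>\<^bsub>A\<^esub>)" if "a \<in> carrier A"
    using that by (simp add: parts_const_def cl hc)
  show "to_dual i (\<xi> j) = (\<zero>\<^bsub>A\<^esub>, if j = i then \<one>\<^bsub>A\<^esub> else \<zero>\<^bsub>A\<^esub>)" if "j \<in> {1..d}"
    unfolding parts_xi_def using that by (simp add: cl hv)
qed

text \<open>Linear independence: each coefficient is recovered from the element by a ring
  homomorphism.\<close>

lemma to_dual_lincomb:
  assumes i: "i \<in> {1..d}" and a: "a \<in> carrier A" and c: "c \<in> {1..d} \<rightarrow> carrier A"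
  shows "to_dual i (lincomb a c) = (a, c i)"
proof -
  let ?D = "dual_ring A (s i)"
  interpret D: cring ?D
    using i by (intro dual_ring_cring A.is_cring) auto
  interpret h: ring_hom_cring P ?D "to_dual i"
    by (intro ring_hom_cringI' P.is_cring D.is_cring to_dual_hom i)
  have c': "c j \<in> carrier A" if "j \<in> {1..d}" for j
    using c that by blast
  have "to_dual i (\<Oplus>\<^bsub>P\<^esub>j \<in> {1..d}. const (c j) \<otimes>\<^bsub>P\<^esub> \<xi> j) =
      (\<Oplus>\<^bsub>?D\<^esub>j \<in> {1..d}. to_dual i (const (c j) \<otimes>\<^bsub>P\<^esub> \<xi> j))"
    using c' by (subst h.hom_finsum) (auto simp: comp_def)
  also have "\<dots> = (\<Oplus>\<^bsub>?D\<^esub>j \<in> {1..d}. if j = i then (\<zero>\<^bsub>A\<^esub>, c j) else \<zero>\<^bsub>?D\<^esub>)"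
    using c' i by (intro D.finsum_cong') (auto simp: to_dual_const to_dual_xi)
  also have "\<dots> = (\<zero>\<^bsub>A\<^esub>, c i)"
    using c' i by (intro D.add.finprod_singleton_swap) auto
  finally show ?thesis
    unfolding lincomb_def using a c' i
    by (subst h.hom_add) (auto intro!: P.finsum_closed simp: to_dual_const)
qed

text \<open>Taking the constant coefficient is evaluation at the indicator of \<open>{#}\<close>.
  That indicator is multiplicative, since a sum of multisets is empty only if both are, and the
  generators of \<open>I\<close> have no constant term.\<close>

lemma
  shows parts_proj_hom: "parts_proj \<in> ring_hom P A"
    and parts_proj_class: "p \<in> carrier Pol \<Longrightarrow> parts_proj (parts_class A d \<sigma> x 1 p) = p {#}"
    and parts_proj_const: "a \<in> carrier A \<Longrightarrow> parts_proj (const a) = a"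
    and parts_proj_xi: "i \<in> {1..d} \<Longrightarrow> parts_proj (\<xi> i) = \<zero>\<^bsub>A\<^esub>"
proof -
  let ?h = "\<lambda>p :: nat multiset \<Rightarrow> 'a. p {#}"
  have "mr_eval A A id (\<lambda>k. if k = {#} then \<one>\<^bsub>A\<^esub> else \<zero>\<^bsub>A\<^esub>) \<in> ring_hom Pol A"
    unfolding poly_ring_def
    by (intro monoid_ring_eval.mr_eval_hom monoid_ring_evalI A.is_cring comm_monoid_exponents) auto
  moreover have "mr_eval A A id (\<lambda>k. if k = {#} then \<one>\<^bsub>A\<^esub> else \<zero>\<^bsub>A\<^esub>) p = p {#}" if "p \<in> carrier Pol" for p
    using that unfolding poly_ring_def
    by (rule mr_eval_indicator[OF A.is_cring comm_monoid_exponents])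
  moreover have "p {#} \<in> carrier A" if "p \<in> carrier Pol" for p
    using that by (simp add: poly_ring_def monoid_ring_carrier)
  ultimately have h: "?h \<in> ring_hom Pol A"
    by (auto simp: ring_hom_def)
  have kills: "?h p = \<zero>\<^bsub>A\<^esub>" if "p \<in> I" for p
    using A.is_cring h _ _ that
    by (rule kills_I) (auto simp: pvar_def pconst_def single_def)
  note lift = quot_lift[OF Pol.is_cring A.is_cring h ideal_I]
  show "parts_proj \<in> ring_hom P A"
    unfolding parts_proj_def[abs_def] P_hom_iff using kills by (rule lift(3))
  show cl: "parts_proj (parts_class A d \<sigma> x 1 p) = p {#}" if "p \<in> carrier Pol" for p
    unfolding parts_proj_def parts_class_def using kills that by (rule lift(2))
  show "parts_proj (const a) = a" if "a \<in> carrier A"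
    using that by (simp add: parts_const_def cl) (simp add: pconst_def single_def)
  show "parts_proj (\<xi> i) = \<zero>\<^bsub>A\<^esub>" if "i \<in> {1..d}"
    unfolding parts_xi_def using that by (simp add: cl) (simp add: pvar_def single_def)
qed

lemma parts_proj_lincomb:
  assumes a: "a \<in> carrier A" and c: "c \<in> {1..d} \<rightarrow> carrier A"
  shows "parts_proj (lincomb a c) = a"
proof -
  interpret h: ring_hom_cring P A parts_proj
    by (intro ring_hom_cringI' P.is_cring A.is_cring parts_proj_hom)
  have c': "c j \<in> carrier A" if "j \<in> {1..d}" for j
    using c that by blast
  have "parts_proj (\<Oplus>\<^bsub>P\<^esub>j \<in> {1..d}. const (c j) \<otimes>\<^bsub>P\<^esub> \<xi> j) =
      (\<Oplus>\<^bsub>A\<^esub>j \<in> {1..d}. parts_proj (const (c j) \<otimes>\<^bsub>P\<^esub> \<xi> j))"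
    using c' by (subst h.hom_finsum) (auto simp: comp_def)
  also have "\<dots> = \<zero>\<^bsub>A\<^esub>"
    using c' by (intro A.add.finprod_one_eqI) (auto simp: parts_proj_const parts_proj_xi)
  finally show ?thesis
    unfolding lincomb_def using a c'
    by (subst h.hom_add) (auto intro!: P.finsum_closed simp: parts_proj_const)
qed

text \<open>Turns the description by \<open>THE\<close> into the second component of a ring
  homomorphism. Existence is \<open>P_lincomb\<close>, uniqueness is \<open>to_dual_lincomb\<close>,
  and the projection identifies the constant term as \<open>f\<close>.\<close>

lemma twisted_partial_eq:
  assumes \<theta>: "\<theta> f \<in> carrier P" "parts_proj (\<theta> f) = f" and i: "i \<in> {1..d}"
  shows "to_dual i (\<theta> f) = (f, twisted_partial A d \<sigma> x \<theta> i f)"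
proof -
  obtain a c where ac: "a \<in> carrier A" "c \<in> {1..d} \<rightarrow> carrier A" "\<theta> f = lincomb a c"
    using P_lincomb[OF \<theta>(1)] by blast
  then have a: "a = f"
    using \<theta>(2) parts_proj_lincomb by simp
  \<comment> \<open>\<open>THE\<close> ranges over extensional families; values outside
    \<open>{1..d}\<close> would otherwise spoil uniqueness.\<close>
  let ?c = "restrict c {1..d}"
  have c: "lincomb f c = lincomb f ?c"
    unfolding lincomb_def using ac
    by (intro arg_cong[of _ _ "\<lambda>z. const f \<oplus>\<^bsub>P\<^esub> z"] P.finsum_cong') (auto simp: Pi_iff)
  have "(THE c. c \<in> {1..d} \<rightarrow>\<^sub>E carrier A \<and> \<theta> f = lincomb f c) = ?c"
  proof (rule the_equality)
    show "?c \<in> {1..d} \<rightarrow>\<^sub>E carrier A \<and> \<theta> f = lincomb f ?c"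
      using ac c a by auto
    fix c' assume c': "c' \<in> {1..d} \<rightarrow>\<^sub>E carrier A \<and> \<theta> f = lincomb f c'"
    have "c' j = ?c j" if "j \<in> {1..d}" for j
      using to_dual_lincomb[OF that, of f c'] to_dual_lincomb[OF that, of f c] c' ac a that
      by (auto simp: PiE_def)
    then show "c' = ?c"
      using c' by (auto simp: PiE_def extensional_def fun_eq_iff)
  qed
  \<comment> \<open>\<open>lincomb\<close> was given the shape of the sum in
    \<open>twisted_partial\<close>, so it can be folded here.\<close>
  then have "twisted_partial A d \<sigma> x \<theta> i f = c i"
    unfolding twisted_partial_def lincomb_def[symmetric] using i by simp
  then show ?thesis
    using to_dual_lincomb[OF i] ac a by simp
qed

text \<open>The composite of \<open>\<theta>\<close> with \<open>to_dual i\<close> is the ring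
  homomorphism sending \<open>f\<close> to \<open>(f, \<delta> i f)\<close>; additivity, the product
  rule and the values on \<open>R\<close> and on \<open>x i\<close> are read off its second
  component.\<close>

lemma classical_iff_derivation:
  fixes R :: "'r top_ring"
  assumes \<theta>: "\<theta> \<in> ring_hom A P" and \<theta>x: "\<And>i. i \<in> {1..d} \<Longrightarrow> \<theta> (x i) = const (x i) \<oplus>\<^bsub>P\<^esub> \<xi> i"
    and \<theta>R: "\<And>r. r \<in> carrier R \<Longrightarrow> \<theta> (\<iota> r) = const (\<iota> r)"
    and proj: "\<And>f. f \<in> carrier A \<Longrightarrow> parts_proj (\<theta> f) = f"
    and \<iota>: "\<And>r. r \<in> carrier R \<Longrightarrow> \<iota> r \<in> carrier A"
    and \<sigma>: "\<And>i f. i \<in> {1..d} \<Longrightarrow> f \<in> carrier A \<Longrightarrow> \<sigma> i f \<in> carrier A"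
  defines "\<delta> \<equiv> twisted_partial A d \<sigma> x \<theta>"
  shows "classical_coordinates A d \<sigma> x \<delta> \<longleftrightarrow> (\<forall>i\<in>{1..d}. sigma_derivation R A \<iota> (\<sigma> i) (\<delta> i))"
proof -
  interpret \<theta>: ring_hom_cring A P \<theta>
    by (intro ring_hom_cringI' A.is_cring P.is_cring \<theta>)
  have dual: "to_dual i (\<theta> f) = (f, \<delta> i f)" if "i \<in> {1..d}" "f \<in> carrier A" for i f
    unfolding \<delta>_def using that by (intro twisted_partial_eq) (auto simp: proj)
  have \<delta>_closed [simp]: "\<delta> i f \<in> carrier A" if "i \<in> {1..d}" "f \<in> carrier A" for i f
    using ring_hom_closed[OF to_dual_hom, of i "\<theta> f"] dual[OF that] that by simp
  have \<delta>_add: "\<delta> i (f \<oplus>\<^bsub>A\<^esub> g) = \<delta> i f \<oplus>\<^bsub>A\<^esub> \<delta> i g" if "i \<in> {1..d}" "f \<in> carrier A" "g \<in> carrier A" for i f g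
    using ring_hom_add[OF to_dual_hom, of i "\<theta> f" "\<theta> g"] that dual[of i f] dual[of i g] dual[of i "f \<oplus>\<^bsub>A\<^esub> g"]
    by simp
  have \<delta>_mult: "\<delta> i (f \<otimes>\<^bsub>A\<^esub> g) = f \<otimes>\<^bsub>A\<^esub> \<delta> i g \<oplus>\<^bsub>A\<^esub> g \<otimes>\<^bsub>A\<^esub> \<delta> i f \<oplus>\<^bsub>A\<^esub> \<delta> i f \<otimes>\<^bsub>A\<^esub> \<delta> i g \<otimes>\<^bsub>A\<^esub> s i"
    if "i \<in> {1..d}" "f \<in> carrier A" "g \<in> carrier A" for i f g
    using ring_hom_mult[OF to_dual_hom, of i "\<theta> f" "\<theta> g"] that dual[of i f] dual[of i g] dual[of i "f \<otimes>\<^bsub>A\<^esub> g"]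
    by simp
  have \<delta>_R: "\<delta> i (\<iota> r) = \<zero>\<^bsub>A\<^esub>" if "i \<in> {1..d}" "r \<in> carrier R" for i r
    using that dual[of i "\<iota> r"] by (simp add: \<theta>R \<iota> to_dual_const)
  have \<delta>_x: "\<delta> i (x i) = \<one>\<^bsub>A\<^esub>" if "i \<in> {1..d}" for i
    using that dual[of i "x i"]
    by (simp add: \<theta>x ring_hom_add[OF to_dual_hom] to_dual_const to_dual_xi)
  \<comment> \<open>Scalars come out by the product rule, because \<open>\<delta> i\<close> vanishes
    on the image of \<open>R\<close>.\<close>
  have linear: "R_linear R A \<iota> (\<delta> i)" if "i \<in> {1..d}" for i
    unfolding R_linear_def using that by (auto simp: \<delta>_add \<delta>_mult \<delta>_R \<iota>)
  have mult: "\<delta> i (f \<otimes>\<^bsub>A\<^esub> g) = f \<otimes>\<^bsub>A\<^esub> \<delta> i g \<oplus>\<^bsub>A\<^esub> (g \<oplus>\<^bsub>A\<^esub> s i \<otimes>\<^bsub>A\<^esub> \<delta> i g) \<otimes>\<^bsub>A\<^esub> \<delta> i f"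
    if "i \<in> {1..d}" "f \<in> carrier A" "g \<in> carrier A" for i f g
    using that by (simp add: \<delta>_mult A.l_distr A.r_distr A.m_ac A.a_ac)
  show ?thesis
  proof
    assume "classical_coordinates A d \<sigma> x \<delta>"
    then have "\<sigma> i f = f \<oplus>\<^bsub>A\<^esub> s i \<otimes>\<^bsub>A\<^esub> \<delta> i f" if "i \<in> {1..d}" "f \<in> carrier A" for i f
      using that unfolding classical_coordinates_def s_def by blast
    then show "\<forall>i\<in>{1..d}. sigma_derivation R A \<iota> (\<sigma> i) (\<delta> i)"
      unfolding sigma_derivation_def using linear mult by auto
  next
    assume der: "\<forall>i\<in>{1..d}. sigma_derivation R A \<iota> (\<sigma> i) (\<delta> i)"
    have "\<sigma> i f = f \<oplus>\<^bsub>A\<^esub> s i \<otimes>\<^bsub>A\<^esub> \<delta> i f" if i: "i \<in> {1..d}" and f: "f \<in> carrier A" for i f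
    proof -
      have "x i \<otimes>\<^bsub>A\<^esub> \<delta> i f \<oplus>\<^bsub>A\<^esub> \<sigma> i f \<otimes>\<^bsub>A\<^esub> \<delta> i (x i) = \<delta> i (x i \<otimes>\<^bsub>A\<^esub> f)"
        using der i f unfolding sigma_derivation_def by simp
      also have "\<dots> = x i \<otimes>\<^bsub>A\<^esub> \<delta> i f \<oplus>\<^bsub>A\<^esub> (f \<oplus>\<^bsub>A\<^esub> s i \<otimes>\<^bsub>A\<^esub> \<delta> i f) \<otimes>\<^bsub>A\<^esub> \<delta> i (x i)"
        using i f by (intro mult) auto
      finally show ?thesis
        using i f \<sigma>[OF i f] by (simp add: \<delta>_x)
    qed
    then show "classical_coordinates A d \<sigma> x \<delta>"
      unfolding classical_coordinates_def s_def by blast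
  qed
qed

end

section \<open>Good coordinates\<close>

lemma sub_ring_simps [simp]:
  "carrier (sub_ring A S) = S" "monoid.mult (sub_ring A S) = monoid.mult A"
  "one (sub_ring A S) = one A" "zero (sub_ring A S) = zero A" "add (sub_ring A S) = add A"
  by (simp_all add: sub_ring_def)

lemma sub_ring_cring:
  assumes "cring A" "subring S A"
  shows "cring (sub_ring A S)"
proof -
  interpret A: cring A by fact
  have "cring (A\<lparr>carrier := S\<rparr>)"
    using assms subringE(1)[OF assms(2)] A.subcring_iff A.subcringI' by blast
  then show ?thesis
    by (rule cring_cong) auto
qed

lemma sub_ring_incl: "subring S A \<Longrightarrow> id \<in> ring_hom (sub_ring A S) A"
  using subringE(1)[of S A] by (auto simp: ring_hom_def)

lemma ring_hom_sub_ring: "h \<in> ring_hom U A \<Longrightarrow> h ` carrier U \<subseteq> S \<Longrightarrow> h \<in> ring_hom U (sub_ring A S)"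
  by (auto simp: ring_hom_def)

lemma single_sub_ring [simp]: "single (sub_ring A S) = single A"
  by (simp add: single_def fun_eq_iff)

lemma pvar_sub_ring [simp]: "pvar (sub_ring A S) = pvar A"
  by (simp add: pvar_def fun_eq_iff)

lemma pconst_sub_ring [simp]: "pconst (sub_ring A S) = pconst A"
  by (simp add: pconst_def fun_eq_iff)

lemma poly_ring_sub_ring:
  assumes A: "cring A" and S: "subring S A"
  shows "id \<in> ring_hom (poly_ring (sub_ring A S) d) (poly_ring A d)"
proof -
  interpret id: ring_hom_cring "sub_ring A S" A id
    by (intro ring_hom_cringI' sub_ring_cring A S sub_ring_incl)
  have sub: "S \<subseteq> carrier A"
    using S by (rule subringE)
  show ?thesis
  proof (rule ring_hom_memI)
    fix p q
    assume p: "p \<in> carrier (poly_ring (sub_ring A S) d)" and q: "q \<in> carrier (poly_ring (sub_ring A S) d)"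
    \<comment> \<open>\<open>finsum\<close> refers to the carrier of its ring, so the convolution
      sums in the subring and in \<open>A\<close> are matched by the inclusion homomorphism.\<close>
    have "finsum (sub_ring A S) (\<lambda>ab. p (fst ab) \<otimes>\<^bsub>A\<^esub> q (snd ab)) B =
        finsum A (\<lambda>ab. p (fst ab) \<otimes>\<^bsub>A\<^esub> q (snd ab)) B" for B
      using id.hom_finsum[of "\<lambda>ab. p (fst ab) \<otimes>\<^bsub>A\<^esub> q (snd ab)" B] p q id.R.m_closed
      by (auto simp: poly_ring_def monoid_ring_carrier comp_def Pi_def)
    then show "id (p \<otimes>\<^bsub>poly_ring (sub_ring A S) d\<^esub> q) = id p \<otimes>\<^bsub>poly_ring A d\<^esub> id q"
      by (simp add: poly_ring_def monoid_ring_def)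
  qed (use sub in \<open>auto simp: poly_ring_def monoid_ring_carrier monoid_ring_add monoid_ring_one\<close>)
qed

lemma poly_hom_eqI:
  assumes K: "cring K" and h: "h \<in> ring_hom (poly_ring K d) U" and h': "h' \<in> ring_hom (poly_ring K d) U"
    and c: "\<And>a. a \<in> carrier K \<Longrightarrow> h (pconst K a) = h' (pconst K a)"
    and v: "\<And>i. i \<in> {1..d} \<Longrightarrow> h (pvar K i) = h' (pvar K i)"
    and p: "p \<in> carrier (poly_ring K d)"
  shows "h p = h' p"
  using K p
proof (induction rule: poly_ring_induct)
  case (mult_var p i)
  then show ?case
    using v[of i] K by (simp add: ring_hom_mult[OF h] ring_hom_mult[OF h'])
qed (use c in \<open>auto simp: ring_hom_add[OF h] ring_hom_add[OF h']\<close>)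

lemma poly_hom_in_subring:
  assumes K: "cring K" and h: "h \<in> ring_hom (poly_ring K d) U" and Q: "subring Q U"
    and "\<And>a. a \<in> carrier K \<Longrightarrow> h (pconst K a) \<in> Q" "\<And>i. i \<in> {1..d} \<Longrightarrow> h (pvar K i) \<in> Q"
    and p: "p \<in> carrier (poly_ring K d)"
  shows "h p \<in> Q"
  using K p
proof (induction rule: poly_ring_induct)
  case (mult_var p i)
  then show ?case
    using assms subringE(6)[OF Q] K by (simp add: ring_hom_mult[OF h])
qed (use assms subringE(7)[OF Q] in \<open>auto simp: ring_hom_add[OF h]\<close>)

lemma huber_cring: "huber_ring A \<Longrightarrow> cring A"
  by (simp add: huber_ring_def topological_ring_def)

lemma ring_of_definition_subring: "ring_of_definition A S \<Longrightarrow> subring S A"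
  by (auto simp: ring_of_definition_def definition_pair_def)

lemma sigma_coordinates_Theta:
  "sigma_coordinates R A \<iota> d \<sigma> x \<Longrightarrow> is_Theta R A \<iota> d \<sigma> x n (Theta R A \<iota> d \<sigma> x n)"
proof -
  assume "sigma_coordinates R A \<iota> d \<sigma> x"
  then have "\<exists>!\<theta>. is_Theta R A \<iota> d \<sigma> x n \<theta>"
    unfolding sigma_coordinates_def by blast
  then show ?thesis
    unfolding Theta_def by (rule theI')
qed

locale good_coordinates =
  fixes R :: "'r top_ring" and A :: "'a top_ring" and \<iota> :: "'r \<Rightarrow> 'a"
    and d :: nat and \<sigma> :: "nat \<Rightarrow> 'a \<Rightarrow> 'a" and x :: "nat \<Rightarrow> 'a" and R\<^sub>0 A\<^sub>0
  assumes twisted: "twisted_algebra R A \<iota> d \<sigma>"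
    and good: "good_sigma_coordinates_model R A \<iota> d \<sigma> x R\<^sub>0 A\<^sub>0"
begin

abbreviation "R0 \<equiv> sub_ring R R\<^sub>0"
abbreviation "A0 \<equiv> sub_ring A A\<^sub>0"
abbreviation "\<phi> \<equiv> poly_eval R A \<iota> d x"
abbreviation "RX \<equiv> poly_top_ring R d"
abbreviation "RX0 \<equiv> sub_ring RX (carrier (poly_ring R0 d))"
abbreviation "P0 \<equiv> twisted_parts A0 d \<sigma> x 1"

lemma etale: "huber_morphism R A \<iota>" "\<And>i. i \<in> {1..d} \<Longrightarrow> x i \<in> carrier A" "ring_of_definition R R\<^sub>0"
    "good_model RX A \<phi> (carrier (poly_ring R0 d)) A\<^sub>0"
  and coordinates: "sigma_coordinates R0 A0 \<iota> d \<sigma> x"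
  using good unfolding good_sigma_coordinates_model_def good_etale_coordinates_model_def by auto

lemma cring_R: "cring R" and cring_A: "cring A" and \<iota>_hom: "\<iota> \<in> ring_hom R A"
  using etale(1) by (auto simp: huber_morphism_def intro: huber_cring)

lemma sub_R: "subring R\<^sub>0 R" and sub_A: "subring A\<^sub>0 A" and sub_RX: "subring (carrier (poly_ring R0 d)) RX"
  using etale(3,4) by (auto simp: good_model_def intro: ring_of_definition_subring)

lemma cring_R0: "cring R0" and cring_A0: "cring A0"
  by (intro sub_ring_cring cring_R cring_A sub_R sub_A)+

lemma RX_hom_iff [simp]: "ring_hom RX B = ring_hom (poly_ring R d) B" "carrier RX = carrier (poly_ring R d)"
    "one RX = one (poly_ring R d)"
  by (simp_all add: poly_top_ring_def)

lemma cring_RX: "cring RX"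
  unfolding poly_top_ring_def by (intro cring_with_topology poly_cring cring_R)

lemma cring_RX0: "cring RX0"
  by (intro sub_ring_cring cring_RX sub_RX)

lemma A0_closed: "a \<in> A\<^sub>0 \<Longrightarrow> a \<in> carrier A"
  using subringE(1)[OF sub_A] by blast

lemma R0_closed: "r \<in> R\<^sub>0 \<Longrightarrow> r \<in> carrier R"
  using subringE(1)[OF sub_R] by blast

lemma \<phi>_hom: "\<phi> \<in> ring_hom (poly_ring R d) A"
  and \<phi>_const: "r \<in> carrier R \<Longrightarrow> \<phi> (pconst R r) = \<iota> r"
  and \<phi>_var: "i \<in> {1..d} \<Longrightarrow> \<phi> (pvar R i) = x i"
  using etale(2)
  by (auto intro!: poly_eval_hom poly_eval_pconst poly_eval_pvar cring_R cring_A \<iota>_hom)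

lemma \<phi>_A0: "p \<in> carrier (poly_ring R0 d) \<Longrightarrow> \<phi> p \<in> A\<^sub>0"
  using etale(4) by (auto simp: good_model_def)

text \<open>R0[X] occurs in two forms: as a subring of R[X], the base of the tensor product in
  \<open>good_model\<close>, and as the polynomial ring over \<open>R0\<close>, to which polynomial
  induction applies.\<close>

lemma \<phi>_hom0: "\<phi> \<in> ring_hom RX0 A0" "\<phi> \<in> ring_hom (poly_ring R0 d) A0"
proof -
  have "\<phi> \<circ> id \<in> ring_hom RX0 A"
    using sub_ring_incl[OF sub_RX] \<phi>_hom by (intro ring_hom_trans[of id RX0 RX]) auto
  then show "\<phi> \<in> ring_hom RX0 A0"
    using \<phi>_A0 by (intro ring_hom_sub_ring) auto
  have "\<phi> \<circ> id \<in> ring_hom (poly_ring R0 d) A"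
    using poly_ring_sub_ring[OF cring_R sub_R] \<phi>_hom by (rule ring_hom_trans)
  then show "\<phi> \<in> ring_hom (poly_ring R0 d) A0"
    using \<phi>_A0 by (intro ring_hom_sub_ring) auto
qed

lemma twisted0: "twisted_algebra R0 A0 \<iota> d \<sigma>" "\<And>i. i \<in> {1..d} \<Longrightarrow> x i \<in> A\<^sub>0"
  using coordinates by (auto simp: sigma_coordinates_def)

lemma \<iota>_hom0: "\<iota> \<in> ring_hom R0 A0"
  using twisted0(1) by (auto simp: twisted_algebra_def adic_morphism_def huber_morphism_def)

lemma \<sigma>_hom: "i \<in> {1..d} \<Longrightarrow> \<sigma> i \<in> ring_hom A A" and \<sigma>_hom0: "i \<in> {1..d} \<Longrightarrow> \<sigma> i \<in> ring_hom A0 A0"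
  using twisted twisted0(1) by (auto simp: twisted_algebra_def)

sublocale tp: twisted_parts_ring A d \<sigma> x
  using etale(2) \<sigma>_hom
  by (intro twisted_parts_ring.intro twisted_parts_ring_axioms.intro cring_A) (auto intro: ring_hom_closed)

sublocale tp0: twisted_parts_ring A0 d \<sigma> x
proof (intro twisted_parts_ring.intro twisted_parts_ring_axioms.intro cring_A0)
  fix i assume "i \<in> {1..d}"
  then show "x i \<in> carrier A0" "\<sigma> i (x i) \<in> carrier A0"
    using twisted0(2)[of i] ring_hom_closed[OF \<sigma>_hom0, of i "x i"] by simp_all
qed

section \<open>Base change from \<open>P0\<close> to \<open>P\<close>\<close>

abbreviation "base_change \<equiv> coset_map (poly_ring A d) (twisted_ideal A d \<sigma> x 1) id"

text \<open>Induced by the inclusion of \<open>A0[\<xi>]\<close> into \<open>A[\<xi>]\<close>: the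
  relations over \<open>A0\<close> hold over \<open>A\<close>, so the map passes to the
  quotients.\<close>

lemma base_change_hom: "base_change \<in> ring_hom P0 tp.P"
  and base_change_class: "p \<in> carrier tp0.Pol \<Longrightarrow>
    base_change (parts_class A0 d \<sigma> x 1 p) = parts_class A d \<sigma> x 1 p"
proof -
  let ?h = "parts_class A d \<sigma> x 1"
  have h: "?h \<in> ring_hom tp0.Pol tp.P"
    using ring_hom_trans[OF poly_ring_sub_ring[OF cring_A sub_A] tp.class_hom] by simp
  interpret h: ring_hom_cring tp0.Pol tp.P ?h
    by (intro ring_hom_cringI' tp0.Pol.is_cring tp.P.is_cring h)
  interpret incl: ring_hom_cring A0 A id
    by (intro ring_hom_cringI' cring_A0 cring_A sub_ring_incl sub_A)
  have kills: "?h p = \<zero>\<^bsub>tp.P\<^esub>" if "p \<in> tp0.I" for p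
    using tp.P.is_cring h _ _ that
  proof (rule tp0.kills_I)
    fix i j assume "i \<in> {1..d}" "j \<in> {1..d}" "i \<noteq> j"
    then show "?h (pvar A0 i) \<otimes>\<^bsub>tp.P\<^esub> ?h (pvar A0 j) = \<zero>\<^bsub>tp.P\<^esub>"
      using tp.xi_mult[of i j] by (simp add: parts_xi_def)
  next
    fix i assume i: "i \<in> {1..d}"
    \<comment> \<open>Negation depends on the carrier; the inclusion homomorphism identifies the
      differences formed in \<open>A0\<close> and in \<open>A\<close>.\<close>
    have "x i \<ominus>\<^bsub>A0\<^esub> \<sigma> i (x i) = x i \<ominus>\<^bsub>A\<^esub> \<sigma> i (x i)"
      using incl.ring.hom_a_inv[of "\<sigma> i (x i)"] i tp0.\<sigma>_closed by (simp add: a_minus_def)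
    then show "?h (pvar A0 i) \<otimes>\<^bsub>tp.P\<^esub> (?h (pvar A0 i) \<oplus>\<^bsub>tp.P\<^esub> ?h (pconst A0 (x i \<ominus>\<^bsub>A0\<^esub> \<sigma> i (x i)))) = \<zero>\<^bsub>tp.P\<^esub>"
      using tp.xi_square[OF i] unfolding parts_xi_def parts_const_def by simp
  qed
  note lift = quot_lift[OF tp0.Pol.is_cring tp.P.is_cring h tp0.ideal_I]
  have U: "base_change X = \<Union> (?h ` X)" for X
    by (simp add: coset_map_def parts_class_def)
  show cl: "base_change (parts_class A0 d \<sigma> x 1 p) = ?h p" if "p \<in> carrier tp0.Pol" for p
    using lift(1)[OF kills that] by (simp add: U parts_class_def[of A0])
  \<comment> \<open>All representatives of a class have the same image, so the union in
    \<open>coset_map\<close> is one coset and agrees with \<open>the_elem\<close>.\<close>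
  have eq: "the_elem (?h ` X) = base_change X" if X: "X \<in> carrier (tp0.Pol Quot tp0.I)" for X
  proof -
    obtain p where p: "p \<in> carrier tp0.Pol" "X = tp0.I +>\<^bsub>tp0.Pol\<^esub> p"
      using X by (rule quot_carrierE)
    then show ?thesis
      using lift(1)[OF kills p(1)] by (simp add: U)
  qed
  have hom: "(\<lambda>X. the_elem (?h ` X)) \<in> ring_hom (tp0.Pol Quot tp0.I) tp.P"
    using kills by (rule lift(3))
  show "base_change \<in> ring_hom P0 tp.P"
    unfolding tp0.P_hom_iff
    by (rule ring.ring_hom_restrict[OF ideal.quotient_is_ring[OF tp0.ideal_I] hom eq])
qed

lemma base_change_const: "a \<in> A\<^sub>0 \<Longrightarrow> base_change (tp0.const a) = tp.const a"
  using base_change_class[of "pconst A0 a"] tp0.pc(1)[of a] by (simp add: parts_const_def)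

lemma base_change_xi: "i \<in> {1..d} \<Longrightarrow> base_change (tp0.\<xi> i) = tp.\<xi> i"
  using base_change_class[of "pvar A0 i"] tp0.pc(2)[of i] by (simp add: parts_xi_def)

lemma base_change_proj: "X \<in> carrier P0 \<Longrightarrow> parts_proj (base_change X) = parts_proj X"
proof -
  assume "X \<in> carrier P0"
  then obtain p where p: "p \<in> carrier tp0.Pol" "X = parts_class A0 d \<sigma> x 1 p"
    by (rule tp0.P_carrierE)
  then have "p \<in> carrier tp.Pol"
    using ring_hom_closed[OF poly_ring_sub_ring[OF cring_A sub_A]] by auto
  with p show ?thesis
    by (simp add: base_change_class tp.parts_proj_class tp0.parts_proj_class)
qed

section \<open>Homomorphisms into \<open>P\<close> from \<open>A0\<close> and from R[X]\<close>

definition \<Theta>\<^sub>0 :: "'a \<Rightarrow> (nat multiset \<Rightarrow> 'a) set" where "\<Theta>\<^sub>0 = Theta R0 A0 \<iota> d \<sigma> x 1"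

lemma is_Theta0: "is_Theta R0 A0 \<iota> d \<sigma> x 1 \<Theta>\<^sub>0"
  unfolding \<Theta>\<^sub>0_def by (rule sigma_coordinates_Theta[OF coordinates])

lemma \<Theta>\<^sub>0_hom: "\<Theta>\<^sub>0 \<in> ring_hom A0 P0"
  and \<Theta>\<^sub>0_R: "r \<in> R\<^sub>0 \<Longrightarrow> \<Theta>\<^sub>0 (\<iota> r) = tp0.const (\<iota> r)"
  and \<Theta>\<^sub>0_x: "i \<in> {1..d} \<Longrightarrow> \<Theta>\<^sub>0 (x i) = tp0.const (x i) \<oplus>\<^bsub>P0\<^esub> tp0.\<xi> i"
  and \<Theta>\<^sub>0_proj: "a \<in> A\<^sub>0 \<Longrightarrow> parts_proj (\<Theta>\<^sub>0 a) = a"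
  using is_Theta0 unfolding is_Theta_def adic_morphism_def huber_morphism_def
  by (simp_all del: tp0.P_hom_iff)

definition \<theta>\<^sub>0 :: "'a \<Rightarrow> (nat multiset \<Rightarrow> 'a) set" where "\<theta>\<^sub>0 a = base_change (\<Theta>\<^sub>0 a)"

lemma \<theta>\<^sub>0_hom: "\<theta>\<^sub>0 \<in> ring_hom A0 tp.P"
  using ring_hom_trans[OF \<Theta>\<^sub>0_hom base_change_hom] by (simp add: \<theta>\<^sub>0_def[abs_def] comp_def)

lemma \<theta>\<^sub>0_R: "r \<in> R\<^sub>0 \<Longrightarrow> \<theta>\<^sub>0 (\<iota> r) = tp.const (\<iota> r)"
  using ring_hom_closed[OF \<iota>_hom0] by (simp add: \<theta>\<^sub>0_def \<Theta>\<^sub>0_R base_change_const)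

lemma \<theta>\<^sub>0_x: "i \<in> {1..d} \<Longrightarrow> \<theta>\<^sub>0 (x i) = tp.const (x i) \<oplus>\<^bsub>tp.P\<^esub> tp.\<xi> i"
  using twisted0(2)
  by (simp add: \<theta>\<^sub>0_def \<Theta>\<^sub>0_x ring_hom_add[OF base_change_hom] base_change_const base_change_xi)

lemma \<theta>\<^sub>0_proj: "a \<in> A\<^sub>0 \<Longrightarrow> parts_proj (\<theta>\<^sub>0 a) = a"
  using ring_hom_closed[OF \<Theta>\<^sub>0_hom, of a] by (simp add: \<theta>\<^sub>0_def base_change_proj \<Theta>\<^sub>0_proj)

definition ev :: "(nat multiset \<Rightarrow> 'r) \<Rightarrow> (nat multiset \<Rightarrow> 'a) set" where
  "ev = poly_eval R tp.P (tp.const \<circ> \<iota>) d (\<lambda>i. tp.const (x i) \<oplus>\<^bsub>tp.P\<^esub> tp.\<xi> i)"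

lemma const_\<iota>_hom: "tp.const \<circ> \<iota> \<in> ring_hom R tp.P"
  using \<iota>_hom tp.const_hom by (rule ring_hom_trans)

lemma ev_hom: "ev \<in> ring_hom (poly_ring R d) tp.P"
  and ev_const: "r \<in> carrier R \<Longrightarrow> ev (pconst R r) = tp.const (\<iota> r)"
  and ev_var: "i \<in> {1..d} \<Longrightarrow> ev (pvar R i) = tp.const (x i) \<oplus>\<^bsub>tp.P\<^esub> tp.\<xi> i"
proof -
  have y: "tp.const (x i) \<oplus>\<^bsub>tp.P\<^esub> tp.\<xi> i \<in> carrier tp.P" if "i \<in> {1..d}" for i
    using that by simp
  note hyps = cring_R tp.P.is_cring const_\<iota>_hom y
  show "ev \<in> ring_hom (poly_ring R d) tp.P"
    unfolding ev_def using hyps by (rule poly_eval_hom)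
  show "ev (pconst R r) = tp.const (\<iota> r)" if "r \<in> carrier R"
    unfolding ev_def using poly_eval_pconst[OF hyps that] by simp
  show "ev (pvar R i) = tp.const (x i) \<oplus>\<^bsub>tp.P\<^esub> tp.\<xi> i" if "i \<in> {1..d}"
    unfolding ev_def using hyps that by (rule poly_eval_pvar)
qed

text \<open>The compatibility over R0[X] that lets \<open>ev\<close> and
  \<open>\<theta>\<^sub>0\<close> be glued to \<open>to_P\<close>; both sides are homomorphisms with
  the same values on constants and variables.\<close>

lemma ev_\<phi>:
  assumes p: "p \<in> carrier (poly_ring R0 d)"
  shows "ev p = \<theta>\<^sub>0 (\<phi> p)"
proof -
  have 1: "ev \<circ> id \<in> ring_hom (poly_ring R0 d) tp.P"
    using poly_ring_sub_ring[OF cring_R sub_R] ev_hom by (rule ring_hom_trans)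
  have 2: "\<theta>\<^sub>0 \<circ> \<phi> \<in> ring_hom (poly_ring R0 d) tp.P"
    using \<phi>_hom0(2) \<theta>\<^sub>0_hom by (rule ring_hom_trans)
  have "(ev \<circ> id) p = (\<theta>\<^sub>0 \<circ> \<phi>) p"
    by (rule poly_hom_eqI[OF cring_R0 1 2 _ _ p])
      (simp_all add: ev_const ev_var R0_closed \<phi>_const \<phi>_var \<theta>\<^sub>0_R \<theta>\<^sub>0_x)
  then show ?thesis
    by simp
qed

lemma ev_proj:
  assumes p: "p \<in> carrier (poly_ring R d)"
  shows "parts_proj (ev p) = \<phi> p"
proof -
  have 1: "parts_proj \<circ> ev \<in> ring_hom (poly_ring R d) A"
    using ev_hom tp.parts_proj_hom by (rule ring_hom_trans)
  have "(parts_proj \<circ> ev) p = \<phi> p"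
    by (rule poly_hom_eqI[OF cring_R 1 \<phi>_hom _ _ p])
      (simp_all add: ev_const ev_var \<phi>_const \<phi>_var tp.parts_proj_const tp.parts_proj_xi
        ring_hom_add[OF tp.parts_proj_hom] ring_hom_closed[OF \<iota>_hom])
  then show ?thesis
    by simp
qed

section \<open>Tensor products for a good model and their maps to \<open>A\<close> and
  \<open>P\<close>\<close>

sublocale X: tensor_product RX0 RX A0 id \<phi>
  using sub_ring_incl[OF sub_RX] \<phi>_hom0(1)
  by (intro tensor_product.intro ring_hom_cringI' cring_RX0 cring_RX cring_A0)

sublocale T: tensor_product R0 R A0 id \<iota>
  by (intro tensor_product.intro ring_hom_cringI' cring_R cring_R0 cring_A0 \<iota>_hom0 sub_ring_incl sub_R)

sublocale TP: tensor_product R0 R P0 id "tp0.const \<circ> \<iota>"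
  by (intro tensor_product.intro ring_hom_cringI' cring_R cring_R0 tp0.P.is_cring sub_ring_incl sub_R
      ring_hom_trans[OF \<iota>_hom0 tp0.const_hom])

definition to_A :: "((nat multiset \<Rightarrow> 'r) \<times> 'a \<Rightarrow> int) set \<Rightarrow> 'a" where
  "to_A = tensor_lift A \<phi> id"

definition to_P :: "((nat multiset \<Rightarrow> 'r) \<times> 'a \<Rightarrow> int) set \<Rightarrow> (nat multiset \<Rightarrow> 'a) set" where
  "to_P = tensor_lift tp.P ev \<theta>\<^sub>0"

lemmas to_A_hyps = cring_A \<phi>_hom[folded RX_hom_iff] sub_ring_incl[OF sub_A]
lemmas to_P_hyps = tp.P.is_cring ev_hom[folded RX_hom_iff] \<theta>\<^sub>0_hom

lemma to_A_iso: "to_A \<in> ring_iso X.ST A"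
  using etale(4) by (simp add: good_model_def to_A_def)

lemma to_A_pure: "p \<in> carrier (poly_ring R d) \<Longrightarrow> a \<in> A\<^sub>0 \<Longrightarrow>
    to_A (pure_tensor RX0 RX A0 id \<phi> p a) = \<phi> p \<otimes>\<^bsub>A\<^esub> a"
  unfolding to_A_def by (subst X.tensor_lift_pure[OF to_A_hyps]) auto

lemma to_P_hom: "to_P \<in> ring_hom X.ST tp.P"
  unfolding to_P_def by (rule X.tensor_lift_hom[OF to_P_hyps]) (simp add: ev_\<phi>)

lemma to_P_pure: "p \<in> carrier (poly_ring R d) \<Longrightarrow> a \<in> A\<^sub>0 \<Longrightarrow>
    to_P (pure_tensor RX0 RX A0 id \<phi> p a) = ev p \<otimes>\<^bsub>tp.P\<^esub> \<theta>\<^sub>0 a"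
  unfolding to_P_def by (subst X.tensor_lift_pure[OF to_P_hyps]) (auto simp: ev_\<phi>)

lemma to_P_proj: "W \<in> carrier X.ST \<Longrightarrow> parts_proj (to_P W) = to_A W"
  unfolding to_P_def to_A_def
  by (rule X.tensor_lift_comp[OF to_P_hyps _ cring_A tp.parts_proj_hom]) (auto simp: ev_\<phi> ev_proj \<theta>\<^sub>0_proj)

lemma pconst_tensor_hom:
  "(\<lambda>r. pure_tensor RX0 RX A0 id \<phi> (pconst R r) \<one>\<^bsub>A0\<^esub>) \<in> ring_hom R X.ST"
proof -
  have "pconst R \<in> ring_hom R RX"
    using pconst_hom[OF cring_R] by (simp add: poly_top_ring_def)
  from ring_hom_trans[OF this X.pure_left_hom] show ?thesis
    by (simp add: comp_def)
qed

text \<open>The map \<open>R \<otimes> A\<^sub>0 \<rightarrow> R[X] \<otimes> A\<^sub>0\<close>. As the map from the target to \<open>A\<close> is injective, \<^const>\<open>good_Theta\<close> does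
  not depend on the preimages in \<open>R \<otimes> A\<^sub>0\<close> that are chosen by \<^const>\<open>inv_into\<close>.\<close>

definition compare :: "('r \<times> 'a \<Rightarrow> int) set \<Rightarrow> ((nat multiset \<Rightarrow> 'r) \<times> 'a \<Rightarrow> int) set" where
  "compare = tensor_lift X.ST (\<lambda>r. pure_tensor RX0 RX A0 id \<phi> (pconst R r) \<one>\<^bsub>A0\<^esub>)
    (\<lambda>a. pure_tensor RX0 RX A0 id \<phi> \<one>\<^bsub>RX\<^esub> a)"

text \<open>An element of \<open>R0\<close> is a constant of R0[X], so the balancing over R0[X]
  moves it across the tensor sign.\<close>

lemma compare_balanced:
  assumes "r \<in> carrier R0"
  shows "pure_tensor RX0 RX A0 id \<phi> (pconst R (id r)) \<one>\<^bsub>A0\<^esub> = pure_tensor RX0 RX A0 id \<phi> \<one>\<^bsub>RX\<^esub> (\<iota> r)"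
  using X.pure_balanced[of "pconst R r"] assms pconst_closed[OF cring_R0, of r d]
  by (simp add: \<phi>_const R0_closed)

lemmas compare_hyps = X.cring_tensor pconst_tensor_hom X.pure_right_hom compare_balanced

lemma compare_closed: "w \<in> carrier T.ST \<Longrightarrow> compare w \<in> carrier X.ST"
  unfolding compare_def by (rule ring_hom_closed[OF T.tensor_lift_hom[OF compare_hyps]])

lemma to_A_left:
  assumes "r \<in> carrier R"
  shows "to_A (pure_tensor RX0 RX A0 id \<phi> (pconst R r) \<one>\<^bsub>A0\<^esub>) = \<iota> r"
  using assms subringE(3)[OF sub_A] ring_hom_closed[OF \<iota>_hom]
  by (simp add: to_A_pure cring_R \<phi>_const)

lemma to_A_right: "a \<in> A\<^sub>0 \<Longrightarrow> to_A (pure_tensor RX0 RX A0 id \<phi> \<one>\<^bsub>RX\<^esub> a) = a"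
  using X.f.S.one_closed by (simp add: to_A_pure ring_hom_one[OF \<phi>_hom] A0_closed)

lemma to_P_left:
  assumes "r \<in> carrier R"
  shows "to_P (pure_tensor RX0 RX A0 id \<phi> (pconst R r) \<one>\<^bsub>A0\<^esub>) = tp.const (\<iota> r)"
  using assms subringE(3)[OF sub_A] ring_hom_closed[OF \<iota>_hom] ring_hom_one[OF \<theta>\<^sub>0_hom]
  by (simp add: to_P_pure cring_R ev_const)

lemma to_P_right: "a \<in> A\<^sub>0 \<Longrightarrow> to_P (pure_tensor RX0 RX A0 id \<phi> \<one>\<^bsub>RX\<^esub> a) = \<theta>\<^sub>0 a"
  using X.f.S.one_closed ring_hom_closed[OF \<theta>\<^sub>0_hom, of a] by (simp add: to_P_pure ring_hom_one[OF ev_hom] del: tp.P_hom_iff)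

text \<open>\<open>compare\<close> is a map over \<open>A\<close>: a preimage of \<open>f\<close> in
  R \<otimes> \<open>A0\<close> goes to a preimage of \<open>f\<close> in R[X] \<otimes>
  \<open>A0\<close>.\<close>

lemma to_A_compare:
  assumes "w \<in> carrier T.ST"
  shows "to_A (compare w) = tensor_lift A \<iota> id w"
proof -
  have hom: "to_A \<in> ring_hom X.ST A"
    using to_A_iso by (simp add: ring_iso_def)
  show ?thesis
    unfolding compare_def
    by (rule T.tensor_lift_comp[OF compare_hyps cring_A hom assms])
      (simp_all only: to_A_left to_A_right sub_ring_simps(1), simp)
qed

lemma to_P_compare:
  assumes "w \<in> carrier T.ST"
  shows "to_P (compare w) = tensor_lift tp.P (tp.const \<circ> \<iota>) \<theta>\<^sub>0 w"
  unfolding compare_def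
  by (rule T.tensor_lift_comp[OF compare_hyps tp.P.is_cring to_P_hom assms])
    (simp_all only: to_P_left to_P_right sub_ring_simps(1) comp_apply)

text \<open>The image is a subring containing the images of \<open>R\<close> and \<open>A0\<close>.
  As the \<open>x i\<close> lie in \<open>A0\<close>, it contains \<phi>(R[X]) as well, hence
  everything reached by \<open>to_A\<close>, which is onto.\<close>

lemma to_A_surj:
  assumes "f \<in> carrier A"
  shows "f \<in> tensor_lift A \<iota> id ` carrier T.ST"
proof -
  note hyps = cring_A \<iota>_hom sub_ring_incl[OF sub_A]
  let ?h = "tensor_lift A \<iota> id"
  interpret h: ring_hom_cring T.ST A ?h
    by (intro ring_hom_cringI' T.cring_tensor cring_A T.tensor_lift_hom[OF hyps]) simp
  let ?Q = "?h ` carrier T.ST"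
  have Q: "subring ?Q A"
    by (rule h.ring.img_is_subring[OF h.R.carrier_is_subring])
  have Q_R: "\<iota> r \<in> ?Q" if "r \<in> carrier R" for r
    using that ring_hom_closed[OF \<iota>_hom]
    by (intro image_eqI[OF _ T.pure_closed[OF that tp0.A.one_closed]]) (simp add: T.tensor_lift_pure[OF hyps] subringE(3)[OF sub_A])
  have Q_A: "a \<in> ?Q" if "a \<in> A\<^sub>0" for a
    using that ring_hom_one[OF \<iota>_hom]
    by (intro image_eqI[OF _ T.pure_closed[OF T.f.S.one_closed]]) (auto simp: T.tensor_lift_pure[OF hyps] A0_closed)
  have Q_RX: "\<phi> p \<in> ?Q" if "p \<in> carrier (poly_ring R d)" for p
    by (rule poly_hom_in_subring[OF cring_R \<phi>_hom Q _ _ that])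
      (simp_all only: \<phi>_const \<phi>_var Q_R Q_A twisted0(2))
  obtain W where W: "W \<in> carrier X.ST" "f = to_A W"
    using to_A_iso assms by (auto simp: ring_iso_def bij_betw_def)
  show ?thesis
    unfolding W(2) to_A_def
    by (rule X.tensor_lift_in_subring[OF to_A_hyps _ Q W(1)]) (simp_all add: Q_RX Q_A del: image_iff)
qed

text \<open>Stated at \<open>to_A W\<close> in order to express \<open>good_Theta\<close> as
  \<open>to_P\<close> after the inverse of \<open>to_A\<close>, a composite of ring
  homomorphisms.\<close>

lemma good_Theta_to_A:
  assumes W: "W \<in> carrier X.ST"
  shows "good_Theta R A \<iota> d \<sigma> x R\<^sub>0 A\<^sub>0 1 (to_A W) = to_P W"
proof -
  define w where "w = inv_into (carrier T.ST) (tensor_lift A \<iota> id) (to_A W)"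
  have inj: "inj_on to_A (carrier X.ST)" and closed: "to_A W \<in> carrier A"
    using to_A_iso W by (auto simp: ring_iso_def bij_betw_def intro: ring_hom_closed)
  have w: "w \<in> carrier T.ST" "tensor_lift A \<iota> id w = to_A W"
    unfolding w_def using to_A_surj[OF closed] by (auto intro: inv_into_into f_inv_into_f)
  \<comment> \<open>Both sides have the same image under the injective map \<open>to_A\<close>,
    whichever \<open>w\<close> was chosen.\<close>
  then have "compare w = W"
    using inj_onD[OF inj] to_A_compare compare_closed W by metis
  let ?left = "\<lambda>r. pure_tensor R0 R P0 id (tp0.const \<circ> \<iota>) r \<one>\<^bsub>P0\<^esub>"
  let ?right = "\<lambda>y. pure_tensor R0 R P0 id (tp0.const \<circ> \<iota>) \<one>\<^bsub>R\<^esub> y"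
  let ?P = "tensor_lift tp.P (tp.const \<circ> \<iota>) base_change"
  have right: "(\<lambda>a. ?right (\<Theta>\<^sub>0 a)) \<in> ring_hom A0 TP.ST"
    using ring_hom_trans[OF \<Theta>\<^sub>0_hom TP.pure_right_hom] by (simp add: comp_def)
  have balanced: "?left (id r) = ?right (\<Theta>\<^sub>0 (\<iota> r))" if "r \<in> carrier R0" for r
    using that TP.pure_balanced[OF that] by (simp add: \<Theta>\<^sub>0_R)
  have bal: "(tp.const \<circ> \<iota>) (id r) = base_change ((tp0.const \<circ> \<iota>) r)" if "r \<in> carrier R0" for r
    using that ring_hom_closed[OF \<iota>_hom0, of r] by (simp add: base_change_const)
  note P_hyps = tp.P.is_cring const_\<iota>_hom base_change_hom bal
  have "good_Theta R A \<iota> d \<sigma> x R\<^sub>0 A\<^sub>0 1 (to_A W) = ?P (tensor_lift TP.ST ?left (\<lambda>a. ?right (\<Theta>\<^sub>0 a)) w)"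
    by (simp add: good_Theta_def Let_def w_def \<Theta>\<^sub>0_def)
  \<comment> \<open>The two lifts collapse into one by naturality: on \<open>R\<close> the composite
    is the constant map, on \<open>A0\<close> it is \<open>\<theta>\<^sub>0\<close>.\<close>
  also have "\<dots> = tensor_lift tp.P (tp.const \<circ> \<iota>) \<theta>\<^sub>0 w"
  proof (rule T.tensor_lift_comp[OF TP.cring_tensor TP.pure_left_hom right balanced tp.P.is_cring _ w(1)])
    show "?P \<in> ring_hom TP.ST tp.P"
      by (rule TP.tensor_lift_hom[OF P_hyps])
    show "(tp.const \<circ> \<iota>) r = ?P (?left r)" if "r \<in> carrier R" for r
      using that ring_hom_closed[OF \<iota>_hom that] ring_hom_one[OF base_change_hom]
      by (subst TP.tensor_lift_pure[OF P_hyps]) auto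
    show "\<theta>\<^sub>0 a = ?P (?right (\<Theta>\<^sub>0 a))" if "a \<in> carrier A0" for a
      using ring_hom_closed[OF \<Theta>\<^sub>0_hom that] ring_hom_closed[OF \<theta>\<^sub>0_hom that] ring_hom_one[OF const_\<iota>_hom]
      by (subst TP.tensor_lift_pure[OF P_hyps]) (auto simp: \<theta>\<^sub>0_def)
  qed
  also have "\<dots> = to_P W"
    using to_P_compare[OF w(1)] \<open>compare w = W\<close> by simp
  finally show ?thesis .
qed

section \<open>The properties required of \<Theta> in the good case\<close>

lemma good_Theta_hom: "good_Theta R A \<iota> d \<sigma> x R\<^sub>0 A\<^sub>0 1 \<in> ring_hom A tp.P"
  and good_Theta_proj: "f \<in> carrier A \<Longrightarrow> parts_proj (good_Theta R A \<iota> d \<sigma> x R\<^sub>0 A\<^sub>0 1 f) = f"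
proof -
  let ?inv = "inv_into (carrier X.ST) to_A"
  have inv: "?inv \<in> ring_hom A X.ST"
    using ring_iso_set_sym[OF _ to_A_iso] X.cring_tensor
    by (auto simp: ring_iso_def cring_def)
  have eq: "?inv f \<in> carrier X.ST" "to_A (?inv f) = f" if "f \<in> carrier A" for f
    using to_A_iso that by (auto simp: ring_iso_def bij_betw_def intro: inv_into_into f_inv_into_f)
  have comp: "to_P \<circ> ?inv \<in> ring_hom A tp.P"
    using inv to_P_hom by (rule ring_hom_trans)
  have Theta: "good_Theta R A \<iota> d \<sigma> x R\<^sub>0 A\<^sub>0 1 f = to_P (?inv f)" if "f \<in> carrier A" for f
    using good_Theta_to_A eq[OF that] by metis
  show "good_Theta R A \<iota> d \<sigma> x R\<^sub>0 A\<^sub>0 1 \<in> ring_hom A tp.P"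
    by (rule tp.A.ring_hom_restrict[OF comp]) (simp add: Theta)
  show "parts_proj (good_Theta R A \<iota> d \<sigma> x R\<^sub>0 A\<^sub>0 1 f) = f" if "f \<in> carrier A"
    using that eq[OF that] by (simp add: Theta to_P_proj)
qed

lemma good_Theta_R: "r \<in> carrier R \<Longrightarrow> good_Theta R A \<iota> d \<sigma> x R\<^sub>0 A\<^sub>0 1 (\<iota> r) = tp.const (\<iota> r)"
  using good_Theta_to_A[OF X.pure_closed, of "pconst R r" "\<one>\<^bsub>A0\<^esub>"] tp0.A.one_closed
  by (simp only: to_A_left to_P_left RX_hom_iff pconst_closed[OF cring_R])

text \<open>Since \<open>x i\<close> lies in \<open>A0\<close>, it is represented by the tensor 1
  \<otimes> x_i, where \<open>to_P\<close> is given by \<open>\<theta>\<^sub>0\<close>.\<close>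

lemma good_Theta_x: "i \<in> {1..d} \<Longrightarrow>
    good_Theta R A \<iota> d \<sigma> x R\<^sub>0 A\<^sub>0 1 (x i) = tp.const (x i) \<oplus>\<^bsub>tp.P\<^esub> tp.\<xi> i"
  using good_Theta_to_A[OF X.pure_closed[OF X.f.S.one_closed, of "x i"]] twisted0(2)[of i]
  by (simp only: to_A_right to_P_right \<theta>\<^sub>0_x sub_ring_simps(1))

lemma classical_iff_derivation_good:
  defines "\<delta> \<equiv> twisted_partial A d \<sigma> x (good_Theta R A \<iota> d \<sigma> x R\<^sub>0 A\<^sub>0 1)"
  shows "classical_coordinates A d \<sigma> x \<delta> \<longleftrightarrow> (\<forall>i\<in>{1..d}. sigma_derivation R A \<iota> (\<sigma> i) (\<delta> i))"
  unfolding \<delta>_def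
  by (rule tp.classical_iff_derivation[OF good_Theta_hom good_Theta_x good_Theta_R good_Theta_proj])
    (auto intro: ring_hom_closed[OF \<iota>_hom] ring_hom_closed[OF \<sigma>_hom])

end

lemma classical_iff_derivation_sigma:
  assumes "sigma_coordinates R A \<iota> d \<sigma> x"
  defines "\<delta> \<equiv> twisted_partial A d \<sigma> x (Theta R A \<iota> d \<sigma> x 1)"
  shows "classical_coordinates A d \<sigma> x \<delta> \<longleftrightarrow> (\<forall>i\<in>{1..d}. sigma_derivation R A \<iota> (\<sigma> i) (\<delta> i))"
proof -
  have tw: "twisted_algebra R A \<iota> d \<sigma>" and x: "\<And>i. i \<in> {1..d} \<Longrightarrow> x i \<in> carrier A"
    using assms(1) by (auto simp: sigma_coordinates_def)
  have A: "cring A" and \<iota>: "\<iota> \<in> ring_hom R A" and \<sigma>: "\<And>i. i \<in> {1..d} \<Longrightarrow> \<sigma> i \<in> ring_hom A A"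
    using tw by (auto simp: twisted_algebra_def adic_morphism_def huber_morphism_def intro: huber_cring)
  interpret twisted_parts_ring A d \<sigma> x
    using A x \<sigma> by (intro twisted_parts_ring.intro twisted_parts_ring_axioms.intro) (auto intro: ring_hom_closed)
  have "is_Theta R A \<iota> d \<sigma> x 1 (Theta R A \<iota> d \<sigma> x 1)"
    using assms(1) by (rule sigma_coordinates_Theta)
  then show ?thesis
    unfolding \<delta>_def is_Theta_def adic_morphism_def huber_morphism_def
    by (intro classical_iff_derivation) (auto intro: ring_hom_closed[OF \<iota>] ring_hom_closed[OF \<sigma>] simp del: P_hom_iff)
qed

text \<open>In the good case \<Theta>, and with it the derivations, is built from a chosen model, so
  the equivalence is claimed for each model separately.\<close>

theorem theorem5p11:
  fixes R :: "'r top_ring" and A :: "'a top_ring" and \<iota> :: "'r \<Rightarrow> 'a"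
    and d :: nat and \<sigma> :: "nat \<Rightarrow> 'a \<Rightarrow> 'a" and x :: "nat \<Rightarrow> 'a"
  assumes "huber_ring R"
    and "twisted_algebra R A \<iota> d \<sigma>"
    and "\<And>i. i \<in> {1..d} \<Longrightarrow> x i \<in> carrier A"
  shows "(sigma_coordinates R A \<iota> d \<sigma> x \<longrightarrow>
      (let \<delta> = twisted_partial A d \<sigma> x (Theta R A \<iota> d \<sigma> x 1)
       in classical_coordinates A d \<sigma> x \<delta> \<longleftrightarrow>
          (\<forall>i\<in>{1..d}. sigma_derivation R A \<iota> (\<sigma> i) (\<delta> i)))) \<and>
    (\<forall>R\<^sub>0 A\<^sub>0. good_sigma_coordinates_model R A \<iota> d \<sigma> x R\<^sub>0 A\<^sub>0 \<longrightarrow>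
      (let \<delta> = twisted_partial A d \<sigma> x (good_Theta R A \<iota> d \<sigma> x R\<^sub>0 A\<^sub>0 1)
       in classical_coordinates A d \<sigma> x \<delta> \<longleftrightarrow>
          (\<forall>i\<in>{1..d}. sigma_derivation R A \<iota> (\<sigma> i) (\<delta> i))))"
  using classical_iff_derivation_sigma
    good_coordinates.classical_iff_derivation_good[OF good_coordinates.intro[OF assms(2)]]
  by (simp only: Let_def) blast

end
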